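(* Let $(\mathbf{u},\mathbf{H})$ be a smooth solution on $\mathbb{R}^3$ of the stationary magneto-hydrodynamics system $$\operatorname{div}\mathbf{u}=0,\qquad \mathbf{u}\cdot\nabla\mathbf{u}-\Delta\mathbf{u}+\nabla p=\mathbf{H}\cdot\nabla\mathbf{H},\qquad \operatorname{div}\mathbf{H}=0,\qquad \mathbf{u}\cdot\nabla\mathbf{H}-\mathbf{H}\cdot\nabla\mathbf{u}=\Delta\mathbf{H},$$ with $\mathbf{u},\mathbf{H}\in BMO^{-1}(\mathbb{R}^3)$. If additionally $\mathbf{u},\mathbf{H}\in L^{q}(\mathbb{R}^3)$ for some $q\in(2,6)$, then $\mathbf{u}\equiv 0$ and $\mathbf{H}\equiv 0$.
   Context: Here $\mathbf{u},\mathbf{H}:\mathbb{R}^3\to\mathbb{R}^3$ are vector fields (fluid velocity and magnetic field) and $p:\mathbb{R}^3\to\mathbb{R}$ is the scalar pressure; $(\mathbf{u},\mathbf{H})$ is a smooth solution if the fields are smooth and the equations hold pointwise on $\mathbb{R}^3$ with some smooth pressure $p$. The notation $(\mathbf{a}\cdot\nabla\mathbf{b})_i=\sum_j a_j\,\partial_j b_i$ is used. Definition of $BMO^{-1}$: a vector field $\mathbf{f}$ on $\mathbb{R}^3$ belongs to $BMO^{-1}(\mathbb{R}^3)$ if there exists a skew-symmetric tensor field $d=(d_{ij})_{i,j=1}^3\in BMO(\mathbb{R}^3)$ such that $\mathbf{f}=\operatorname{div} d$, i.e. $f_i=\sum_{j}\partial_j d_{ij}$ for $i=1,2,3$ (in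 the sense of distributions). Here $BMO(\mathbb{R}^3)$ is the usual space of functions of bounded mean oscillation. *)

theory Defs
  imports "HOL-Analysis.Analysis"
begin

fun Ck_function :: "nat \<Rightarrow> ('a::real_normed_vector \<Rightarrow> 'b::real_normed_vector) \<Rightarrow> bool" where
  "Ck_function 0 f \<longleftrightarrow> continuous_on UNIV f"
| "Ck_function (Suc k) f \<longleftrightarrow>
     (\<forall>x. f differentiable (at x)) \<and>
     (\<forall>v. Ck_function k (\<lambda>x. frechet_derivative f (at x) v))"

definition smooth_function :: "('a::real_normed_vector \<Rightarrow> 'b::real_normed_vector) \<Rightarrow> bool" where
  "smooth_function f \<longleftrightarrow> (\<forall>k. Ck_function k f)"

definition partial_deriv ::
    "'n::finite \<Rightarrow> (real ^ 'n \<Rightarrow> 'b::real_normed_vector) \<Rightarrow> real ^ 'n \<Rightarrow> 'b" where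
  "partial_deriv j f x = frechet_derivative f (at x) (axis j 1)"

definition grad :: "(real ^ 'n::finite \<Rightarrow> real) \<Rightarrow> real ^ 'n \<Rightarrow> real ^ 'n" where
  "grad p x = (\<chi> i. partial_deriv i p x)"

definition divergence :: "(real ^ 'n::finite \<Rightarrow> real ^ 'n) \<Rightarrow> real ^ 'n \<Rightarrow> real" where
  "divergence u x = (\<Sum>j\<in>UNIV. partial_deriv j (\<lambda>y. u y $ j) x)"

definition laplacian :: "(real ^ 'n::finite \<Rightarrow> 'b::real_normed_vector) \<Rightarrow> real ^ 'n \<Rightarrow> 'b" where
  "laplacian f x = (\<Sum>j\<in>UNIV. partial_deriv j (partial_deriv j f) x)"

definition convection ::
    "(real ^ 'n::finite \<Rightarrow> real ^ 'n) \<Rightarrow> (real ^ 'n \<Rightarrow> real ^ 'n) \<Rightarrow> real ^ 'n \<Rightarrow> real ^ 'n" where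
  "convection a b x = (\<chi> i. \<Sum>j\<in>UNIV. a x $ j * partial_deriv j (\<lambda>y. b y $ i) x)"

definition stationary_MHD_solution ::
    "(real ^ 3 \<Rightarrow> real ^ 3) \<Rightarrow> (real ^ 3 \<Rightarrow> real ^ 3) \<Rightarrow> bool" where
  "stationary_MHD_solution u H \<longleftrightarrow>
     smooth_function u \<and> smooth_function H \<and>
     (\<exists>p :: real ^ 3 \<Rightarrow> real. smooth_function p \<and>
       (\<forall>x. divergence u x = 0 \<and>
            convection u u x - laplacian u x + grad p x = convection H H x \<and>
            divergence H x = 0 \<and>
            convection u H x - convection H u x = laplacian H x))"

definition locally_integrable :: "('a::euclidean_space \<Rightarrow> real) \<Rightarrow> bool" where
  "locally_integrable f \<longleftrightarrow> (\<forall>K. compact K \<longrightarrow> set_integrable lebesgue K f)"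

definition mean_on :: "'a::euclidean_space set \<Rightarrow> ('a \<Rightarrow> real) \<Rightarrow> real" where
  "mean_on B f = (LINT y:B|lebesgue. f y) / measure lebesgue B"

definition BMO :: "('a::euclidean_space \<Rightarrow> real) set" where
  "BMO = {f. locally_integrable f \<and>
             (\<exists>C. \<forall>x r. r > 0 \<longrightarrow>
                mean_on (ball x r) (\<lambda>y. \<bar>f y - mean_on (ball x r) f\<bar>) \<le> C)}"

definition test_function :: "('a::euclidean_space \<Rightarrow> real) \<Rightarrow> bool" where
  "test_function \<phi> \<longleftrightarrow> smooth_function \<phi> \<and> compact (closure {x. \<phi> x \<noteq> 0})"

text \<open>The identity \<open>f\<^sub>i = \<Sum>\<^sub>j \<partial>\<^sub>j d\<^sub>i\<^sub>j\<close> of distributions, tested against compactly supported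
  smooth functions. It is meaningful when all components of \<open>f\<close> and \<open>d\<close> are locally
  integrable.\<close>

definition is_weak_divergence ::
    "(real ^ 3 \<Rightarrow> real ^ 3) \<Rightarrow> (real ^ 3 \<Rightarrow> real ^ 3 ^ 3) \<Rightarrow> bool" where
  "is_weak_divergence f d \<longleftrightarrow>
     (\<forall>\<phi> i. test_function \<phi> \<longrightarrow>
        (LINT x|lebesgue. f x $ i * \<phi> x) =
        - (\<Sum>j\<in>UNIV. LINT x|lebesgue. d x $ i $ j * partial_deriv j \<phi> x))"

text \<open>Elements of \<open>BMO\<^sup>-\<^sup>1\<close> are in general distributions; this is the set of those that are
  represented by a locally integrable function.\<close>

definition BMO_inv :: "(real ^ 3 \<Rightarrow> real ^ 3) set" where
  "BMO_inv = {f. (\<forall>i. locally_integrable (\<lambda>x. f x $ i)) \<and>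
                 (\<exists>d :: real ^ 3 \<Rightarrow> real ^ 3 ^ 3.
                    (\<forall>x i j. d x $ i $ j = - d x $ j $ i) \<and>
                    (\<forall>i j. (\<lambda>x. d x $ i $ j) \<in> BMO) \<and>
                    is_weak_divergence f d)}"

definition Lebesgue_space :: "real \<Rightarrow> ('a::euclidean_space \<Rightarrow> 'b::euclidean_space) set" where
  "Lebesgue_space q = {f. f \<in> borel_measurable lebesgue \<and>
                          integrable lebesgue (\<lambda>x. norm (f x) powr q)}"

end

theory Submission
  imports Defs
begin

text \<open>Fix \<open>R \<ge> 1\<close>. Both fields have \<open>C\<^sup>1\<close> skew-symmetric potentials adapted to the scale \<open>R\<close>: mollify a
  \<open>BMO\<close> potential at scale \<open>R\<close>, and add the truncated Newtonian potential of the vorticity, which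
  recovers the difference between the field and its mollification. Let \<open>d\<close> be the potential of \<open>u\<close> and
  \<open>\<chi>\<close> a cutoff at scale \<open>R\<close>. Test the momentum equation with \<open>v\<^sub>i = \<Sum>\<^sub>j \<partial>\<^sub>j (\<chi> d\<^sub>i\<^sub>j)\<close>, which is divergence free
  and hence does not see the pressure, and the induction equation with \<open>\<chi> H\<close>. The nonlinear terms
  become products of potentials with fields, and the Dirichlet energy in a ball of radius \<open>R/2\<close> is bounded by
  \<open>R\<^sup>-\<^sup>2\<close> times weighted squares of the fields and potentials. The \<open>L\<^sup>q\<close> bound with \<open>2 < q < 6\<close>, interpolated
  against the \<open>BMO\<^sup>-\<^sup>1\<close> bound on bump averages, makes this \<open>O(R\<^sup>-\<^sup>a\<^sup>/\<^sup>2)\<close> for some \<open>a > 0\<close>. Hence both fields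
  are constant, and being in \<open>L\<^sup>q\<close> they vanish.\<close>

section \<open>Calculus with partial derivatives\<close>

text \<open>A \<open>BMO\<close> tensor is controlled only in mean oscillation and its divergence is
  only distributional, while the energy inequality needs one derivative of the potential and the
  products of squared fields with squared potentials. The splitting at scale R answers both. On the
  ball of radius 2R the mollified part is bounded, with gradient O(1/R). The other part is minus the
  integral over 0 < r < R of a function F(r, x) that, after an integration by parts, is a difference
  of bump averages of the field itself. The BMO^-1 bound |F| <= C/r fails to be integrable at 0 only
  logarithmically, so |F|^2 is split into (C/r)^(2-a) and |F|^a, and the last factor is paid for by
  the L^q norm. The gradient of this part comes from a Caccioppoli inequality, because its Laplacian
  is the curl of the field minus its mollification. The range of q enters through exponents: the
  integral of |u|^2 over a ball of radius 2R is O(R^(3-6/q)), which R^-2 beats because q < 6, while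
  q > 2 leaves room for the positive exponent a <= (q-2)/q in a Young inequality.\<close>

abbreviation pd :: "'n::finite \<Rightarrow> (real ^ 'n \<Rightarrow> real) \<Rightarrow> real ^ 'n \<Rightarrow> real" where
  "pd \<equiv> partial_deriv"

lemma vec_sum_axis: "(\<Sum>j\<in>UNIV. h $ j *\<^sub>R axis j 1) = (h :: real ^ 'n::finite)"
  using basis_expansion[of h] by (simp add: scalar_mult_eq_scaleR)

lemma has_derivative_pd:
  fixes f :: "real ^ 'n::finite \<Rightarrow> real"
  assumes "f differentiable (at x)"
  shows "(f has_derivative (\<lambda>h. \<Sum>j\<in>UNIV. h $ j * pd j f x)) (at x)"
proof -
  let ?D = "frechet_derivative f (at x)"
  have d: "(f has_derivative ?D) (at x)"
    using assms frechet_derivative_works by blast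
  then interpret bounded_linear ?D by (rule has_derivative_bounded_linear)
  have "?D h = (\<Sum>j\<in>UNIV. h $ j * pd j f x)" for h
  proof -
    have "?D h = ?D (\<Sum>j\<in>UNIV. h $ j *\<^sub>R axis j 1)" by (simp add: vec_sum_axis)
    then show ?thesis by (simp add: sum scaleR partial_deriv_def)
  qed
  then have "?D = (\<lambda>h. \<Sum>j\<in>UNIV. h $ j * pd j f x)" by blast
  with d show ?thesis by simp
qed

lemma pd_eq:
  assumes "(f has_derivative f') (at x)"
  shows "pd j f x = f' (axis j 1)"
  using frechet_derivative_at[OF assms] by (simp add: partial_deriv_def)

lemma pd_eq_sum:
  fixes f :: "real ^ 'n::finite \<Rightarrow> real"
  assumes "(f has_derivative (\<lambda>h. \<Sum>j\<in>UNIV. h $ j * g j)) (at x)"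
  shows "pd j f x = g j"
  using pd_eq[OF assms, of j] by (simp add: axis_def if_distrib[of "\<lambda>u. u * _"] cong: if_cong)

text \<open>Finite regularity in terms of scalar partial derivatives: the potentials at scale R are
  only shown to be \<open>C1\<close>, so the energy argument cannot be run with
  \<open>smooth_function\<close>.\<close>

definition C1 :: "(real ^ 'n::finite \<Rightarrow> real) \<Rightarrow> bool" where
  "C1 f \<longleftrightarrow> (\<forall>x. f differentiable (at x)) \<and> (\<forall>j. continuous_on UNIV (pd j f))"

definition C2 :: "(real ^ 'n::finite \<Rightarrow> real) \<Rightarrow> bool" where
  "C2 f \<longleftrightarrow> C1 f \<and> (\<forall>j. C1 (pd j f))"

lemma C1_has_derivative:
  "C1 f \<Longrightarrow> (f has_derivative (\<lambda>h. \<Sum>j\<in>UNIV. h $ j * pd j f x)) (at x)"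
  by (simp add: C1_def has_derivative_pd)

lemma C1_differentiable [simp]: "C1 f \<Longrightarrow> f differentiable (at x)"
  by (simp add: C1_def)

lemma C1_continuous_pd: "C1 f \<Longrightarrow> continuous_on A (pd j f)"
  using continuous_on_subset[of UNIV "pd j f" A] by (auto simp add: C1_def)

lemma C1_continuous: "C1 f \<Longrightarrow> continuous_on A f"
  by (meson C1_has_derivative continuous_at_imp_continuous_on has_derivative_continuous)

lemma C2_C1: "C2 f \<Longrightarrow> C1 f" and C2_C1_pd: "C2 f \<Longrightarrow> C1 (pd j f)"
  by (auto simp: C2_def)

lemma C1I:
  fixes f :: "real ^ 'n::finite \<Rightarrow> real"
  assumes "\<And>x. (f has_derivative (\<lambda>h. \<Sum>j\<in>UNIV. h $ j * g j x)) (at x)"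
    and "\<And>j. continuous_on UNIV (g j)"
  shows "C1 f" and "pd j f = g j"
proof -
  show *: "pd j f = g j" for j
    using pd_eq_sum[OF assms(1)] by blast
  show "C1 f"
    unfolding C1_def * using assms by (auto simp: differentiable_def)
qed

lemma
  fixes f g :: "real ^ 'n::finite \<Rightarrow> real"
  assumes "f differentiable (at x)" "g differentiable (at x)"
  shows pd_add: "pd j (\<lambda>x. f x + g x) x = pd j f x + pd j g x"
    and pd_diff: "pd j (\<lambda>x. f x - g x) x = pd j f x - pd j g x"
    and pd_mult: "pd j (\<lambda>x. f x * g x) x = pd j f x * g x + f x * pd j g x"
proof -
  note d = assms[THEN has_derivative_pd]
  show "pd j (\<lambda>x. f x + g x) x = pd j f x + pd j g x"
    by (rule pd_eq_sum) (rule derivative_eq_intros d refl | simp add: sum.distrib algebra_simps)+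
  show "pd j (\<lambda>x. f x - g x) x = pd j f x - pd j g x"
    by (rule pd_eq_sum) (rule derivative_eq_intros d refl | simp add: sum_subtractf algebra_simps)+
  show "pd j (\<lambda>x. f x * g x) x = pd j f x * g x + f x * pd j g x"
    by (rule pd_eq_sum) (rule derivative_eq_intros d refl | simp add: sum.distrib sum_distrib_left sum_distrib_right algebra_simps)+
qed

lemma pd_const [simp]: "pd j (\<lambda>x. c) x = 0"
  by (subst pd_eq[where f'="\<lambda>h. 0"]) auto

lemma pd_minus: "f differentiable (at x) \<Longrightarrow> pd j (\<lambda>x. - f x) x = - pd j f x"
  using pd_diff[of "\<lambda>x. 0" x f j] by simp

lemma pd_cmult: "f differentiable (at x) \<Longrightarrow> pd j (\<lambda>x. c * f x) x = c * pd j f x"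
  using pd_mult[of "\<lambda>x. c" x f j] by simp

lemma pd_sum:
  "finite I \<Longrightarrow> (\<And>i. i \<in> I \<Longrightarrow> f i differentiable (at x)) \<Longrightarrow>
    pd j (\<lambda>x. \<Sum>i\<in>I. f i x) x = (\<Sum>i\<in>I. pd j (f i) x)"
  by (induction I rule: finite_induct) (auto simp: pd_add)

lemma pd_power2: "f differentiable (at x) \<Longrightarrow> pd j (\<lambda>x. (f x)\<^sup>2) x = 2 * f x * pd j f x"
  by (simp add: power2_eq_square pd_mult)

lemma C1_const [simp]: "C1 (\<lambda>x. c)"
  by (simp add: C1_def fun_eq_iff[symmetric] cong: continuous_on_cong)

lemma C1_add [simp]: "C1 f \<Longrightarrow> C1 g \<Longrightarrow> C1 (\<lambda>x. f x + g x)"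
  unfolding C1_def by (auto simp: pd_add intro!: continuous_intros)

lemma C1_diff [simp]: "C1 f \<Longrightarrow> C1 g \<Longrightarrow> C1 (\<lambda>x. f x - g x)"
  unfolding C1_def by (auto simp: pd_diff intro!: continuous_intros)

lemma C1_mult [simp]: "C1 f \<Longrightarrow> C1 g \<Longrightarrow> C1 (\<lambda>x. f x * g x)"
  using C1_continuous[of f UNIV] C1_continuous[of g UNIV]
  unfolding C1_def by (auto simp: pd_mult intro!: continuous_intros)

lemma C1_minus [simp]: "C1 f \<Longrightarrow> C1 (\<lambda>x. - f x)"
  using C1_diff[of "\<lambda>x. 0" f] by simp

lemma C1_power2 [simp]: "C1 f \<Longrightarrow> C1 (\<lambda>x. (f x)\<^sup>2)"
  by (simp add: power2_eq_square)

lemma C1_sum [simp]: "(\<And>i. i \<in> I \<Longrightarrow> C1 (f i)) \<Longrightarrow> C1 (\<lambda>x. \<Sum>i\<in>I. f i x)"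
  by (induction I rule: infinite_finite_induct) auto

lemma
  fixes f g :: "real ^ 'n::finite \<Rightarrow> real"
  assumes "C1 f" "C1 g"
  shows pd_fun_add: "pd j (\<lambda>x. f x + g x) = (\<lambda>x. pd j f x + pd j g x)"
    and pd_fun_diff: "pd j (\<lambda>x. f x - g x) = (\<lambda>x. pd j f x - pd j g x)"
    and pd_fun_mult: "pd j (\<lambda>x. f x * g x) = (\<lambda>x. pd j f x * g x + f x * pd j g x)"
  using assms by (auto simp: pd_add pd_diff pd_mult)

lemma C2_add [simp]: "C2 f \<Longrightarrow> C2 g \<Longrightarrow> C2 (\<lambda>x. f x + g x)"
  by (auto simp: C2_def pd_fun_add)
lemma C2_diff [simp]: "C2 f \<Longrightarrow> C2 g \<Longrightarrow> C2 (\<lambda>x. f x - g x)"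
  by (auto simp: C2_def pd_fun_diff)
lemma C2_mult [simp]: "C2 f \<Longrightarrow> C2 g \<Longrightarrow> C2 (\<lambda>x. f x * g x)"
  by (auto simp: C2_def pd_fun_mult)

lemma has_vector_derivative_line:
  fixes f :: "real ^ 'n::finite \<Rightarrow> real"
  assumes "f differentiable (at (x + s *\<^sub>R v))"
  shows "((\<lambda>s. f (x + s *\<^sub>R v)) has_vector_derivative (\<Sum>j\<in>UNIV. v $ j * pd j f (x + s *\<^sub>R v))) (at s within S)"
proof -
  have "((\<lambda>s. f (x + s *\<^sub>R v)) has_derivative (\<lambda>h. \<Sum>j\<in>UNIV. (h *\<^sub>R v) $ j * pd j f (x + s *\<^sub>R v))) (at s)"
    by (rule has_derivative_compose[where g=f and f="\<lambda>s. x + s *\<^sub>R v", OF _ has_derivative_pd[OF assms]])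
       (auto intro!: derivative_eq_intros)
  then have "((\<lambda>s. f (x + s *\<^sub>R v)) has_vector_derivative (\<Sum>j\<in>UNIV. v $ j * pd j f (x + s *\<^sub>R v))) (at s)"
    by (simp add: has_vector_derivative_def sum_distrib_left mult.assoc)
  then show ?thesis by (rule has_vector_derivative_at_within)
qed

lemma mean_value_line:
  fixes f :: "real ^ 'n::finite \<Rightarrow> real"
  assumes "\<And>y. f differentiable (at y)"
  obtains t where "0 < t" "t < 1" "f (x + h) - f x = (\<Sum>j\<in>UNIV. h $ j * pd j f (x + t *\<^sub>R h))"
proof -
  have "\<exists>t\<in>{0<..<1}. f (x + 1 *\<^sub>R h) - f (x + 0 *\<^sub>R h) = (\<lambda>s. s * (\<Sum>j\<in>UNIV. h $ j * pd j f (x + t *\<^sub>R h))) (1 - 0)"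
    by (rule mvt_simple)
       (use has_vector_derivative_line[OF assms, of x h] in \<open>auto simp: has_vector_derivative_def\<close>)
  then show ?thesis using that by auto
qed

lemma abs_sum_le_card:
  fixes f :: "'n::finite \<Rightarrow> real"
  assumes "\<And>j. \<bar>f j\<bar> \<le> B"
  shows "\<bar>\<Sum>j\<in>UNIV. f j\<bar> \<le> real CARD('n) * B"
  using order_trans[OF sum_abs sum_mono[of UNIV "\<lambda>j. \<bar>f j\<bar>" "\<lambda>_. B"]] assms by simp

lemma pd_bounded_imp_Lipschitz:
  fixes f :: "real ^ 'n::finite \<Rightarrow> real"
  assumes "\<And>y. f differentiable (at y)" and B: "\<And>j y. \<bar>pd j f y\<bar> \<le> B"
  shows "\<bar>f (x + h) - f x\<bar> \<le> real CARD('n) * B * norm h"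
proof -
  obtain t where t: "f (x + h) - f x = (\<Sum>j\<in>UNIV. h $ j * pd j f (x + t *\<^sub>R h))"
    using mean_value_line[OF assms(1)] by metis
  have "\<bar>h $ j * pd j f (x + t *\<^sub>R h)\<bar> \<le> norm h * B" for j
    unfolding abs_mult by (intro mult_mono component_le_norm_cart B) auto
  from abs_sum_le_card[OF this] show ?thesis unfolding t by (simp add: algebra_simps)
qed

text \<open>The strict inequality makes the exterior open, so the vanishing passes to derivatives of
  every order with the same radius.\<close>

lemma pd_zero_outside:
  fixes f :: "real ^ 'n::finite \<Rightarrow> real"
  assumes "\<And>x. \<rho> < norm x \<Longrightarrow> f x = 0" and "\<rho> < norm x"
  shows "pd j f x = 0"
proof -
  have "(f has_derivative (\<lambda>h. 0)) (at x)"
    by (rule has_derivative_transform_within_open[of "\<lambda>x. 0" _ _ _ "- cball 0 \<rho>"]) (use assms in auto)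
  from pd_eq[OF this] show ?thesis by simp
qed

section \<open>Compact support and integrals of derivatives\<close>

lemma continuous_support_bounded:
  fixes f :: "'a::euclidean_space \<Rightarrow> real"
  assumes "continuous_on UNIV f" "\<And>x. \<rho> < norm x \<Longrightarrow> f x = 0"
  obtains B where "0 \<le> B" "\<And>x. \<bar>f x\<bar> \<le> B"
proof -
  have "bounded (f ` cball 0 \<rho>)"
    by (intro compact_imp_bounded compact_continuous_image continuous_on_subset[OF assms(1)]) auto
  then have "\<exists>B. \<forall>x\<in>cball 0 \<rho>. \<bar>f x\<bar> \<le> B"
    by (simp add: bounded_iff)
  then obtain B where B: "\<And>x. x \<in> cball 0 \<rho> \<Longrightarrow> \<bar>f x\<bar> \<le> B"
    by metis
  have "\<bar>f x\<bar> \<le> max B 0" for x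
    using B[of x] assms(2)[of x] by (cases "norm x \<le> \<rho>") auto
  then show ?thesis using that[of "max B 0"] by auto
qed

lemma integrable_continuous_support:
  fixes f :: "'a::euclidean_space \<Rightarrow> real"
  assumes "continuous_on UNIV f" "\<And>x. \<rho> < norm x \<Longrightarrow> f x = 0"
  shows "integrable lborel f"
proof -
  have "integrable lborel (\<lambda>x. indicator (cball 0 \<rho>) x *\<^sub>R f x)"
    by (intro borel_integrable_compact continuous_on_subset[OF assms(1)]) auto
  moreover have "(\<lambda>x. indicator (cball 0 \<rho>) x *\<^sub>R f x) = f"
    using assms(2) by (auto simp: indicator_def fun_eq_iff)
  ultimately show ?thesis by simp
qed

lemma lborel_integral_translate:
  fixes f :: "'a::euclidean_space \<Rightarrow> real"
  assumes [measurable]: "f \<in> borel_measurable borel"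
  shows "(\<integral>x. f (c + x) \<partial>lborel) = (\<integral>x. f x \<partial>lborel)"
proof -
  have "(\<integral>x. f x \<partial>lborel) = (\<integral>x. f x \<partial>(distr lborel borel ((+) c)))"
    by (simp add: lborel_distr_plus)
  also have "\<dots> = (\<integral>x. f (c + x) \<partial>lborel)" by (rule integral_distr) auto
  finally show ?thesis by simp
qed

text \<open>By translation invariance all difference quotients of \<open>f\<close> have integral zero.\<close>

lemma integral_pd_zero:
  fixes f :: "real ^ 'n::finite \<Rightarrow> real"
  assumes "C1 f" and supp: "\<And>x. \<rho> < norm x \<Longrightarrow> f x = 0"
  shows "(\<integral>x. pd j f x \<partial>lborel) = 0"
proof -
  have c: "continuous_on UNIV f" "continuous_on UNIV (pd j f)" for j
    by (rule C1_continuous[OF assms(1)] C1_continuous_pd[OF assms(1)])+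
  have [measurable]: "f \<in> borel_measurable borel" "pd j f \<in> borel_measurable borel"
    using c by (auto intro: borel_measurable_continuous_onI)
  have "\<exists>B\<ge>0. \<forall>x. \<bar>pd j f x\<bar> \<le> B" for j
    using continuous_support_bounded[OF c(2)[of j] pd_zero_outside[OF supp, of \<rho>]] by blast
  then obtain B where B: "\<And>j. B j \<ge> 0" "\<And>j x. \<bar>pd j f x\<bar> \<le> B j" by metis
  define M where "M = (\<Sum>j\<in>UNIV. B j)"
  have M: "\<bar>pd j f x\<bar> \<le> M" "M \<ge> 0" for j x
    unfolding M_def using B by (auto intro!: order_trans[OF B(2)] member_le_sum sum_nonneg)
  define e :: "real ^ 'n" where "e = axis j 1"
  \<comment> \<open>Difference quotients with step 1/(n+1). Steps of at most 1 keep all of them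
    supported in the ball of radius \<open>\<rho> + 1\<close>, and bounded partials give the
    Lipschitz bound that dominates them there.\<close>
  define s where "s = (\<lambda>n x. real (Suc n) * (f ((1 / real (Suc n)) *\<^sub>R e + x) - f x))"
  have ne: "norm e = 1" by (simp add: e_def)
  have shift: "f ((1 / real (Suc n)) *\<^sub>R e + x) = 0" if "\<rho> + 1 < norm x" for x n
  proof (rule supp)
    have "norm x \<le> norm ((1 / real (Suc n)) *\<^sub>R e + x) + norm ((1 / real (Suc n)) *\<^sub>R e)"
      by (metis add_diff_cancel_left' norm_triangle_ineq4 add.commute)
    moreover have "norm ((1 / real (Suc n)) *\<^sub>R e) \<le> 1" by (simp add: ne)
    ultimately show "\<rho> < norm ((1 / real (Suc n)) *\<^sub>R e + x)" using that by linarith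
  qed
  have s0: "(\<integral>x. s n x \<partial>lborel) = 0" for n
  proof -
    have "integrable lborel f" using integrable_continuous_support[OF c(1) supp] by simp
    moreover have "integrable lborel (\<lambda>x. f ((1 / real (Suc n)) *\<^sub>R e + x))"
    proof (rule integrable_continuous_support[where \<rho>="\<rho> + 1"])
      show "continuous_on UNIV (\<lambda>x. f ((1 / real (Suc n)) *\<^sub>R e + x))"
        by (intro continuous_on_compose2[OF c(1)] continuous_intros) auto
    qed (rule shift)
    ultimately show ?thesis
      unfolding s_def using lborel_integral_translate[of f "(1 / real (Suc n)) *\<^sub>R e"] by simp
  qed
  have "(\<lambda>n. \<integral>x. s n x \<partial>lborel) \<longlonglongrightarrow> (\<integral>x. pd j f x \<partial>lborel)"
  proof (rule integral_dominated_convergence)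
    show "integrable lborel (\<lambda>x. indicator (cball (0::real^'n) (\<rho>+1)) x *\<^sub>R (real CARD('n) * M))"
      by (intro borel_integrable_compact continuous_intros) auto
    show "AE x in lborel. (\<lambda>n. s n x) \<longlonglongrightarrow> pd j f x"
    proof (intro AE_I2)
      fix x
      have "(\<Sum>i\<in>UNIV. e $ i * pd i f x) = pd j f x"
        by (simp add: e_def axis_def if_distrib[of "\<lambda>u. u * _"] cong: if_cong)
      with has_vector_derivative_line[of f x 0 e UNIV]
      have "((\<lambda>t. f (x + t *\<^sub>R e)) has_real_derivative pd j f x) (at 0)"
        using assms(1) by (simp add: has_real_derivative_iff_has_vector_derivative)
      then have "((\<lambda>t. (f (x + t *\<^sub>R e) - f x) / t) \<longlongrightarrow> pd j f x) (at 0)"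
        by (simp add: DERIV_def)
      moreover have "filterlim (\<lambda>n. 1 / real (Suc n)) (at 0) sequentially"
        using LIMSEQ_inverse_real_of_nat unfolding filterlim_at by (auto simp: inverse_eq_divide)
      ultimately have "(\<lambda>n. (f (x + (1 / real (Suc n)) *\<^sub>R e) - f x) / (1 / real (Suc n))) \<longlonglongrightarrow> pd j f x"
        by (rule filterlim_compose)
      then show "(\<lambda>n. s n x) \<longlonglongrightarrow> pd j f x" by (simp add: s_def add.commute mult.commute)
    qed
    fix n
    show "s n \<in> borel_measurable lborel" unfolding s_def by measurable
    show "AE x in lborel. norm (s n x) \<le> indicator (cball 0 (\<rho>+1)) x *\<^sub>R (real CARD('n) * M)"
    proof (intro AE_I2)
      fix x
      show "norm (s n x) \<le> indicator (cball 0 (\<rho>+1)) x *\<^sub>R (real CARD('n) * M)"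
      proof (cases "norm x \<le> \<rho> + 1")
        case True
        have "\<bar>f (x + (1 / real (Suc n)) *\<^sub>R e) - f x\<bar> \<le> real CARD('n) * M * norm ((1 / real (Suc n)) *\<^sub>R e)"
          by (rule pd_bounded_imp_Lipschitz) (use M assms in auto)
        then have "real (Suc n) * \<bar>f ((1 / real (Suc n)) *\<^sub>R e + x) - f x\<bar>
            \<le> real (Suc n) * (real CARD('n) * M * (1 / real (Suc n)))"
          by (intro mult_left_mono) (simp_all add: ne add.commute)
        then show ?thesis using True by (simp add: s_def abs_mult del: of_nat_Suc)
      next
        case False
        then have "f ((1 / real (Suc n)) *\<^sub>R e + x) = 0" "f x = 0"
          using supp[of x] shift[of x n] by auto
        then show ?thesis using M(2) by (simp add: s_def)
      qed
    qed
  qed measurable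
  then show ?thesis by (simp add: s0 LIMSEQ_const_iff)
qed

section \<open>Parameter integrals and symmetry of second derivatives\<close>

text \<open>Leibniz rule over a compact box. The shape \<open>f (x - \<theta> p)\<close> is common
  to the averages (\<open>p = z\<close>), to the parametrix (\<open>p = (r, z)\<close>) and to the
  segment integrals in \<open>pd_commute\<close>.\<close>

lemma
  fixes f :: "real ^ 'n::finite \<Rightarrow> real" and \<theta> :: "'p::euclidean_space \<Rightarrow> real ^ 'n"
  assumes k: "continuous_on (cbox a b) k" and th: "continuous_on (cbox a b) \<theta>" and f: "C1 f"
  shows C1_integral_param: "C1 (\<lambda>x. integral (cbox a b) (\<lambda>p. k p * f (x - \<theta> p)))"
    and pd_integral_param:
      "pd j (\<lambda>x. integral (cbox a b) (\<lambda>p. k p * f (x - \<theta> p))) =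
         (\<lambda>x. integral (cbox a b) (\<lambda>p. k p * pd j f (x - \<theta> p)))"
proof -
  have k': "continuous_on (UNIV \<times> cbox a b) (\<lambda>z. k (snd z))"
    and th': "continuous_on (UNIV \<times> cbox a b) (\<lambda>z. \<theta> (snd z))"
    by (rule continuous_on_compose2[OF k]; force intro: continuous_intros)
       (rule continuous_on_compose2[OF th]; force intro: continuous_intros)
  have c: "continuous_on (UNIV \<times> cbox a b) (\<lambda>(x, p). k p * g (x - \<theta> p))"
    if "continuous_on UNIV g" for g :: "real ^ 'n \<Rightarrow> real"
    unfolding split_beta
    by (intro continuous_intros k' th' continuous_on_compose2[OF that]) auto
  have c1: "continuous_on (cbox a b) (\<lambda>p. k p * g (x - \<theta> p))"
    if "continuous_on UNIV g" for g :: "real ^ 'n \<Rightarrow> real" and x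
    by (intro continuous_intros k th continuous_on_compose2[OF that]) auto
  define G where "G = (\<lambda>x. \<chi> j. pd j f x)"
  have cG: "continuous_on UNIV G"
    unfolding G_def using f by (intro continuous_intros) (auto simp: C1_continuous_pd)
  have G: "(f has_derivative (\<lambda>h. h \<bullet> G x)) (at x)" for x
    using C1_has_derivative[OF f, of x] by (simp add: G_def inner_vec_def)
  \<comment> \<open>The Leibniz rule asks for a derivative that is continuous as a family of bounded
    linear maps, so the gradient is packed through the inner product.\<close>
  define fx where "fx = (\<lambda>x p. k p *\<^sub>R blinfun_inner_left (G (x - \<theta> p)))"
  have cfx: "continuous_on (UNIV \<times> cbox a b) (\<lambda>(x, p). fx x p)"
    unfolding fx_def split_beta
    by (intro continuous_intros k' th' continuous_on_compose2[OF cG]) auto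
  have cfx1: "continuous_on (cbox a b) (fx x)" for x
    unfolding fx_def by (intro continuous_intros k th continuous_on_compose2[OF cG]) auto
  have D: "((\<lambda>x. integral (cbox a b) (\<lambda>p. k p * f (x - \<theta> p))) has_derivative
      integral (cbox a b) (fx x)) (at x)" for x
  proof (rule leibniz_rule[where U=UNIV])
    show "((\<lambda>x. k t * f (x - \<theta> t)) has_derivative blinfun_apply (fx x t)) (at x)"
      if "t \<in> cbox a b" for x t
    proof -
      have "((\<lambda>x. k t * f (x - \<theta> t)) has_derivative (\<lambda>h. k t * (h \<bullet> G (x - \<theta> t)))) (at x)"
        by (intro has_derivative_mult_right has_derivative_compose[OF _ G]) (auto intro!: derivative_eq_intros)
      moreover have "blinfun_apply (fx x t) = (\<lambda>h. k t * (h \<bullet> G (x - \<theta> t)))"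
        by (simp add: fx_def blinfun.scaleR_left fun_eq_iff)
      ultimately show ?thesis by simp
    qed
    show "(\<lambda>p. k p * f (x - \<theta> p)) integrable_on cbox a b" for x
      by (rule integrable_continuous[OF c1]) (simp add: C1_continuous f)
  qed (use cfx in auto)
  have E: "integral (cbox a b) (fx x) h
      = (\<Sum>j\<in>UNIV. h $ j * integral (cbox a b) (\<lambda>p. k p * pd j f (x - \<theta> p)))" for x h
  proof -
    have "integral (cbox a b) (fx x) h = integral (cbox a b) (\<lambda>p. fx x p h)"
      by (rule blinfun_apply_integral) (rule integrable_continuous[OF cfx1])
    also have "\<dots> = integral (cbox a b) (\<lambda>p. \<Sum>j\<in>UNIV. h $ j * (k p * pd j f (x - \<theta> p)))"
      by (simp add: fx_def blinfun.scaleR_left inner_vec_def G_def sum_distrib_left algebra_simps)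
    also have "\<dots> = (\<Sum>j\<in>UNIV. integral (cbox a b) (\<lambda>p. h $ j * (k p * pd j f (x - \<theta> p))))"
      by (rule integral_sum)
         (auto intro!: integrable_continuous c1[of "pd _ f"] continuous_intros simp: f C1_continuous_pd)
    finally show ?thesis by simp
  qed
  have D': "((\<lambda>x. integral (cbox a b) (\<lambda>p. k p * f (x - \<theta> p))) has_derivative
      (\<lambda>h. \<Sum>j\<in>UNIV. h $ j * integral (cbox a b) (\<lambda>p. k p * pd j f (x - \<theta> p)))) (at x)" for x
    using D[of x] unfolding E[of x, THEN ext, symmetric, simplified] .
  have C: "continuous_on UNIV (\<lambda>x. integral (cbox a b) (\<lambda>p. k p * pd j f (x - \<theta> p)))" for j
    using integral_continuous_on_param[OF c[of "pd j f"]] f by (simp add: C1_continuous_pd)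
  show "C1 (\<lambda>x. integral (cbox a b) (\<lambda>p. k p * f (x - \<theta> p)))"
    and "pd j (\<lambda>x. integral (cbox a b) (\<lambda>p. k p * f (x - \<theta> p))) =
         (\<lambda>x. integral (cbox a b) (\<lambda>p. k p * pd j f (x - \<theta> p)))"
    using C1I[OF D' C] by auto
qed

text \<open>Both mixed derivatives have the same integral over each segment in direction \<open>i\<close>.\<close>

lemma pd_commute:
  fixes f :: "real ^ 'n::finite \<Rightarrow> real"
  assumes "C2 f"
  shows "pd i (pd j f) x = pd j (pd i f) x"
proof -
  define e :: "real ^ 'n" where "e = axis i 1"
  have e: "(\<Sum>k\<in>UNIV. e $ k * a k) = a i" for a :: "'n \<Rightarrow> real"
    by (simp add: e_def axis_def if_distrib[of "\<lambda>u. u * _"] cong: if_cong)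
  have line: "((\<lambda>s. g (y + s *\<^sub>R e)) has_vector_derivative pd i g (y + s *\<^sub>R e)) (at s within S)"
    if "C1 g" for g y s S
    using has_vector_derivative_line[of g y s e S] that by (simp add: e)
  have ftc: "integral (cbox 0 s) (\<lambda>t. pd i g (y + t *\<^sub>R e)) = g (y + s *\<^sub>R e) - g y"
    if "C1 g" "0 \<le> s" for g y s
    using fundamental_theorem_of_calculus[of 0 s "\<lambda>s. g (y + s *\<^sub>R e)" "\<lambda>t. pd i g (y + t *\<^sub>R e)"] line[OF that(1)] that(2)
    by (auto intro!: integral_unique)
  have cont: "continuous_on S (\<lambda>t. g (x + t *\<^sub>R e))" if "continuous_on UNIV g" for g :: "real ^ 'n \<Rightarrow> real" and S
    by (intro continuous_on_compose2[OF that] continuous_intros) auto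
  have eq: "integral (cbox 0 s) (\<lambda>t. pd i (pd j f) (x + t *\<^sub>R e)) = integral (cbox 0 s) (\<lambda>t. pd j (pd i f) (x + t *\<^sub>R e))"
    if s: "0 \<le> s" for s
  proof -
    \<comment> \<open>The derivative in direction \<open>j\<close> is taken out of the integral; the
      remaining integral of \<open>pd i f\<close> is evaluated by the fundamental theorem. The
      double minus fits the shape \<open>x - \<theta> p\<close>.\<close>
    have "integral (cbox 0 s) (\<lambda>t. pd j (pd i f) (x + t *\<^sub>R e))
        = pd j (\<lambda>x. integral (cbox 0 s) (\<lambda>t. 1 * pd i f (x - (- (t *\<^sub>R e))))) x"
      using assms by (subst pd_integral_param) (auto intro!: continuous_intros simp: C2_C1_pd)
    also have "(\<lambda>x. integral (cbox 0 s) (\<lambda>t. 1 * pd i f (x - (- (t *\<^sub>R e))))) = (\<lambda>x. f (s *\<^sub>R e + x) - f x)"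
      using ftc[OF C2_C1[OF assms] s] by (simp add: add.commute)
    also have "pd j \<dots> x = pd j f (s *\<^sub>R e + x) - pd j f x"
    proof -
      have "((\<lambda>x. f (s *\<^sub>R e + x) - f x) has_derivative
          (\<lambda>h. (\<Sum>j\<in>UNIV. h $ j * pd j f (s *\<^sub>R e + x)) - (\<Sum>j\<in>UNIV. h $ j * pd j f x))) (at x)"
        by (intro has_derivative_diff C1_has_derivative[OF C2_C1[OF assms]]
            has_derivative_compose[where g=f and f="\<lambda>x. s *\<^sub>R e + x", OF _ C1_has_derivative[OF C2_C1[OF assms]]])
           (auto intro!: derivative_eq_intros)
      then have "((\<lambda>x. f (s *\<^sub>R e + x) - f x) has_derivative
          (\<lambda>h. \<Sum>j\<in>UNIV. h $ j * (pd j f (s *\<^sub>R e + x) - pd j f x))) (at x)"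
        by (simp add: sum_subtractf algebra_simps)
      from pd_eq_sum[OF this] show ?thesis .
    qed
    also have "\<dots> = integral (cbox 0 s) (\<lambda>t. pd i (pd j f) (x + t *\<^sub>R e))"
      using ftc[OF C2_C1_pd[OF assms] s] by (simp add: add.commute)
    finally show ?thesis by simp
  qed
  have D: "((\<lambda>s. integral {0..s} (\<lambda>t. g (x + t *\<^sub>R e))) has_vector_derivative g (x + 0 *\<^sub>R e)) (at 0 within {0..1})"
    if "continuous_on UNIV g" for g :: "real ^ 'n \<Rightarrow> real"
    by (rule integral_has_vector_derivative[OF cont[OF that]]) auto
  \<comment> \<open>As functions of \<open>s\<close> in [0, 1] both integrals coincide, hence so do
    their one-sided derivatives at 0, which are the two integrands there.\<close>
  have "((\<lambda>s. integral {0..s} (\<lambda>t. pd i (pd j f) (x + t *\<^sub>R e))) has_vector_derivative pd j (pd i f) x) (at 0 within {0..1})"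
    by (rule has_vector_derivative_transform[OF _ _ D[of "pd j (pd i f)", simplified]])
       (use eq assms in \<open>auto simp: C1_continuous_pd C2_C1_pd\<close>)
  moreover have "((\<lambda>s. integral {0..s} (\<lambda>t. pd i (pd j f) (x + t *\<^sub>R e))) has_vector_derivative pd i (pd j f) x) (at 0 within {0..1})"
    using D[of "pd i (pd j f)"] assms by (simp add: C1_continuous_pd C2_C1_pd)
  ultimately show ?thesis
    by (intro vector_derivative_unique_within[rotated]) (auto simp: at_within_Icc_at_right)
qed

section \<open>From iterated Frechet derivatives to partial derivatives\<close>

lemma smooth_differentiable: "smooth_function f \<Longrightarrow> f differentiable (at x)"
proof -
  assume "smooth_function f"
  then have "Ck_function (Suc 0) f" by (simp only: smooth_function_def)
  then show ?thesis by simp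
qed

lemma smooth_partial_deriv: "smooth_function f \<Longrightarrow> smooth_function (partial_deriv j f)"
proof -
  assume "smooth_function f"
  then have "Ck_function (Suc k) f" for k by (simp only: smooth_function_def)
  then show ?thesis by (simp add: smooth_function_def partial_deriv_def[abs_def])
qed

lemma smooth_C1: "smooth_function f \<Longrightarrow> C1 f"
proof -
  assume "smooth_function f"
  then have "Ck_function (Suc 0) f" by (simp only: smooth_function_def)
  then show ?thesis by (simp add: C1_def partial_deriv_def[abs_def])
qed

lemma smooth_C2: "smooth_function f \<Longrightarrow> C2 f"
  by (simp add: C2_def smooth_C1 smooth_partial_deriv)

lemma smooth_component:
  fixes u :: "real ^ 'n::finite \<Rightarrow> real ^ 'm::finite"
  assumes "smooth_function u"
  shows "smooth_function (\<lambda>x. u x $ i)"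
proof -
  have "Ck_function k u \<Longrightarrow> Ck_function k (\<lambda>x. u x $ i)" for k and u :: "real ^ 'n \<Rightarrow> real ^ 'm"
  proof (induction k arbitrary: u)
    case 0
    then show ?case by (auto intro!: continuous_intros)
  next
    case (Suc k)
    have d: "((\<lambda>x. u x $ i) has_derivative (\<lambda>h. frechet_derivative u (at x) h $ i)) (at x)" for x
      using Suc.prems by (intro bounded_linear.has_derivative[OF bounded_linear_vec_nth])
        (simp add: frechet_derivative_works[symmetric])
    have "frechet_derivative (\<lambda>x. u x $ i) (at x) = (\<lambda>h. frechet_derivative u (at x) h $ i)" for x
      using frechet_derivative_at[OF d] by simp
    then show ?case
      using Suc d by (auto simp: differentiable_def)
  qed
  then show ?thesis using assms by (simp add: smooth_function_def)
qed

lemma smooth_affine: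
  fixes f :: "'a::real_normed_vector \<Rightarrow> 'b::real_normed_vector"
  assumes "smooth_function f"
  shows "smooth_function (\<lambda>x. f (c *\<^sub>R x + b))"
proof -
  have "Ck_function k f \<Longrightarrow> Ck_function k (\<lambda>x. f (c *\<^sub>R x + b))" for k and f :: "'a \<Rightarrow> 'b"
  proof (induction k arbitrary: f)
    case 0
    then have "continuous_on UNIV f" by simp
    then show ?case by (auto intro!: continuous_intros continuous_on_compose2[of UNIV f])
  next
    case (Suc k)
    have d: "((\<lambda>x. f (c *\<^sub>R x + b)) has_derivative (\<lambda>h. frechet_derivative f (at (c *\<^sub>R x + b)) (c *\<^sub>R h))) (at x)" for x
      using Suc.prems
      by (intro has_derivative_compose[where g=f and f="\<lambda>x. c *\<^sub>R x + b"])
         (auto simp add: frechet_derivative_works[symmetric] intro!: derivative_eq_intros)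
    have e: "frechet_derivative (\<lambda>x. f (c *\<^sub>R x + b)) (at x) = (\<lambda>h. frechet_derivative f (at (c *\<^sub>R x + b)) (c *\<^sub>R h))" for x
      using frechet_derivative_at[OF d] by simp
    have "Ck_function k (\<lambda>x. frechet_derivative f (at (c *\<^sub>R x + b)) (c *\<^sub>R v))" for v
      using Suc.IH[of "\<lambda>x. frechet_derivative f (at x) (c *\<^sub>R v)"] Suc.prems by simp
    then show ?case
      using d by (auto simp: differentiable_def e)
  qed
  then show ?thesis using assms by (simp add: smooth_function_def)
qed

lemma pd_affine:
  fixes f :: "real ^ 'n::finite \<Rightarrow> real"
  assumes "C1 f"
  shows "pd j (\<lambda>x. f (c *\<^sub>R x + b)) x = c * pd j f (c *\<^sub>R x + b)"
proof (rule pd_eq_sum)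
  have "((\<lambda>x. f (c *\<^sub>R x + b)) has_derivative (\<lambda>h. \<Sum>j\<in>UNIV. (c *\<^sub>R h) $ j * pd j f (c *\<^sub>R x + b))) (at x)"
    by (rule has_derivative_compose[where g=f and f="\<lambda>x. c *\<^sub>R x + b", OF _ C1_has_derivative[OF assms]])
       (auto intro!: derivative_eq_intros)
  then show "((\<lambda>x. f (c *\<^sub>R x + b)) has_derivative (\<lambda>h. \<Sum>j\<in>UNIV. h $ j * (c * pd j f (c *\<^sub>R x + b)))) (at x)"
    by (simp add: algebra_simps)
qed

section \<open>A bump function\<close>

text \<open>The standard flat function exp(-1/s), together with negative powers of s so that the
  family is closed under differentiation up to linear combinations.\<close>

definition exp_inv :: "nat \<Rightarrow> real \<Rightarrow> real" where
  "exp_inv n s = (if s > 0 then exp (- 1 / s) / s ^ n else 0)"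

lemma exp_inv_nonneg: "0 \<le> exp_inv n s"
  by (simp add: exp_inv_def)

lemma power_fact_le_exp: "x ^ n / fact n \<le> exp x" if "0 \<le> (x :: real)"
proof -
  have "(\<Sum>k\<in>{n}. x ^ k /\<^sub>R fact k) \<le> exp x"
    unfolding exp_def using that by (intro sum_le_suminf summable_exp_generic) auto
  then show ?thesis by (simp add: field_simps)
qed

text \<open>One term of the exponential series at \<open>1 / s\<close> beats the pole. The degree
  \<open>n + 2\<close> leaves \<open>s\<^sup>2\<close>, enough for the difference quotient at 0 to
  vanish in the limit.\<close>

lemma exp_inv_le: "exp_inv n s \<le> fact (n + 2) * s\<^sup>2"
proof (cases "s > 0")
  case True
  have "exp_inv n s = s\<^sup>2 * ((1 / s) ^ (n + 2) * exp (- (1 / s)))"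
    using True by (simp add: exp_inv_def field_simps power_add power2_eq_square)
  also have "\<dots> \<le> s\<^sup>2 * (fact (n + 2) * exp (1 / s) * exp (- (1 / s)))"
    using power_fact_le_exp[of "1 / s" "n + 2"] True
    by (intro mult_left_mono mult_right_mono) (auto simp: field_simps simp del: fact_Suc)
  also have "\<dots> = fact (n + 2) * s\<^sup>2" by (simp add: exp_minus field_simps)
  finally show ?thesis .
qed (simp add: exp_inv_def)

lemma exp_inv_has_real_derivative:
  "(exp_inv n has_real_derivative (exp_inv (n + 2) s - n * exp_inv (n + 1) s)) (at s)"
proof -
  consider "s > 0" | "s < 0" | "s = 0" by linarith
  then show ?thesis
  proof cases
    case 1
    have "((\<lambda>s. exp (- 1 / s)) has_real_derivative exp (- 1 / s) / s\<^sup>2) (at s)"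
      using 1 by (auto intro!: derivative_eq_intros simp: power2_eq_square)
    moreover have "((\<lambda>s. inverse s ^ n) has_real_derivative - (real n * inverse s ^ (n + 1))) (at s)"
    proof -
      have "real n * inverse s ^ (n - Suc 0) * inverse (s * s) = real n * inverse s ^ (n + 1)"
        by (cases n) auto
      moreover have "((\<lambda>s. inverse s ^ n) has_real_derivative - (real n * inverse s ^ (n - Suc 0) * inverse (s * s))) (at s)"
        using 1 by (auto intro!: derivative_eq_intros simp: algebra_simps)
      ultimately show ?thesis by (simp only:)
    qed
    ultimately have "((\<lambda>s. exp (- 1 / s) * inverse s ^ n) has_real_derivative
        exp (- 1 / s) / s\<^sup>2 * inverse s ^ n + - (real n * inverse s ^ (n + 1)) * exp (- 1 / s)) (at s)"
      by (rule DERIV_mult)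
    moreover have "exp (- 1 / s) / s\<^sup>2 * inverse s ^ n + - (real n * inverse s ^ (n + 1)) * exp (- 1 / s)
        = exp_inv (n + 2) s - n * exp_inv (n + 1) s"
      using 1 by (simp add: exp_inv_def power_add power2_eq_square divide_inverse power_inverse algebra_simps)
    ultimately have "((\<lambda>s. exp (- 1 / s) * inverse s ^ n) has_real_derivative
        exp_inv (n + 2) s - n * exp_inv (n + 1) s) (at s)" by simp
    then show ?thesis
      by (rule has_field_derivative_transform_within_open[where S="{0<..}"]) (use 1 in \<open>auto simp: exp_inv_def field_simps\<close>)
  next
    case 2
    have "((\<lambda>s. 0) has_real_derivative (exp_inv (n + 2) s - n * exp_inv (n + 1) s)) (at s)"
      using 2 by (simp add: exp_inv_def)
    then show ?thesis
      by (rule has_field_derivative_transform_within_open[where S="{..<0}"]) (use 2 in \<open>auto simp: exp_inv_def\<close>)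
  next
    case 3
    have "((\<lambda>h. exp_inv n h / h) \<longlongrightarrow> 0) (at 0)"
    proof (rule Lim_null_comparison)
      show "\<forall>\<^sub>F h in at 0. norm (exp_inv n h / h) \<le> fact (n + 2) * \<bar>h\<bar>"
      proof (rule always_eventually, rule allI)
        fix h :: real
        show "norm (exp_inv n h / h) \<le> fact (n + 2) * \<bar>h\<bar>"
          using exp_inv_le[of n h] exp_inv_nonneg[of n h]
          by (cases "h = 0") (auto simp: divide_simps power2_eq_square abs_mult simp del: fact_Suc split: abs_split)
      qed
      show "((\<lambda>h. fact (n + 2) * \<bar>h\<bar>) \<longlongrightarrow> 0) (at (0::real))"
        by (auto intro!: tendsto_eq_intros)
    qed
    then show ?thesis using 3 by (simp add: DERIV_def exp_inv_def)
  qed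
qed

text \<open>A class of functions closed under directional derivatives. Smoothness of all orders then
  follows by a single induction on the order.\<close>

inductive bump_alg :: "(real ^ 'n::finite \<Rightarrow> real) \<Rightarrow> bool" where
  const: "bump_alg (\<lambda>x. c)"
| comp: "bump_alg (\<lambda>x. x $ i)"
| radial: "bump_alg (\<lambda>x. exp_inv n (1 - x \<bullet> x))"
| add: "bump_alg f \<Longrightarrow> bump_alg g \<Longrightarrow> bump_alg (\<lambda>x. f x + g x)"
| mult: "bump_alg f \<Longrightarrow> bump_alg g \<Longrightarrow> bump_alg (\<lambda>x. f x * g x)"

lemma bump_alg_sum: "(\<And>i. i \<in> I \<Longrightarrow> bump_alg (f i)) \<Longrightarrow> bump_alg (\<lambda>x. \<Sum>i\<in>I. f i x)"
  by (induction I rule: infinite_finite_induct) (auto intro: bump_alg.const bump_alg.add)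

lemma bump_alg_derivative:
  assumes "bump_alg f"
  shows "\<exists>f'. (\<forall>v. bump_alg (\<lambda>x. f' x v)) \<and> (\<forall>x. (f has_derivative f' x) (at x))"
  using assms
proof induction
  case (const c)
  show ?case by (rule exI[of _ "\<lambda>x v. 0"]) (auto intro: bump_alg.const)
next
  case (comp i)
  show ?case by (rule exI[of _ "\<lambda>x v. v $ i"])
    (auto intro: bump_alg.const bounded_linear_imp_has_derivative bounded_linear_vec_nth)
next
  case (radial n)
  let ?f' = "\<lambda>(x::real^'a) v. (exp_inv (n + 2) (1 - x \<bullet> x) + (- real n) * exp_inv (n + 1) (1 - x \<bullet> x)) * ((- 2) * (\<Sum>i\<in>UNIV. x $ i * v $ i))"
  have "bump_alg (\<lambda>x. ?f' x v)" for v
    by (intro bump_alg.add bump_alg.mult bump_alg.const bump_alg.radial bump_alg_sum bump_alg.comp)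
  moreover have "((\<lambda>x. exp_inv n (1 - x \<bullet> x)) has_derivative ?f' x) (at x)" for x :: "real ^ 'a"
  proof -
    have "((\<lambda>x. 1 - x \<bullet> x) has_derivative (\<lambda>v. - 2 * (x \<bullet> v))) (at x)"
      by (auto intro!: derivative_eq_intros simp: inner_commute)
    from has_derivative_compose[OF this exp_inv_has_real_derivative[of n, unfolded has_field_derivative_def]]
    show ?thesis by (simp add: inner_vec_def algebra_simps)
  qed
  ultimately show ?case by (intro exI[of _ ?f']) blast
next
  case (add f g)
  then obtain f' g' where "\<And>v. bump_alg (\<lambda>x. f' x v)" "\<And>x. (f has_derivative f' x) (at x)"
    "\<And>v. bump_alg (\<lambda>x. g' x v)" "\<And>x. (g has_derivative g' x) (at x)" by metis
  then show ?case
    by (intro exI[of _ "\<lambda>x v. f' x v + g' x v"]) (auto intro: bump_alg.add has_derivative_add)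
next
  case (mult f g)
  then obtain f' g' where "\<And>v. bump_alg (\<lambda>x. f' x v)" "\<And>x. (f has_derivative f' x) (at x)"
    "\<And>v. bump_alg (\<lambda>x. g' x v)" "\<And>x. (g has_derivative g' x) (at x)" by metis
  then show ?case using mult.hyps
    by (intro exI[of _ "\<lambda>x v. f x * g' x v + f' x v * g x"] conjI allI bump_alg.add bump_alg.mult has_derivative_mult) auto
qed

lemma bump_alg_smooth:
  assumes "bump_alg f"
  shows "smooth_function f"
proof -
  have "bump_alg f \<Longrightarrow> Ck_function k f" for k and f :: "real ^ 'a \<Rightarrow> real"
  proof (induction k arbitrary: f)
    case 0
    then show ?case
      using bump_alg_derivative[OF 0] by (auto intro!: continuous_at_imp_continuous_on dest: has_derivative_continuous)
  next
    case (Suc k)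
    obtain f' where f': "\<And>v. bump_alg (\<lambda>x. f' x v)" "\<And>x. (f has_derivative f' x) (at x)"
      using bump_alg_derivative[OF Suc.prems] by metis
    have "frechet_derivative f (at x) = f' x" for x
      using frechet_derivative_at[OF f'(2)] by simp
    with Suc.IH f' show ?case by (auto simp: differentiable_def)
  qed
  then show ?thesis using assms by (simp add: smooth_function_def)
qed

text \<open>The mass of the unnormalised \<open>mollifier\<close>. The same factor divides
  \<open>bump\<close>, whose own integral is irrelevant; this keeps \<open>pd_bump\<close> free of
  constants.\<close>

definition bump_mass :: "'n::finite itself \<Rightarrow> real" where
  "bump_mass _ = (\<integral>z. 2 * exp_inv 2 (1 - z \<bullet> z) \<partial>(lborel :: (real ^ 'n) measure))"

definition bump :: "real ^ 'n::finite \<Rightarrow> real" where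
  "bump z = exp_inv 0 (1 - z \<bullet> z) / bump_mass TYPE('n)"

text \<open>\<open>exp_inv 2\<close> is the derivative of \<open>exp_inv 0\<close>, and the factor 2
  comes from differentiating \<open>z \<bullet> z\<close>.\<close>

definition mollifier :: "real ^ 'n::finite \<Rightarrow> real" where
  "mollifier z = 2 * exp_inv 2 (1 - z \<bullet> z) / bump_mass TYPE('n)"

lemma bump_smooth: "smooth_function bump"
proof -
  have "bump_alg (\<lambda>z :: real ^ 'n. inverse (bump_mass TYPE('n)) * exp_inv 0 (1 - z \<bullet> z))"
    by (intro bump_alg.intros)
  from bump_alg_smooth[OF this] show ?thesis by (simp add: bump_def[abs_def] field_simps)
qed

lemma mollifier_smooth: "smooth_function mollifier"
proof -
  have "bump_alg (\<lambda>z :: real ^ 'n. (2 * inverse (bump_mass TYPE('n))) * exp_inv 2 (1 - z \<bullet> z))"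
    by (intro bump_alg.intros)
  from bump_alg_smooth[OF this] show ?thesis by (simp add: mollifier_def[abs_def] field_simps)
qed

lemma inner_ge_one: "1 \<le> norm z \<Longrightarrow> 1 - z \<bullet> z \<le> 0" for z :: "'a::real_inner"
  by (simp add: dot_square_norm)

lemma bump_outside: "1 \<le> norm z \<Longrightarrow> bump z = 0"
  using inner_ge_one[of z] by (simp add: bump_def exp_inv_def)

lemma mollifier_outside: "1 \<le> norm z \<Longrightarrow> mollifier z = 0"
  using inner_ge_one[of z] by (simp add: mollifier_def exp_inv_def)

lemma bump_mass_pos: "0 < bump_mass TYPE('n::finite)"
proof -
  let ?f = "\<lambda>z :: real ^ 'n. 2 * exp_inv 2 (1 - z \<bullet> z)"
  have "bump_alg ?f" by (intro bump_alg.intros)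
  then have c: "continuous_on UNIV ?f"
    using bump_alg_smooth smooth_C1 C1_continuous by blast
  have int: "integrable lborel ?f"
    by (rule integrable_continuous_support[OF c, of 1])
       (use inner_ge_one in \<open>auto simp: exp_inv_def not_less dest!: less_imp_le\<close>)
  have "bump_mass TYPE('n) \<noteq> 0"
  proof
    assume "bump_mass TYPE('n) = 0"
    then have "AE z in lborel. ?f z = 0"
      using int by (simp add: bump_mass_def integral_nonneg_eq_0_iff_AE exp_inv_nonneg)
    then have "AE z in lborel. z \<notin> ball (0 :: real ^ 'n) 1"
      by (rule AE_mp) (auto simp: exp_inv_def dot_square_norm abs_square_eq_1 abs_square_less_1 not_le intro!: AE_I2)
    then have "emeasure lborel (ball (0 :: real ^ 'n) 1) = 0"
      by (subst (asm) AE_iff_measurable[OF _ refl]) (auto simp: ball_def)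
    then show False
      using content_ball_pos[of 1 "0 :: real ^ 'n"] by (simp add: measure_def)
  qed
  moreover have "0 \<le> bump_mass TYPE('n)"
    unfolding bump_mass_def by (intro integral_nonneg_AE) (simp add: exp_inv_nonneg)
  ultimately show ?thesis by simp
qed

text \<open>The reason for having two profiles: differentiating a \<open>mollifier\<close> average
  in the radius produces the factor \<open>- z $ j\<close>, which turns \<open>mollifier\<close>
  into a derivative of \<open>bump\<close>.\<close>

lemma pd_bump: "pd j bump z = - (z $ j) * mollifier z"
proof -
  have "((\<lambda>x. 1 - x \<bullet> x) has_derivative (\<lambda>v. - 2 * (z \<bullet> v))) (at z)"
    by (auto intro!: derivative_eq_intros simp: inner_commute)
  from has_derivative_compose[OF this exp_inv_has_real_derivative[of 0, unfolded has_field_derivative_def]]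
  have "(bump has_derivative (\<lambda>v. exp_inv 2 (1 - z \<bullet> z) * (- 2 * (z \<bullet> v)) / bump_mass TYPE('a))) (at z)"
    using has_derivative_mult_left[of _ _ _ "inverse (bump_mass TYPE('a))"]
    by (force simp: bump_def[abs_def] numeral_2_eq_2 divide_inverse)
  from pd_eq[OF this, of j] show ?thesis
    by (simp add: mollifier_def inner_axis)
qed

lemma integral_mollifier: "(\<integral>z. mollifier z \<partial>(lborel :: (real ^ 'n::finite) measure)) = 1"
  using bump_mass_pos[where 'n='n] by (simp add: mollifier_def bump_mass_def)

text \<open>The cutoffs are rescaled bumps without a plateau, so a positive lower bound on the half
  ball stands in for the value 1.\<close>

lemma bump_lower_bound:
  obtains c where "0 < c" "\<And>z :: real ^ 'n::finite. norm z \<le> 1 / 2 \<Longrightarrow> c \<le> bump z"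
proof
  \<comment> \<open>On the half ball \<open>1 - z \<bullet> z\<close> is at least 3/4, and -1/(3/4)
    = -4/3.\<close>
  show "0 < exp (- 4 / 3) / bump_mass TYPE('n)" by (simp add: bump_mass_pos)
  fix z :: "real ^ 'n"
  assume "norm z \<le> 1 / 2"
  then have "z \<bullet> z \<le> (1 / 2)\<^sup>2"
    unfolding dot_square_norm by (intro power_mono) auto
  then have "3 / 4 \<le> 1 - z \<bullet> z" by (simp add: power2_eq_square)
  then have "exp (- 4 / 3) \<le> exp_inv 0 (1 - z \<bullet> z)" by (simp add: exp_inv_def field_simps)
  then show "exp (- 4 / 3) / bump_mass TYPE('n) \<le> bump z"
    unfolding bump_def by (intro divide_right_mono) (auto simp: less_imp_le bump_mass_pos)
qed

section \<open>Divergences of compactly supported fields\<close>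

text \<open>Integration by parts in algebraic form: a whole integrand is exhibited as a divergence
  and integrated once, so integrability of its separate terms never enters the algebra.\<close>

definition cpt_divergence :: "real \<Rightarrow> (real ^ 'n::finite \<Rightarrow> real) \<Rightarrow> bool" where
  "cpt_divergence \<rho> D \<longleftrightarrow> (\<exists>F. (\<forall>k. C1 (F k)) \<and> (\<forall>k x. \<rho> < norm x \<longrightarrow> F k x = 0) \<and>
     D = (\<lambda>x. \<Sum>k\<in>UNIV. pd k (F k) x))"

lemma cpt_divergenceI:
  assumes "\<And>k. C1 (F k)" "\<And>k x. \<rho> < norm x \<Longrightarrow> F k x = 0"
    and "\<And>x. (\<Sum>k\<in>UNIV. pd k (F k) x) = D x"
  shows "cpt_divergence \<rho> D"
proof -
  have "D = (\<lambda>x. \<Sum>k\<in>UNIV. pd k (F k) x)" by (rule ext) (rule assms(3)[symmetric])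
  with assms(1,2) show ?thesis unfolding cpt_divergence_def by (intro exI[of _ F] conjI allI impI)
qed

lemma cpt_divergenceE:
  assumes "cpt_divergence \<rho> D"
  obtains F where "\<And>k. C1 (F k)" "\<And>k x. \<rho> < norm x \<Longrightarrow> F k x = 0" "D = (\<lambda>x. \<Sum>k\<in>UNIV. pd k (F k) x)"
  using assms unfolding cpt_divergence_def by auto

lemma cpt_divergence_pd:
  assumes "C1 f" "\<And>x. \<rho> < norm x \<Longrightarrow> f x = 0"
  shows "cpt_divergence \<rho> (pd j f)"
proof (rule cpt_divergenceI)
  fix k show "C1 ((if k = j then f else (\<lambda>x. 0)))" using assms by simp
next
  fix x show "(\<Sum>k\<in>UNIV. pd k (if k = j then f else (\<lambda>x. 0)) x) = pd j f x"
    by (subst sum.remove[of _ j]) (auto intro!: sum.neutral)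
qed (use assms in auto)

lemma cpt_divergence_add:
  assumes "cpt_divergence \<rho> D" "cpt_divergence \<rho> E"
  shows "cpt_divergence \<rho> (\<lambda>x. D x + E x)"
proof -
  obtain F where F: "\<And>k. C1 (F k)" "\<And>k x. \<rho> < norm x \<Longrightarrow> F k x = 0" "D = (\<lambda>x. \<Sum>k\<in>UNIV. pd k (F k) x)"
    by (rule cpt_divergenceE[OF assms(1)], rule that)
  obtain G where G: "\<And>k. C1 (G k)" "\<And>k x. \<rho> < norm x \<Longrightarrow> G k x = 0" "E = (\<lambda>x. \<Sum>k\<in>UNIV. pd k (G k) x)"
    by (rule cpt_divergenceE[OF assms(2)], rule that)
  show ?thesis using F G
    by (intro cpt_divergenceI[of "\<lambda>k x. F k x + G k x"]) (auto simp: pd_fun_add sum.distrib)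
qed

lemma cpt_divergence_minus:
  assumes "cpt_divergence \<rho> D"
  shows "cpt_divergence \<rho> (\<lambda>x. - D x)"
proof -
  obtain F where "\<And>k. C1 (F k)" "\<And>k x. \<rho> < norm x \<Longrightarrow> F k x = 0" "D = (\<lambda>x. \<Sum>k\<in>UNIV. pd k (F k) x)"
    by (rule cpt_divergenceE[OF assms], rule that)
  then show ?thesis
    by (intro cpt_divergenceI[of "\<lambda>k x. - F k x"]) (auto simp: pd_minus sum_negf)
qed

lemma cpt_divergence_diff:
  "cpt_divergence \<rho> D \<Longrightarrow> cpt_divergence \<rho> E \<Longrightarrow> cpt_divergence \<rho> (\<lambda>x. D x - E x)"
  using cpt_divergence_add[of \<rho> D "\<lambda>x. - E x"] cpt_divergence_minus[of \<rho> E] by simp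

lemma cpt_divergence_sum:
  "(\<And>i. i \<in> I \<Longrightarrow> cpt_divergence \<rho> (D i)) \<Longrightarrow> cpt_divergence \<rho> (\<lambda>x. \<Sum>i\<in>I. D i x)"
proof (induction I rule: infinite_finite_induct)
  case (insert i I)
  then show ?case by (auto intro: cpt_divergence_add)
qed (simp_all add: cpt_divergenceI[of "\<lambda>k x. 0"])

lemma cpt_divergence_integral:
  assumes "cpt_divergence \<rho> D"
  shows "(\<integral>x. D x \<partial>lborel) = 0"
proof -
  obtain F where F: "\<And>k. C1 (F k)" "\<And>k x. \<rho> < norm x \<Longrightarrow> F k x = 0" "D = (\<lambda>x. \<Sum>k\<in>UNIV. pd k (F k) x)"
    by (rule cpt_divergenceE[OF assms], rule that)
  have "integrable lborel (pd k (F k))" for k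
    by (rule integrable_continuous_support[of _ \<rho>])
       (use F in \<open>auto intro: C1_continuous_pd pd_zero_outside\<close>)
  then show ?thesis
    using F integral_pd_zero[OF F(1,2)] by simp
qed

text \<open>Green's identity for the equation of \<open>f\<close> tested with \<open>g\<close>; the
  underlying field is \<open>g\<close> times the gradient of \<open>f\<close>.\<close>

lemma cpt_divergence_laplacian:
  fixes f \<eta> :: "real ^ 'n::finite \<Rightarrow> real"
  assumes f: "C2 f" and g: "C1 g" and "\<And>x. \<rho> < norm x \<Longrightarrow> g x = 0"
  shows "cpt_divergence \<rho> (\<lambda>x. (\<Sum>k\<in>UNIV. pd k (pd k f) x) * g x + (\<Sum>k\<in>UNIV. pd k f x * pd k g x))"
  by (rule cpt_divergenceI[of "\<lambda>k x. pd k f x * g x"])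
     (use assms in \<open>auto simp: pd_fun_mult C2_C1_pd sum.distrib sum_distrib_right\<close>)

text \<open>The second derivatives of \<open>Q\<close> drop out because \<open>d\<close> is skew-symmetric.\<close>

lemma cpt_divergence_skew:
  fixes d :: "'n::finite \<Rightarrow> 'n \<Rightarrow> real ^ 'n \<Rightarrow> real"
  assumes Q: "C2 Q" and d: "\<And>j k. C1 (d j k)" and skew: "\<And>j k x. d j k x = - d k j x"
    and w: "\<And>j x. (\<Sum>k\<in>UNIV. pd k (d j k) x) = w j x"
    and \<eta>: "C1 \<eta>" "\<And>x. \<rho> < norm x \<Longrightarrow> \<eta> x = 0"
  shows "cpt_divergence \<rho> (\<lambda>x. \<eta> x * (\<Sum>j\<in>UNIV. w j x * pd j Q x)
           + (\<Sum>j\<in>UNIV. \<Sum>k\<in>UNIV. pd k \<eta> x * d j k x * pd j Q x))"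
proof (rule cpt_divergenceI[of "\<lambda>k x. \<Sum>j\<in>UNIV. \<eta> x * d j k x * pd j Q x"])
  fix x
  have "(\<Sum>j\<in>UNIV. \<Sum>k\<in>UNIV. d j k x * pd k (pd j Q) x) = (\<Sum>j\<in>UNIV. \<Sum>k\<in>UNIV. d k j x * pd j (pd k Q) x)"
    by (rule sum.swap)
  also have "\<dots> = (\<Sum>j\<in>UNIV. \<Sum>k\<in>UNIV. - (d j k x * pd k (pd j Q) x))"
  proof (intro sum.cong refl)
    fix j k
    show "d k j x * pd j (pd k Q) x = - (d j k x * pd k (pd j Q) x)"
      using skew[of k j x] pd_commute[OF Q, of j k x] by simp
  qed
  also have "\<dots> = - (\<Sum>j\<in>UNIV. \<Sum>k\<in>UNIV. d j k x * pd k (pd j Q) x)" by (simp add: sum_negf)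
  finally have 0: "(\<Sum>j\<in>UNIV. \<Sum>k\<in>UNIV. d j k x * pd k (pd j Q) x) = 0" by simp
  have "(\<Sum>k\<in>UNIV. pd k (\<lambda>x. \<Sum>j\<in>UNIV. \<eta> x * d j k x * pd j Q x) x)
      = (\<Sum>k\<in>UNIV. \<Sum>j\<in>UNIV. pd k \<eta> x * d j k x * pd j Q x + \<eta> x * pd k (d j k) x * pd j Q x
          + \<eta> x * (d j k x * pd k (pd j Q) x))"
    using Q d \<eta>(1) by (simp add: pd_sum pd_mult C2_C1_pd algebra_simps)
  also have "\<dots> = (\<Sum>j\<in>UNIV. \<Sum>k\<in>UNIV. pd k \<eta> x * d j k x * pd j Q x)
      + (\<Sum>j\<in>UNIV. \<Sum>k\<in>UNIV. \<eta> x * pd k (d j k) x * pd j Q x)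
      + (\<Sum>j\<in>UNIV. \<Sum>k\<in>UNIV. \<eta> x * (d j k x * pd k (pd j Q) x))"
    by (subst sum.swap) (simp add: sum.distrib)
  also have "(\<Sum>j\<in>UNIV. \<Sum>k\<in>UNIV. \<eta> x * (d j k x * pd k (pd j Q) x)) = 0"
    using 0 by (simp flip: sum_distrib_left)
  also have "(\<Sum>j\<in>UNIV. \<Sum>k\<in>UNIV. \<eta> x * pd k (d j k) x * pd j Q x) = \<eta> x * (\<Sum>j\<in>UNIV. w j x * pd j Q x)"
    by (simp add: w[symmetric] sum_distrib_left sum_distrib_right mult.assoc)
  finally show "(\<Sum>k\<in>UNIV. pd k (\<lambda>x. \<Sum>j\<in>UNIV. \<eta> x * d j k x * pd j Q x) x)
      = \<eta> x * (\<Sum>j\<in>UNIV. w j x * pd j Q x) + (\<Sum>j\<in>UNIV. \<Sum>k\<in>UNIV. pd k \<eta> x * d j k x * pd j Q x)"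
    by simp
qed (use Q d \<eta> in \<open>auto simp: C2_C1_pd\<close>)

section \<open>Absorption and the Caccioppoli inequality\<close>

text \<open>The integral of \<open>X\<close> is minus that of \<open>R\<close>, hence at most half
  of itself plus the integral of \<open>Z\<close>; since it is finite, the half can be subtracted.
  \<open>Z\<close> may lack compact support and is therefore integrated over the ball only.\<close>

lemma absorb_half:
  fixes X R Z :: "'a::euclidean_space \<Rightarrow> real"
  assumes 0: "(\<integral>x. X x + R x \<partial>lborel) = 0"
    and c: "continuous_on UNIV X" "continuous_on UNIV R" "continuous_on UNIV Z"
    and supp: "\<And>x. \<rho> < norm x \<Longrightarrow> X x = 0" "\<And>x. \<rho> < norm x \<Longrightarrow> R x = 0"
    and le: "\<And>x. \<bar>R x\<bar> \<le> X x / 2 + Z x"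
  shows "(\<integral>x. X x \<partial>lborel) \<le> 2 * (LINT x:cball 0 \<rho>|lborel. Z x)"
proof -
  have i: "integrable lborel X" "integrable lborel R"
    using c supp by (auto intro: integrable_continuous_support)
  have iZ: "integrable lborel (\<lambda>x. indicator (cball 0 \<rho>) x *\<^sub>R Z x)"
    by (intro borel_integrable_compact continuous_on_subset[OF c(3)]) auto
  have "(\<integral>x. X x \<partial>lborel) = (\<integral>x. - R x \<partial>lborel)"
    using 0 i by simp
  also have "\<dots> \<le> (\<integral>x. X x / 2 + indicator (cball 0 \<rho>) x *\<^sub>R Z x \<partial>lborel)"
  proof (rule integral_mono)
    fix x
    show "- R x \<le> X x / 2 + indicator (cball 0 \<rho>) x *\<^sub>R Z x"
      using le[of x] supp[of x] by (cases "norm x \<le> \<rho>") auto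
  qed (use i iZ in auto)
  also have "\<dots> = (\<integral>x. X x \<partial>lborel) / 2 + (LINT x:cball 0 \<rho>|lborel. Z x)"
    using i iZ by (simp add: set_lebesgue_integral_def)
  finally show ?thesis by simp
qed

lemma young_half: "a * b \<le> a\<^sup>2 / 2 + b\<^sup>2 / 2" for a b :: real
  using sum_squares_bound[of a b] by (simp add: power2_eq_square)

lemma abs_le_sqrt_sum:
  fixes f :: "'i \<Rightarrow> real"
  assumes "finite I" "i \<in> I"
  shows "\<bar>f i\<bar> \<le> sqrt (\<Sum>i\<in>I. (f i)\<^sup>2)"
  using member_le_sum[of i I "\<lambda>i. (f i)\<^sup>2"] assms by (intro real_le_rsqrt) auto

text \<open>The equation is tested with \<open>w\<^sup>2 * e\<close>, and the derivatives on
  \<open>a\<close> and \<open>b\<close> are moved to the test function. It serves to estimate the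
  gradient of the vorticity potential, with \<open>a\<close> and \<open>b\<close> the field
  components minus their mollifications.\<close>

lemma caccioppoli:
  fixes e a b w :: "real ^ 3 \<Rightarrow> real"
  assumes e: "C2 e" and a: "C1 a" and b: "C1 b"
    and eq: "\<And>x. (\<Sum>k\<in>UNIV. pd k (pd k e) x) = pd j a x - pd i b x"
    and w: "C1 w" "\<And>x. \<rho> < norm x \<Longrightarrow> w x = 0" "\<And>x. \<bar>w x\<bar> \<le> A" "\<And>k x. \<bar>pd k w x\<bar> \<le> A / \<rho>"
    and \<rho>: "0 < \<rho>"
  shows "(\<integral>x. (w x)\<^sup>2 * (\<Sum>k\<in>UNIV. (pd k e x)\<^sup>2) \<partial>lborel)
    \<le> 200 * A\<^sup>2 * (LINT x:cball 0 \<rho>|lborel. (a x)\<^sup>2 + (b x)\<^sup>2 + (e x)\<^sup>2 / \<rho>\<^sup>2)"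
proof -
  \<comment> \<open>Squaring leaves one factor \<open>w\<close> in \<open>pd k \<eta>\<close>; this
    factor accompanies each gradient of \<open>e\<close> that has to be absorbed.\<close>
  define \<eta> where "\<eta> = (\<lambda>x. (w x)\<^sup>2)"
  have \<eta>: "C1 \<eta>" "\<And>x. \<rho> < norm x \<Longrightarrow> \<eta> x = 0"
    using w by (auto simp: \<eta>_def)
  have pd\<eta>: "pd k \<eta> x = 2 * w x * pd k w x" for k x
    unfolding \<eta>_def using w by (simp add: pd_power2)
  define R where "R = (\<lambda>x. e x * (\<Sum>k\<in>UNIV. pd k e x * pd k \<eta> x)
      - a x * (pd j \<eta> x * e x + \<eta> x * pd j e x) + b x * (pd i \<eta> x * e x + \<eta> x * pd i e x))"
  define X where "X = (\<lambda>x. \<eta> x * (\<Sum>k\<in>UNIV. (pd k e x)\<^sup>2))"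
  have e1: "C1 e" using e by (rule C2_C1)
  \<comment> \<open>The last two terms are divergences that cancel the derivatives of
    \<open>a\<close> and \<open>b\<close> supplied by the equation.\<close>
  have "cpt_divergence \<rho> (\<lambda>x. ((\<Sum>k\<in>UNIV. pd k (pd k e) x) * (\<eta> x * e x) + (\<Sum>k\<in>UNIV. pd k e x * pd k (\<lambda>x. \<eta> x * e x) x))
      - pd j (\<lambda>x. a x * (\<eta> x * e x)) x + pd i (\<lambda>x. b x * (\<eta> x * e x)) x)"
    using e e1 a b \<eta>
    by (intro cpt_divergence_add cpt_divergence_diff cpt_divergence_laplacian cpt_divergence_pd) auto
  also have "(\<lambda>x. ((\<Sum>k\<in>UNIV. pd k (pd k e) x) * (\<eta> x * e x) + (\<Sum>k\<in>UNIV. pd k e x * pd k (\<lambda>x. \<eta> x * e x) x))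
      - pd j (\<lambda>x. a x * (\<eta> x * e x)) x + pd i (\<lambda>x. b x * (\<eta> x * e x)) x) = (\<lambda>x. X x + R x)"
    unfolding eq X_def R_def using e1 a b \<eta>
    by (simp add: pd_mult fun_eq_iff sum.distrib sum_distrib_left power2_eq_square algebra_simps)
  finally have 0: "(\<integral>x. X x + R x \<partial>lborel) = 0" by (rule cpt_divergence_integral)
  have le: "\<bar>R x\<bar> \<le> X x / 2 + 100 * A\<^sup>2 * ((a x)\<^sup>2 + (b x)\<^sup>2 + (e x)\<^sup>2 / \<rho>\<^sup>2)" for x
  proof -
    define g where "g = sqrt (\<Sum>k\<in>UNIV. (pd k e x)\<^sup>2)"
    have g: "\<bar>pd k e x\<bar> \<le> g" "0 \<le> g" for k
      unfolding g_def by (auto intro!: abs_le_sqrt_sum sum_nonneg)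
    have A: "0 \<le> A" using w(3)[of 0] by linarith
    have c1: "\<bar>pd k \<eta> x\<bar> \<le> 2 * (A / \<rho>) * \<bar>w x\<bar>" for k
      using mult_left_mono[OF w(4)[of k x], of "2 * \<bar>w x\<bar>"] by (simp add: pd\<eta> abs_mult algebra_simps)
    \<comment> \<open>A cruder bound for the products of \<open>a\<close> or \<open>b\<close> with
      \<open>e\<close>, where no gradient is present and no factor \<open>w\<close> has to be
      kept.\<close>
    have c2: "\<bar>pd k \<eta> x\<bar> \<le> 2 * A\<^sup>2 / \<rho>" for k
    proof -
      have "2 * (A / \<rho>) * \<bar>w x\<bar> \<le> 2 * (A / \<rho>) * A"
        using A \<rho> w(3) by (intro mult_left_mono) auto
      with c1[of k] show ?thesis by (simp add: power2_eq_square)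
    qed
    have c3: "\<bar>\<eta> x * pd k e x\<bar> \<le> A * (\<bar>w x\<bar> * g)" for k
    proof -
      have "\<bar>\<eta> x * pd k e x\<bar> = \<bar>w x\<bar> * (\<bar>w x\<bar> * \<bar>pd k e x\<bar>)"
        by (simp add: \<eta>_def abs_mult power2_eq_square)
      also have "\<dots> \<le> A * (\<bar>w x\<bar> * g)" using w(3) g A by (intro mult_mono) auto
      finally show ?thesis .
    qed
    have t1: "\<bar>e x * (\<Sum>k\<in>UNIV. pd k e x * pd k \<eta> x)\<bar> \<le> (\<bar>w x\<bar> * g) * (6 * A * (\<bar>e x\<bar> / \<rho>))"
    proof -
      have "\<bar>\<Sum>k\<in>UNIV. pd k e x * pd k \<eta> x\<bar> \<le> real CARD(3) * (g * (2 * (A / \<rho>) * \<bar>w x\<bar>))"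
        by (rule abs_sum_le_card) (unfold abs_mult, intro mult_mono c1 g, auto)
      then have "\<bar>e x\<bar> * \<bar>\<Sum>k\<in>UNIV. pd k e x * pd k \<eta> x\<bar> \<le> \<bar>e x\<bar> * (real CARD(3) * (g * (2 * (A / \<rho>) * \<bar>w x\<bar>)))"
        by (rule mult_left_mono) simp
      then show ?thesis by (simp add: abs_mult algebra_simps)
    qed
    have t2: "\<bar>c * (pd k \<eta> x * e x + \<eta> x * pd k e x)\<bar> \<le> (2 * A * \<bar>c\<bar>) * (A * (\<bar>e x\<bar> / \<rho>)) + (\<bar>w x\<bar> * g) * (A * \<bar>c\<bar>)" for c k
    proof -
      have "\<bar>pd k \<eta> x * e x\<bar> \<le> 2 * A\<^sup>2 / \<rho> * \<bar>e x\<bar>"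
        unfolding abs_mult by (intro mult_right_mono c2) auto
      then have "\<bar>pd k \<eta> x * e x + \<eta> x * pd k e x\<bar> \<le> 2 * A\<^sup>2 / \<rho> * \<bar>e x\<bar> + A * (\<bar>w x\<bar> * g)"
        using c3[of k] by linarith
      then have "\<bar>c\<bar> * \<bar>pd k \<eta> x * e x + \<eta> x * pd k e x\<bar> \<le> \<bar>c\<bar> * (2 * A\<^sup>2 / \<rho> * \<bar>e x\<bar> + A * (\<bar>w x\<bar> * g))"
        by (rule mult_left_mono) simp
      then show ?thesis unfolding abs_mult[of c] by (simp add: algebra_simps power2_eq_square)
    qed
    define W E where "W = \<bar>w x\<bar> * g" and "E = A * (\<bar>e x\<bar> / \<rho>)"
    have "\<bar>R x\<bar> \<le> W * (6 * E) + ((2 * A * \<bar>a x\<bar>) * E + W * (A * \<bar>a x\<bar>)) + ((2 * A * \<bar>b x\<bar>) * E + W * (A * \<bar>b x\<bar>))"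
    proof -
      have "\<bar>R x\<bar> \<le> \<bar>e x * (\<Sum>k\<in>UNIV. pd k e x * pd k \<eta> x)\<bar> + \<bar>a x * (pd j \<eta> x * e x + \<eta> x * pd j e x)\<bar>
          + \<bar>b x * (pd i \<eta> x * e x + \<eta> x * pd i e x)\<bar>"
        unfolding R_def by linarith
      moreover have "\<bar>e x * (\<Sum>k\<in>UNIV. pd k e x * pd k \<eta> x)\<bar> \<le> W * (6 * E)"
        using t1 by (simp add: W_def E_def mult.assoc)
      ultimately show ?thesis
        using t2[of "a x" j] t2[of "b x" i] unfolding W_def[symmetric] E_def[symmetric] by linarith
    qed
    also have "\<dots> = W * (6 * E + A * \<bar>a x\<bar> + A * \<bar>b x\<bar>) + (2 * A * \<bar>a x\<bar>) * E + (2 * A * \<bar>b x\<bar>) * E"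
      by (simp add: algebra_simps)
    also have "\<dots> \<le> (W\<^sup>2 / 2 + (6 * E + A * \<bar>a x\<bar> + A * \<bar>b x\<bar>)\<^sup>2 / 2) + ((2 * A * \<bar>a x\<bar>)\<^sup>2 / 2 + E\<^sup>2 / 2) + ((2 * A * \<bar>b x\<bar>)\<^sup>2 / 2 + E\<^sup>2 / 2)"
      by (intro add_mono young_half)
    also have "(6 * E + A * \<bar>a x\<bar> + A * \<bar>b x\<bar>)\<^sup>2 \<le> 3 * ((6 * E)\<^sup>2 + (A * \<bar>a x\<bar>)\<^sup>2 + (A * \<bar>b x\<bar>)\<^sup>2)"
      using sum_squares_bound[of "6 * E" "A * \<bar>a x\<bar>"] sum_squares_bound[of "6 * E" "A * \<bar>b x\<bar>"] sum_squares_bound[of "A * \<bar>a x\<bar>" "A * \<bar>b x\<bar>"]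
      by (simp add: power2_eq_square algebra_simps)
    \<comment> \<open>Coefficients: 3 * 36 / 2 + 1/2 + 1/2 = 55 for \<open>E\<^sup>2\<close>, and
      3/2 + 4/2 = 7/2 for each of the others. They are rounded up to 100, and absorption doubles
      this to 200.\<close>
    also have "W\<^sup>2 / 2 + 3 * ((6 * E)\<^sup>2 + (A * \<bar>a x\<bar>)\<^sup>2 + (A * \<bar>b x\<bar>)\<^sup>2) / 2 + ((2 * A * \<bar>a x\<bar>)\<^sup>2 / 2 + E\<^sup>2 / 2) + ((2 * A * \<bar>b x\<bar>)\<^sup>2 / 2 + E\<^sup>2 / 2)
        = W\<^sup>2 / 2 + 55 * E\<^sup>2 + 7/2 * (A\<^sup>2 * (a x)\<^sup>2) + 7/2 * (A\<^sup>2 * (b x)\<^sup>2)"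
      by (simp add: power_mult_distrib) (simp add: field_simps)
    also have "\<dots> \<le> W\<^sup>2 / 2 + 100 * E\<^sup>2 + 100 * (A\<^sup>2 * (a x)\<^sup>2) + 100 * (A\<^sup>2 * (b x)\<^sup>2)"
      by (intro add_mono mult_right_mono) auto
    also have "\<dots> = X x / 2 + 100 * A\<^sup>2 * ((a x)\<^sup>2 + (b x)\<^sup>2 + (e x)\<^sup>2 / \<rho>\<^sup>2)"
      by (simp add: W_def E_def X_def \<eta>_def g_def power_mult_distrib power_divide sum_nonneg algebra_simps)
    finally show ?thesis by simp
  qed
  have c: "continuous_on UNIV e" "continuous_on UNIV a" "continuous_on UNIV b" "continuous_on UNIV \<eta>"
    "continuous_on UNIV (pd k e)" "continuous_on UNIV (pd k \<eta>)" for k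
    using e1 a b \<eta>(1) by (auto intro: C1_continuous C1_continuous_pd)
  have "(\<integral>x. X x \<partial>lborel) \<le> 2 * (LINT x:cball 0 \<rho>|lborel. 100 * A\<^sup>2 * ((a x)\<^sup>2 + (b x)\<^sup>2 + (e x)\<^sup>2 / \<rho>\<^sup>2))"
  proof (rule absorb_half[OF 0 _ _ _ _ _ le])
    show "continuous_on UNIV X" "continuous_on UNIV R"
      "continuous_on UNIV (\<lambda>x. 100 * A\<^sup>2 * ((a x)\<^sup>2 + (b x)\<^sup>2 + (e x)\<^sup>2 / \<rho>\<^sup>2))"
      unfolding X_def R_def using \<rho> by (intro continuous_intros c; simp)+
  qed (auto simp: X_def R_def \<eta> pd\<eta> w)
  then show ?thesis by (simp add: X_def \<eta>_def)
qed

section \<open>The energy estimate\<close>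

lemma member_le_double_sum:
  fixes f :: "'a::finite \<Rightarrow> 'b::finite \<Rightarrow> real"
  assumes "\<And>i j. 0 \<le> f i j"
  shows "f i j \<le> (\<Sum>i\<in>UNIV. \<Sum>j\<in>UNIV. f i j)"
proof -
  have "f i j \<le> (\<Sum>j\<in>UNIV. f i j)" by (rule member_le_sum) (use assms in auto)
  also have "\<dots> \<le> (\<Sum>i\<in>UNIV. \<Sum>j\<in>UNIV. f i j)"
    by (rule member_le_sum[where f="\<lambda>i. \<Sum>j\<in>UNIV. f i j"]) (auto intro: sum_nonneg assms)
  finally show ?thesis .
qed

text \<open>Every error term contains a first or second derivative of the cutoff and exactly one
  gradient of a field, so Young's inequality absorbs the gradient. Only derivatives of
  \<open>d\<close> appear on the right because only the momentum equation is tested with a field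
  built from a potential.\<close>

lemma energy_estimate:
  fixes U V :: "3 \<Rightarrow> real ^ 3 \<Rightarrow> real" and d h :: "3 \<Rightarrow> 3 \<Rightarrow> real ^ 3 \<Rightarrow> real"
  assumes UV: "\<And>i. C2 (U i)" "\<And>i. C2 (V i)" and p: "C2 p"
    and dh: "\<And>i j. C1 (d i j)" "\<And>i j. C1 (h i j)"
    and skew: "\<And>i j x. d i j x = - d j i x" "\<And>i j x. h i j x = - h j i x"
    and div: "\<And>i x. (\<Sum>j\<in>UNIV. pd j (d i j) x) = U i x" "\<And>i x. (\<Sum>j\<in>UNIV. pd j (h i j) x) = V i x"
    and mom: "\<And>i x. (\<Sum>k\<in>UNIV. pd k (pd k (U i)) x) =
        (\<Sum>j\<in>UNIV. U j x * pd j (U i) x) - (\<Sum>j\<in>UNIV. V j x * pd j (V i) x) + pd i p x"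
    and ind: "\<And>i x. (\<Sum>k\<in>UNIV. pd k (pd k (V i)) x) =
        (\<Sum>j\<in>UNIV. U j x * pd j (V i) x) - (\<Sum>j\<in>UNIV. V j x * pd j (U i) x)"
    and w: "C2 w" "\<And>x. \<rho> < norm x \<Longrightarrow> w x = 0" "\<And>x. \<bar>w x\<bar> \<le> A" "\<And>k x. \<bar>pd k w x\<bar> \<le> A / \<rho>"
      "\<And>j k x. \<bar>pd k (pd j w) x\<bar> \<le> A / \<rho>\<^sup>2"
    and \<rho>: "0 < \<rho>"
    and G: "G = (\<lambda>x. \<Sum>i\<in>UNIV. \<Sum>k\<in>UNIV. (pd k (U i) x)\<^sup>2 + (pd k (V i) x)\<^sup>2)"
    and S: "S = (\<lambda>x. \<Sum>i\<in>UNIV. (U i x)\<^sup>2 + (V i x)\<^sup>2)"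
    and D: "D = (\<lambda>x. \<Sum>i\<in>UNIV. \<Sum>j\<in>UNIV. (d i j x)\<^sup>2 + (h i j x)\<^sup>2)"
    and E: "E = (\<lambda>x. \<Sum>i\<in>UNIV. \<Sum>j\<in>UNIV. \<Sum>k\<in>UNIV. (pd k (d i j) x)\<^sup>2)"
  shows "(\<integral>x. (w x) ^ 4 * G x \<partial>lborel)
    \<le> 4 * (2592 * A\<^sup>2)\<^sup>2 * (LINT x:cball 0 \<rho>|lborel. (S x + S x * D x + E x) / \<rho>\<^sup>2 + D x / \<rho> ^ 4)"
proof -
  \<comment> \<open>The test field already contains first derivatives of the cutoff, so second
    derivatives occur. With a fourth power both orders keep the factor \<open>w\<^sup>2\<close>
    needed to pair with the square root of \<open>w ^ 4 * G\<close>.\<close>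
  define \<eta> where "\<eta> = (\<lambda>x. (w x) ^ 4)"
  have A: "0 \<le> A" using w(3)[of 0] by linarith
  have w1: "C1 w" "\<And>j. C1 (pd j w)" using w(1) by (auto simp: C2_C1 C2_C1_pd)
  have \<eta>_alt: "\<eta> = (\<lambda>x. (w x * w x) * (w x * w x))"
    by (simp add: \<eta>_def power4_eq_xxxx mult.assoc)
  have \<eta>2: "C2 \<eta>" unfolding \<eta>_alt using w(1) by simp
  then have \<eta>1: "C1 \<eta>" "\<And>j. C1 (pd j \<eta>)" by (auto simp: C2_C1 C2_C1_pd)
  have \<eta>0: "\<eta> x = 0" if "\<rho> < norm x" for x using w(2)[OF that] by (simp add: \<eta>_def)
  have pd\<eta>: "pd k \<eta> = (\<lambda>x. 4 * (w x * w x * w x) * pd k w x)" for k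
    unfolding \<eta>_alt using w1 by (simp add: pd_mult fun_eq_iff algebra_simps)
  have pd\<eta>0: "pd k \<eta> x = 0" if "\<rho> < norm x" for k x using w(2)[OF that] by (simp add: pd\<eta>)
  have pd2\<eta>: "pd j (pd k \<eta>) x = (w x)\<^sup>2 * (12 * pd j w x * pd k w x + 4 * w x * pd j (pd k w) x)" for j k x
    unfolding pd\<eta> using w1 by (simp add: pd_mult pd_cmult algebra_simps power2_eq_square)
  have pd2\<eta>0: "pd j (pd k \<eta>) x = 0" if "\<rho> < norm x" for j k x using w(2)[OF that] by (simp add: pd2\<eta>)
  \<comment> \<open>The second derivative of \<open>w ^ 4\<close> contributes 12 + 4 = 16; the first
    one needs only 4.\<close>
  define M where "M = 16 * A\<^sup>2"
  have M0: "0 \<le> M" by (simp add: M_def)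
  have b1: "\<bar>pd k \<eta> x\<bar> \<le> (w x)\<^sup>2 * (M / \<rho>)" for k x
  proof -
    have "\<bar>w x\<bar> * \<bar>pd k w x\<bar> \<le> A * (A / \<rho>)" using A \<rho> w(3,4) by (intro mult_mono) auto
    then have "4 * (w x)\<^sup>2 * (\<bar>w x\<bar> * \<bar>pd k w x\<bar>) \<le> 4 * (w x)\<^sup>2 * (A * (A / \<rho>))"
      by (rule mult_left_mono) simp
    also have "\<dots> \<le> (w x)\<^sup>2 * (M / \<rho>)"
    proof -
      have "4 * (w x)\<^sup>2 * (A * (A / \<rho>)) = (w x)\<^sup>2 * (4 * A\<^sup>2 / \<rho>)" by (simp add: power2_eq_square)
      also have "\<dots> \<le> (w x)\<^sup>2 * (M / \<rho>)"
        using \<rho> by (intro mult_left_mono divide_right_mono) (auto simp: M_def)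
      finally show ?thesis .
    qed
    finally show ?thesis by (simp add: pd\<eta> abs_mult power2_eq_square algebra_simps)
  qed
  have b2: "\<bar>pd j (pd k \<eta>) x\<bar> \<le> (w x)\<^sup>2 * (M / \<rho>\<^sup>2)" for j k x
  proof -
    have "\<bar>pd j w x\<bar> * \<bar>pd k w x\<bar> \<le> (A / \<rho>) * (A / \<rho>)" using A \<rho> w(4) by (intro mult_mono) auto
    moreover have "\<bar>w x\<bar> * \<bar>pd j (pd k w) x\<bar> \<le> A * (A / \<rho>\<^sup>2)" using A \<rho> w(3,5) by (intro mult_mono) auto
    moreover have "\<bar>12 * pd j w x * pd k w x + 4 * w x * pd j (pd k w) x\<bar>
        \<le> 12 * (\<bar>pd j w x\<bar> * \<bar>pd k w x\<bar>) + 4 * (\<bar>w x\<bar> * \<bar>pd j (pd k w) x\<bar>)"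
      by (rule order_trans[OF abs_triangle_ineq]) (simp add: abs_mult)
    ultimately have "\<bar>12 * pd j w x * pd k w x + 4 * w x * pd j (pd k w) x\<bar> \<le> 12 * ((A / \<rho>) * (A / \<rho>)) + 4 * (A * (A / \<rho>\<^sup>2))"
      by linarith
    also have "\<dots> = M / \<rho>\<^sup>2" by (simp add: M_def power2_eq_square)
    finally have "(w x)\<^sup>2 * \<bar>12 * pd j w x * pd k w x + 4 * w x * pd j (pd k w) x\<bar> \<le> (w x)\<^sup>2 * (M / \<rho>\<^sup>2)"
      by (rule mult_left_mono) simp
    then show ?thesis unfolding pd2\<eta> abs_mult[of "(w x)\<^sup>2"] by simp
  qed
  \<comment> \<open>Energy density and cross helicity. When the equations are tested with
    \<open>U\<close> and \<open>V\<close>, magnetic force and stretching combine, and the convective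
    terms sum to \<open>U\<close> applied to the gradient of \<open>Q\<close> minus \<open>V\<close>
    applied to the gradient of \<open>P\<close>.\<close>
  define Q where "Q = (\<lambda>x. \<Sum>i\<in>UNIV. (1/2) * (U i x * U i x + V i x * V i x))"
  define P where "P = (\<lambda>x. \<Sum>i\<in>UNIV. U i x * V i x)"
  have UV1: "C1 (U i)" "C1 (V i)" for i using UV by (auto simp: C2_C1)
  have C2sum: "C2 (\<lambda>x. \<Sum>i\<in>UNIV. f i x)" if "\<And>i. C2 (f i)" for f :: "3 \<Rightarrow> real ^ 3 \<Rightarrow> real"
    by (simp add: sum_3 that)
  have C2const: "C2 (\<lambda>x::real^3. c)" for c
  proof -
    have "pd j (\<lambda>x::real^3. c) = (\<lambda>x. 0)" for j by (rule ext) simp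
    then show ?thesis by (simp add: C2_def)
  qed
  have QP: "C2 Q" "C2 P" unfolding Q_def P_def by (intro C2sum C2_mult C2_add C2const UV)+
  have pdQ: "pd j Q x = (\<Sum>i\<in>UNIV. U i x * pd j (U i) x + V i x * pd j (V i) x)" for j x
    unfolding Q_def using UV1 by (simp add: pd_sum pd_mult pd_add pd_cmult del: times_divide_eq_left) (simp add: algebra_simps)
  have pdP: "pd j P x = (\<Sum>i\<in>UNIV. pd j (U i) x * V i x + U i x * pd j (V i) x)" for j x
    unfolding P_def using UV1 by (simp add: pd_sum pd_mult pd_add algebra_simps)
  \<comment> \<open>The errors: \<open>R1\<close> from viscosity against the cutoff fields,
    \<open>R2\<close> from viscosity against \<open>g2\<close> (the only place with derivatives of a
    potential), \<open>R3\<close> from convection against \<open>g2\<close>, and \<open>R4\<close>,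
    \<open>R5\<close> from rewriting \<open>U\<close> and \<open>V\<close> as divergences of their
    potentials.\<close>
  define R1 where "R1 = (\<lambda>x. \<Sum>i\<in>UNIV. \<Sum>k\<in>UNIV. pd k \<eta> x * (U i x * pd k (U i) x + V i x * pd k (V i) x))"
  define R2 where "R2 = (\<lambda>x. \<Sum>i\<in>UNIV. \<Sum>k\<in>UNIV. \<Sum>j\<in>UNIV. pd k (U i) x * (pd k (pd j \<eta>) x * d i j x + pd j \<eta> x * pd k (d i j) x))"
  define R3 where "R3 = (\<lambda>x. \<Sum>i\<in>UNIV. \<Sum>k\<in>UNIV. \<Sum>j\<in>UNIV. (U j x * pd j (U i) x - V j x * pd j (V i) x) * (pd k \<eta> x * d i k x))"
  define R4 where "R4 = (\<lambda>x. \<Sum>j\<in>UNIV. \<Sum>k\<in>UNIV. pd k \<eta> x * d j k x * pd j Q x)"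
  define R5 where "R5 = (\<lambda>x. \<Sum>j\<in>UNIV. \<Sum>k\<in>UNIV. pd k \<eta> x * h j k x * pd j P x)"
  define X R where "X = (\<lambda>x. \<eta> x * G x)" and "R = (\<lambda>x. R1 x + R2 x + R3 x - R4 x + R5 x)"
  \<comment> \<open>\<open>\<eta> x * U i x + g2 i x\<close> is the sum over \<open>j\<close> of
    \<open>pd j\<close> of \<open>\<eta> * d i j\<close>, the divergence-free test field. Its two
    summands are tested separately.\<close>
  define g2 where "g2 = (\<lambda>i x. \<Sum>j\<in>UNIV. pd j \<eta> x * d i j x)"
  have g2: "C1 (g2 i)" "\<rho> < norm x \<Longrightarrow> g2 i x = 0" for i x
    unfolding g2_def using \<eta>1 dh by (auto simp: pd\<eta>0)
  have pdg2: "pd k (g2 i) x = (\<Sum>j\<in>UNIV. pd k (pd j \<eta>) x * d i j x + pd j \<eta> x * pd k (d i j) x)" for k i x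
    unfolding g2_def using \<eta>1 dh by (simp add: pd_sum pd_mult)
  let ?L = "\<lambda>f g x. (\<Sum>k\<in>UNIV. pd k (pd k f) x) * g x + (\<Sum>k\<in>UNIV. pd k f x * pd k g x)"
  let ?K = "\<lambda>d w Q x. \<eta> x * (\<Sum>j\<in>UNIV. w j x * pd j Q x) + (\<Sum>j\<in>UNIV. \<Sum>k\<in>UNIV. pd k \<eta> x * d j k x * pd j Q x)"
  \<comment> \<open>Three Green identities and three skew identities. The one with \<open>p\<close>
    removes the pressure; those with \<open>Q\<close> and \<open>P\<close> replace the
    undifferentiated cutoff in the convective terms by a derivative of the cutoff times a
    potential.\<close>
  have "cpt_divergence \<rho> (\<lambda>x. (\<Sum>i\<in>UNIV. ?L (U i) (\<lambda>x. \<eta> x * U i x) x) + (\<Sum>i\<in>UNIV. ?L (V i) (\<lambda>x. \<eta> x * V i x) x)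
      + (\<Sum>i\<in>UNIV. ?L (U i) (g2 i) x) - ?K d U p x - ?K d U Q x + ?K h V P x)"
    by (intro cpt_divergence_add cpt_divergence_diff cpt_divergence_sum cpt_divergence_laplacian
        cpt_divergence_skew UV p QP dh skew div \<eta>1 \<eta>0 g2 C1_mult UV1) (auto simp: \<eta>0)
  also have "(\<lambda>x. (\<Sum>i\<in>UNIV. ?L (U i) (\<lambda>x. \<eta> x * U i x) x) + (\<Sum>i\<in>UNIV. ?L (V i) (\<lambda>x. \<eta> x * V i x) x)
      + (\<Sum>i\<in>UNIV. ?L (U i) (g2 i) x) - ?K d U p x - ?K d U Q x + ?K h V P x) = (\<lambda>x. X x + R x)"
  proof
    fix x
    have a1: "(\<Sum>i\<in>UNIV. \<Sum>k\<in>UNIV. pd k (U i) x * pd k (\<lambda>x. \<eta> x * U i x) x)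
        + (\<Sum>i\<in>UNIV. \<Sum>k\<in>UNIV. pd k (V i) x * pd k (\<lambda>x. \<eta> x * V i x) x) = X x + R1 x"
      unfolding X_def R1_def G using UV1 \<eta>1
      by (simp add: pd_mult sum_distrib_left power2_eq_square algebra_simps flip: sum.distrib)
    have a2: "(\<Sum>i\<in>UNIV. \<Sum>k\<in>UNIV. pd k (U i) x * pd k (g2 i) x) = R2 x"
      unfolding R2_def pdg2 by (simp add: sum_distrib_left)
    have a3: "(\<Sum>i\<in>UNIV. ((\<Sum>j\<in>UNIV. U j x * pd j (U i) x) - (\<Sum>j\<in>UNIV. V j x * pd j (V i) x)) * g2 i x) = R3 x"
      unfolding R3_def g2_def
      by (simp add: sum_distrib_left sum_distrib_right flip: sum_subtractf)
    have a4: "(\<Sum>i\<in>UNIV. pd i p x * g2 i x) = (\<Sum>j\<in>UNIV. \<Sum>k\<in>UNIV. pd k \<eta> x * d j k x * pd j p x)"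
      unfolding g2_def by (simp add: sum_distrib_left mult.commute)
    have a5: "(\<Sum>i\<in>UNIV. ((\<Sum>j\<in>UNIV. U j x * pd j (U i) x) - (\<Sum>j\<in>UNIV. V j x * pd j (V i) x)) * U i x)
        + (\<Sum>i\<in>UNIV. ((\<Sum>j\<in>UNIV. U j x * pd j (V i) x) - (\<Sum>j\<in>UNIV. V j x * pd j (U i) x)) * V i x)
        = (\<Sum>j\<in>UNIV. U j x * pd j Q x) - (\<Sum>j\<in>UNIV. V j x * pd j P x)"
      unfolding pdQ pdP by (simp add: sum_3 algebra_simps)
    have a6: "(\<Sum>i\<in>UNIV. pd i p x * U i x) = (\<Sum>j\<in>UNIV. U j x * pd j p x)"
      by (simp add: mult.commute)
    define cu cv where "cu = (\<lambda>i. (\<Sum>j\<in>UNIV. U j x * pd j (U i) x) - (\<Sum>j\<in>UNIV. V j x * pd j (V i) x))"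
      and "cv = (\<lambda>i. (\<Sum>j\<in>UNIV. U j x * pd j (V i) x) - (\<Sum>j\<in>UNIV. V j x * pd j (U i) x))"
    have cu: "(\<Sum>j\<in>UNIV. U j x * pd j (U i) x) - (\<Sum>j\<in>UNIV. V j x * pd j (V i) x) = cu i"
      and cv: "(\<Sum>j\<in>UNIV. U j x * pd j (V i) x) - (\<Sum>j\<in>UNIV. V j x * pd j (U i) x) = cv i" for i
      by (simp_all add: cu_def cv_def)
    have s1: "(\<Sum>i\<in>UNIV. ?L (U i) (\<lambda>x. \<eta> x * U i x) x) = \<eta> x * (\<Sum>i\<in>UNIV. cu i * U i x) + \<eta> x * (\<Sum>i\<in>UNIV. pd i p x * U i x)
        + (\<Sum>i\<in>UNIV. \<Sum>k\<in>UNIV. pd k (U i) x * pd k (\<lambda>x. \<eta> x * U i x) x)"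
      unfolding mom cu by (simp add: sum.distrib sum_distrib_left algebra_simps)
    have s2: "(\<Sum>i\<in>UNIV. ?L (V i) (\<lambda>x. \<eta> x * V i x) x) = \<eta> x * (\<Sum>i\<in>UNIV. cv i * V i x)
        + (\<Sum>i\<in>UNIV. \<Sum>k\<in>UNIV. pd k (V i) x * pd k (\<lambda>x. \<eta> x * V i x) x)"
      unfolding ind cv by (simp add: sum.distrib sum_distrib_left algebra_simps)
    have s3: "(\<Sum>i\<in>UNIV. ?L (U i) (g2 i) x) = (\<Sum>i\<in>UNIV. cu i * g2 i x) + (\<Sum>i\<in>UNIV. pd i p x * g2 i x)
        + (\<Sum>i\<in>UNIV. \<Sum>k\<in>UNIV. pd k (U i) x * pd k (g2 i) x)"
      unfolding mom cu by (simp add: sum.distrib sum_distrib_left algebra_simps)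
    have a5': "\<eta> x * (\<Sum>i\<in>UNIV. cu i * U i x) + \<eta> x * (\<Sum>i\<in>UNIV. cv i * V i x)
        = \<eta> x * (\<Sum>j\<in>UNIV. U j x * pd j Q x) - \<eta> x * (\<Sum>j\<in>UNIV. V j x * pd j P x)"
      using arg_cong[OF a5[unfolded cu cv], of "\<lambda>t. \<eta> x * t"] by (simp only: distrib_left right_diff_distrib)
    show "(\<Sum>i\<in>UNIV. ?L (U i) (\<lambda>x. \<eta> x * U i x) x) + (\<Sum>i\<in>UNIV. ?L (V i) (\<lambda>x. \<eta> x * V i x) x)
      + (\<Sum>i\<in>UNIV. ?L (U i) (g2 i) x) - ?K d U p x - ?K d U Q x + ?K h V P x = X x + R x"
      unfolding s1 s2 s3 using a1 a2 a3 a4 a5' unfolding R_def R4_def R5_def cu a6 by linarith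
  qed
  finally have 0: "(\<integral>x. X x + R x \<partial>lborel) = 0" by (rule cpt_divergence_integral)
  have le: "\<bar>R x\<bar> \<le> X x / 2 + 2 * (162 * M)\<^sup>2 * ((S x + S x * D x + E x) / \<rho>\<^sup>2 + D x / \<rho> ^ 4)" for x
  proof -
    define g s \<delta> \<gamma> where "g = sqrt (G x)" and "s = sqrt (S x)" and "\<delta> = sqrt (D x)" and "\<gamma> = sqrt (E x)"
    have nn: "0 \<le> G x" "0 \<le> S x" "0 \<le> D x" "0 \<le> E x"
      unfolding G S D E by (auto intro!: sum_nonneg)
    then have nn': "0 \<le> g" "0 \<le> s" "0 \<le> \<delta>" "0 \<le> \<gamma>" by (auto simp: g_def s_def \<delta>_def \<gamma>_def)
    have root: "\<bar>a\<bar> \<le> sqrt T" if "a\<^sup>2 \<le> T" for a T :: real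
      using that by (intro real_le_rsqrt) auto
    have bg: "\<bar>pd k (U i) x\<bar> \<le> g" "\<bar>pd k (V i) x\<bar> \<le> g" for i k
      using member_le_double_sum[of "\<lambda>i k. (pd k (U i) x)\<^sup>2 + (pd k (V i) x)\<^sup>2" i k]
      unfolding g_def G by (auto intro!: root intro: order_trans[rotated])
    have bs: "\<bar>U i x\<bar> \<le> s" "\<bar>V i x\<bar> \<le> s" for i
      using member_le_sum[of i UNIV "\<lambda>i. (U i x)\<^sup>2 + (V i x)\<^sup>2"]
      unfolding s_def S by (auto intro!: root intro: order_trans[rotated])
    have b\<delta>: "\<bar>d i j x\<bar> \<le> \<delta>" "\<bar>h i j x\<bar> \<le> \<delta>" for i j
      using member_le_double_sum[of "\<lambda>i j. (d i j x)\<^sup>2 + (h i j x)\<^sup>2" i j]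
      unfolding \<delta>_def D by (auto intro!: root intro: order_trans[rotated])
    have b\<gamma>: "\<bar>pd k (d i j) x\<bar> \<le> \<gamma>" for i j k
    proof -
      have "(pd k (d i j) x)\<^sup>2 \<le> (\<Sum>k\<in>UNIV. (pd k (d i j) x)\<^sup>2)"
        by (rule member_le_sum) auto
      also have "\<dots> \<le> E x"
        unfolding E by (rule member_le_double_sum[of "\<lambda>i j. \<Sum>k\<in>UNIV. (pd k (d i j) x)\<^sup>2"]) (auto intro: sum_nonneg)
      finally show ?thesis unfolding \<gamma>_def by (rule root)
    qed
    define m where "m = (w x)\<^sup>2 * M"
    have m0: "0 \<le> m" using M0 by (simp add: m_def)
    have b1': "\<bar>pd k \<eta> x\<bar> \<le> m / \<rho>" and b2': "\<bar>pd j (pd k \<eta>) x\<bar> \<le> m / \<rho>\<^sup>2" for j k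
      using b1[of k x] b2[of j k x] by (simp_all add: m_def)
    have prod2: "\<bar>a * b + a' * b'\<bar> \<le> 2 * (\<alpha> * \<beta>)" if "\<bar>a\<bar> \<le> \<alpha>" "\<bar>a'\<bar> \<le> \<alpha>" "\<bar>b\<bar> \<le> \<beta>" "\<bar>b'\<bar> \<le> \<beta>" for a b a' b' \<alpha> \<beta> :: real
    proof -
      have "\<bar>a\<bar> * \<bar>b\<bar> \<le> \<alpha> * \<beta>" "\<bar>a'\<bar> * \<bar>b'\<bar> \<le> \<alpha> * \<beta>" using that by (auto intro!: mult_mono)
      then show ?thesis using abs_triangle_ineq[of "a * b" "a' * b'"] by (simp add: abs_mult)
    qed
    have sum3: "\<bar>\<Sum>j\<in>(UNIV :: 3 set). f j\<bar> \<le> 3 * B" if "\<And>j. \<bar>f j\<bar> \<le> B" for f :: "3 \<Rightarrow> real" and B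
      using abs_sum_le_card[of f B, OF that] by simp
    have r1: "\<bar>R1 x\<bar> \<le> 3 * (3 * (m / \<rho> * (2 * (s * g))))"
      unfolding R1_def
      by (intro sum3, unfold abs_mult[of "pd _ \<eta> x"], intro mult_mono b1' prod2 bs bg) (use m0 \<rho> in auto)
    have r2: "\<bar>R2 x\<bar> \<le> 3 * (3 * (3 * (g * (m / \<rho>\<^sup>2 * \<delta> + m / \<rho> * \<gamma>))))"
    proof -
      have "\<bar>pd k (pd j \<eta>) x * d i j x + pd j \<eta> x * pd k (d i j) x\<bar> \<le> m / \<rho>\<^sup>2 * \<delta> + m / \<rho> * \<gamma>" for i j k
        by (rule order_trans[OF abs_triangle_ineq], unfold abs_mult, intro add_mono mult_mono b1' b2' b\<delta> b\<gamma>) (use m0 \<rho> in auto)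
      then show ?thesis
        unfolding R2_def by (intro sum3, unfold abs_mult[of "pd _ (U _) x"], intro mult_mono bg) (use nn' in auto)
    qed
    have r3: "\<bar>R3 x\<bar> \<le> 3 * (3 * (3 * (2 * (s * g) * (m / \<rho> * \<delta>))))"
    proof -
      have "\<bar>U j x * pd j (U i) x - V j x * pd j (V i) x\<bar> \<le> 2 * (s * g)" for i j
        using prod2[of "U j x" s "- V j x" "pd j (U i) x" g "pd j (V i) x"] bs bg by simp
      moreover have "\<bar>pd k \<eta> x * d i k x\<bar> \<le> m / \<rho> * \<delta>" for i k
        unfolding abs_mult by (intro mult_mono b1' b\<delta>) (use m0 \<rho> in auto)
      ultimately show ?thesis
        unfolding R3_def by (intro sum3, subst abs_mult, intro mult_mono) (use nn' in auto)
    qed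
    have bQ: "\<bar>pd j Q x\<bar> \<le> 3 * (2 * (s * g))" "\<bar>pd j P x\<bar> \<le> 3 * (2 * (s * g))" for j
    proof -
      show "\<bar>pd j Q x\<bar> \<le> 3 * (2 * (s * g))" unfolding pdQ by (intro sum3 prod2 bs bg)
      have "\<bar>V i x * pd j (U i) x + U i x * pd j (V i) x\<bar> \<le> 2 * (s * g)" for i by (intro prod2 bs bg)
      then show "\<bar>pd j P x\<bar> \<le> 3 * (2 * (s * g))" unfolding pdP by (intro sum3) (simp add: mult.commute)
    qed
    have r4: "\<bar>R4 x\<bar> \<le> 3 * (3 * (m / \<rho> * \<delta> * (3 * (2 * (s * g)))))"
      unfolding R4_def by (intro sum3, unfold abs_mult, intro mult_mono b1' b\<delta> bQ) (use m0 \<rho> nn' in auto)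
    have r5: "\<bar>R5 x\<bar> \<le> 3 * (3 * (m / \<rho> * \<delta> * (3 * (2 * (s * g)))))"
      unfolding R5_def by (intro sum3, unfold abs_mult, intro mult_mono b1' b\<delta> bQ) (use m0 \<rho> nn' in auto)
    define a1 a2 a3 a4 where "a1 = m * g * (s / \<rho>)" and "a2 = m * g * (\<delta> / \<rho>\<^sup>2)" and "a3 = m * g * (\<gamma> / \<rho>)"
      and "a4 = m * g * (s * \<delta> / \<rho>)"
    have "\<bar>R x\<bar> \<le> \<bar>R1 x\<bar> + \<bar>R2 x\<bar> + \<bar>R3 x\<bar> + \<bar>R4 x\<bar> + \<bar>R5 x\<bar>"
      unfolding R_def by linarith
    also have "\<dots> \<le> 18 * a1 + 27 * (a2 + a3) + 54 * a4 + 54 * a4 + 54 * a4"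
    proof -
      have "\<bar>R1 x\<bar> \<le> 18 * a1" using r1 by (simp add: a1_def algebra_simps)
      moreover have "\<bar>R2 x\<bar> \<le> 27 * (a2 + a3)" using r2 by (simp add: a2_def a3_def algebra_simps)
      moreover have "\<bar>R3 x\<bar> \<le> 54 * a4" "\<bar>R4 x\<bar> \<le> 54 * a4" "\<bar>R5 x\<bar> \<le> 54 * a4"
        using r3 r4 r5 by (simp_all add: a4_def algebra_simps)
      ultimately show ?thesis by (intro add_mono)
    qed
    \<comment> \<open>162 = 3 * 54 is the largest coefficient, that of \<open>a4\<close>. With
      \<open>M = 16 * A\<^sup>2\<close> it yields the constant 2592 = 162 * 16 of the
      conclusion.\<close>
    also have "\<dots> \<le> 162 * (a1 + a2 + a3 + a4)"
    proof -
      have "0 \<le> a1" "0 \<le> a2" "0 \<le> a3" "0 \<le> a4"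
        unfolding a1_def a2_def a3_def a4_def using m0 nn' \<rho> by auto
      then have "0 \<le> 144 * a1 + 135 * (a2 + a3)" by simp
      then show ?thesis by (simp add: algebra_simps)
    qed
    also have "\<dots> = ((w x)\<^sup>2 * g) * (162 * M * (s / \<rho> + \<delta> / \<rho>\<^sup>2 + \<gamma> / \<rho> + s * \<delta> / \<rho>))"
      by (simp add: a1_def a2_def a3_def a4_def m_def algebra_simps)
    also have "\<dots> \<le> ((w x)\<^sup>2 * g)\<^sup>2 / 2 + (162 * M * (s / \<rho> + \<delta> / \<rho>\<^sup>2 + \<gamma> / \<rho> + s * \<delta> / \<rho>))\<^sup>2 / 2"
      by (rule young_half)
    also have "\<dots> \<le> ((w x)\<^sup>2 * g)\<^sup>2 / 2 + (162 * M)\<^sup>2 * (4 * ((s / \<rho>)\<^sup>2 + (\<delta> / \<rho>\<^sup>2)\<^sup>2 + (\<gamma> / \<rho>)\<^sup>2 + (s * \<delta> / \<rho>)\<^sup>2)) / 2"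
    proof -
      have "(a + b + c + e)\<^sup>2 \<le> 4 * (a\<^sup>2 + b\<^sup>2 + c\<^sup>2 + e\<^sup>2)" for a b c e :: real
        using sum_squares_bound[of a b] sum_squares_bound[of a c] sum_squares_bound[of a e]
          sum_squares_bound[of b c] sum_squares_bound[of b e] sum_squares_bound[of c e]
        by (simp add: power2_eq_square algebra_simps)
      from mult_left_mono[OF this, of "(162 * M)\<^sup>2"] show ?thesis
        unfolding power_mult_distrib[of "162 * M"] by simp
    qed
    also have "\<dots> = X x / 2 + 2 * (162 * M)\<^sup>2 * ((S x + S x * D x + E x) / \<rho>\<^sup>2 + D x / \<rho> ^ 4)"
      using nn by (simp add: X_def \<eta>_def g_def s_def \<delta>_def \<gamma>_def power_mult_distrib power_divide add_divide_distrib algebra_simps)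
    finally show ?thesis .
  qed
  have c: "continuous_on UNIV (U i)" "continuous_on UNIV (V i)" "continuous_on UNIV (pd k (U i))" "continuous_on UNIV (pd k (V i))"
    "continuous_on UNIV (d i j)" "continuous_on UNIV (h i j)" "continuous_on UNIV (pd k (d i j))"
    "continuous_on UNIV \<eta>" "continuous_on UNIV (pd k \<eta>)" "continuous_on UNIV (pd j (pd k \<eta>))"
    "continuous_on UNIV (pd k Q)" "continuous_on UNIV (pd k P)" for i j k
    using UV1 dh \<eta>1 QP by (auto intro: C1_continuous C1_continuous_pd C2_C1)
  have "(\<integral>x. X x \<partial>lborel) \<le> 2 * (LINT x:cball 0 \<rho>|lborel. 2 * (162 * M)\<^sup>2 * ((S x + S x * D x + E x) / \<rho>\<^sup>2 + D x / \<rho> ^ 4))"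
  proof (rule absorb_half[OF 0 _ _ _ _ _ le])
    show "continuous_on UNIV X" unfolding X_def G by (intro continuous_intros c)
    show "continuous_on UNIV R" unfolding R_def R1_def R2_def R3_def R4_def R5_def
      by (intro continuous_intros c)
    show "continuous_on UNIV (\<lambda>x. 2 * (162 * M)\<^sup>2 * ((S x + S x * D x + E x) / \<rho>\<^sup>2 + D x / \<rho> ^ 4))"
      unfolding S D E using \<rho> by (intro continuous_intros c) auto
  qed (auto simp: X_def R_def R1_def R2_def R3_def R4_def R5_def \<eta>0 pd\<eta>0 pd2\<eta>0)
  then show ?thesis by (simp add: X_def \<eta>_def M_def)
qed

section \<open>Bump averages and the vorticity potential\<close>

text \<open>A Henstock integral over a box, so that the results on parameter integrals apply. The
  kernels used vanish from norm 1 on, so the box loses nothing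
  (\<open>avg_eq_lborel\<close>).\<close>

definition avg :: "(real ^ 'n::finite \<Rightarrow> real) \<Rightarrow> (real ^ 'n \<Rightarrow> real) \<Rightarrow> real \<Rightarrow> real ^ 'n \<Rightarrow> real" where
  "avg k f r x = integral (cbox (-1) 1) (\<lambda>z. k z * f (x - r *\<^sub>R z))"

text \<open>The kernel \<open>\<integral>\<^sub>0\<^sup>R r\<^sup>1\<^sup>-\<^sup>n bump (z / r) dr\<close> is a parametrix of the Laplacian:
  see \<open>potential_laplacian\<close>.\<close>

definition potential :: "real \<Rightarrow> (real ^ 'n::finite \<Rightarrow> real) \<Rightarrow> real ^ 'n \<Rightarrow> real" where
  "potential R f x = integral (cbox (0, -1) (R, 1)) (\<lambda>p. (fst p * bump (snd p)) * f (x - fst p *\<^sub>R snd p))"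

lemma bump_C1 [simp]: "C1 bump" and mollifier_C1 [simp]: "C1 mollifier"
  and bump_C2 [simp]: "C2 bump" and mollifier_C2 [simp]: "C2 mollifier"
  by (simp_all add: bump_smooth mollifier_smooth smooth_C1 smooth_C2)

lemma bump_continuous: "continuous_on A bump" and mollifier_continuous: "continuous_on A mollifier"
  by (simp_all add: C1_continuous)

lemma
  assumes "continuous_on UNIV k" "C1 f"
  shows C1_avg: "C1 (avg k f r)" and pd_avg: "pd j (avg k f r) = avg k (pd j f) r"
proof -
  have k: "continuous_on (cbox (-1) 1) k" using assms(1) continuous_on_subset by blast
  show "C1 (avg k f r)" "pd j (avg k f r) = avg k (pd j f) r"
    unfolding avg_def[abs_def]
    by (rule C1_integral_param pd_integral_param; (intro continuous_intros k assms(2))?)+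
qed

lemma
  assumes "C1 f"
  shows C1_potential: "C1 (potential R f)" and pd_potential: "pd j (potential R f) = potential R (pd j f)"
proof -
  have k: "continuous_on (cbox (0, -1) (R, 1)) (\<lambda>p. fst p * bump (snd p))"
    by (intro continuous_intros continuous_on_compose2[OF bump_continuous[of UNIV]]) auto
  have th: "continuous_on (cbox (0, -1) (R, 1)) (\<lambda>p. fst p *\<^sub>R snd p)"
    by (intro continuous_intros)
  show "C1 (potential R f)" "pd j (potential R f) = potential R (pd j f)"
    unfolding potential_def[abs_def]
    by (rule C1_integral_param[OF k th assms] pd_integral_param[OF k th assms])+
qed

lemma C2_potential: "C2 f \<Longrightarrow> C2 (potential R f)"
  by (simp add: C2_def C1_potential pd_potential)

lemma avg_integrable:
  fixes k f :: "real ^ 'n::finite \<Rightarrow> real"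
  assumes "continuous_on UNIV k" "continuous_on UNIV f"
  shows "(\<lambda>z. k z * f (x - r *\<^sub>R z)) integrable_on cbox (-1) 1"
proof (rule integrable_continuous)
  show "continuous_on (cbox (-1) 1) (\<lambda>z. k z * f (x - r *\<^sub>R z))"
    by (intro continuous_on_mult continuous_on_subset[OF assms(1)] continuous_on_compose2[OF assms(2)] continuous_intros) auto
qed

lemma potential_integrable:
  assumes "continuous_on UNIV f"
  shows "(\<lambda>p. (fst p * bump (snd p)) * f (x - fst p *\<^sub>R snd p)) integrable_on cbox (0, -1) (R, 1)"
  by (intro integrable_continuous continuous_intros continuous_on_compose2[OF bump_continuous[of UNIV]]
      continuous_on_compose2[OF assms(1)]) auto

lemma potential_diff:
  assumes "continuous_on UNIV f" "continuous_on UNIV g"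
  shows "potential R (\<lambda>x. f x - g x) x = potential R f x - potential R g x"
  unfolding potential_def right_diff_distrib
  by (rule integral_diff[OF potential_integrable[OF assms(1)] potential_integrable[OF assms(2)]])

lemma potential_sum:
  assumes "finite I" "\<And>i. i \<in> I \<Longrightarrow> continuous_on UNIV (f i)"
  shows "potential R (\<lambda>x. \<Sum>i\<in>I. f i x) x = (\<Sum>i\<in>I. potential R (f i) x)"
  unfolding potential_def sum_distrib_left
  by (rule integral_sum[OF assms(1) potential_integrable[OF assms(2)]])

lemma avg_continuous:
  assumes "continuous_on UNIV k" "continuous_on UNIV f"
  shows "continuous_on UNIV (\<lambda>p. avg k f (fst p) (snd p))"
  unfolding avg_def
proof (rule integral_continuous_on_param)
  show "continuous_on (UNIV \<times> cbox (-1) 1) (\<lambda>(p, z). k z * f (snd p - fst p *\<^sub>R z))"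
    unfolding split_beta
    by (intro continuous_intros continuous_on_compose2[OF assms(1)] continuous_on_compose2[OF assms(2)]) auto
qed

lemma potential_eq_integral_avg:
  assumes "continuous_on UNIV f"
  shows "potential R f x = integral {0..R} (\<lambda>r. r * avg bump f r x)"
proof -
  have "potential R f x = integral (cbox 0 R) (\<lambda>r. integral (cbox (-1) 1) (\<lambda>z. (r * bump z) * f (x - r *\<^sub>R z)))"
    unfolding potential_def
    by (subst integral_prod_continuous)
       (simp_all, intro continuous_intros continuous_on_compose2[OF bump_continuous[of UNIV]] continuous_on_compose2[OF assms(1)], auto)
  also have "\<dots> = integral {0..R} (\<lambda>r. r * avg bump f r x)"
    by (simp add: avg_def mult.assoc)
  finally show ?thesis .
qed

lemma unit_ball_subset_cbox: "norm z \<le> 1 \<Longrightarrow> z \<in> cbox (-1) (1 :: real ^ 'n::finite)"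
proof -
  assume "norm z \<le> 1"
  then have "\<bar>z $ i\<bar> \<le> 1" for i using component_le_norm_cart[of z i] by linarith
  then show ?thesis by (simp add: mem_box_cart abs_le_iff minus_le_iff)
qed

lemma integral_cbox_eq_lborel:
  fixes g :: "real ^ 'n::finite \<Rightarrow> real"
  assumes "continuous_on UNIV g" "\<And>z. 1 < norm z \<Longrightarrow> g z = 0"
  shows "integral (cbox (-1) 1) g = (\<integral>z. g z \<partial>lborel)"
proof -
  have "set_integrable lborel (cbox (-1) 1) g"
    unfolding set_integrable_def by (intro borel_integrable_compact continuous_on_subset[OF assms(1)]) auto
  then have "integral (cbox (-1) 1) g = (LINT z:cbox (-1) 1|lborel. g z)"
    by (simp add: set_borel_integral_eq_integral)
  also have "\<dots> = (\<integral>z. g z \<partial>lborel)"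
    unfolding set_lebesgue_integral_def
  proof (rule Bochner_Integration.integral_cong)
    fix z :: "real ^ 'n"
    show "indicator (cbox (-1) 1) z *\<^sub>R g z = g z"
      using assms(2)[of z] unit_ball_subset_cbox[of z] by (cases "norm z \<le> 1") auto
  qed simp
  finally show ?thesis .
qed

lemma avg_eq_lborel:
  fixes k :: "real ^ 'n::finite \<Rightarrow> real"
  assumes "continuous_on UNIV k" "\<And>z. 1 \<le> norm z \<Longrightarrow> k z = 0" "continuous_on UNIV f"
  shows "avg k f r x = (\<integral>z. k z * f (x - r *\<^sub>R z) \<partial>lborel)"
  unfolding avg_def
proof (rule integral_cbox_eq_lborel)
  show "continuous_on UNIV (\<lambda>z. k z * f (x - r *\<^sub>R z))"
    by (intro continuous_intros assms(1) continuous_on_compose2[OF assms(3)]) auto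
qed (simp add: assms(2))

section \<open>Integration by parts in averages and the parametrix identity\<close>

lemma pd_reflected:
  fixes f :: "real ^ 'n::finite \<Rightarrow> real"
  assumes "C1 f"
  shows "C1 (\<lambda>z. f (x - r *\<^sub>R z))" "pd j (\<lambda>z. f (x - r *\<^sub>R z)) = (\<lambda>z. - r * pd j f (x - r *\<^sub>R z))"
proof -
  have 1: "((\<lambda>z. f (x - r *\<^sub>R z)) has_derivative (\<lambda>h. \<Sum>j\<in>UNIV. h $ j * (- r * pd j f (x - r *\<^sub>R z)))) (at z)" for z
  proof -
    have "((\<lambda>z. x - r *\<^sub>R z) has_derivative (\<lambda>h. - r *\<^sub>R h)) (at z)"
      by (auto intro!: derivative_eq_intros)
    from has_derivative_compose[OF this C1_has_derivative[OF assms]]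
    have "((\<lambda>z. f (x - r *\<^sub>R z)) has_derivative (\<lambda>h. \<Sum>j\<in>UNIV. (- r *\<^sub>R h) $ j * pd j f (x - r *\<^sub>R z))) (at z)" .
    then show ?thesis by (simp add: algebra_simps)
  qed
  have 2: "continuous_on UNIV (\<lambda>z. - r * pd j f (x - r *\<^sub>R z))" for j
    by (intro continuous_intros continuous_on_compose2[OF C1_continuous_pd[OF assms, of UNIV]]) auto
  show "C1 (\<lambda>z. f (x - r *\<^sub>R z))" "pd j (\<lambda>z. f (x - r *\<^sub>R z)) = (\<lambda>z. - r * pd j f (x - r *\<^sub>R z))"
    using C1I[OF 1 2] by auto
qed

text \<open>On the unit sphere itself the derivative vanishes by continuity, since the sphere lies
  in the closure of the open exterior.\<close>

lemma pd_unit_support: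
  fixes k :: "real ^ 'n::finite \<Rightarrow> real"
  assumes "C1 k" "\<And>z. 1 \<le> norm z \<Longrightarrow> k z = 0" "1 \<le> norm z"
  shows "pd j k z = 0"
proof -
  have "z \<in> closure (- cball 0 1)"
    using assms(3) by (simp add: closure_complement interior_cball ball_def not_less)
  moreover have "pd j k y = 0" if "y \<in> - cball 0 1" for y
    using pd_zero_outside[of 1 k y j] assms(2) that by simp
  ultimately show ?thesis
    using continuous_constant_on_closure[of "- cball 0 1" "pd j k" 0 z] C1_continuous_pd[OF assms(1)] by blast
qed

text \<open>The factor \<open>r\<close> comes from the chain rule for
  \<open>f (x - r *\<^sub>R z)\<close>. Read from right to left, a derivative of the field is traded
  for a factor 1/r and a derivative of the kernel.\<close>

lemma avg_by_parts:
  fixes k :: "real ^ 'n::finite \<Rightarrow> real"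
  assumes k: "C1 k" "\<And>z. 1 \<le> norm z \<Longrightarrow> k z = 0" and f: "C1 f"
  shows "avg (pd j k) f r x = r * avg k (pd j f) r x"
proof -
  note [simp] = pd_reflected[OF f]
  have c: "continuous_on UNIV k" "continuous_on UNIV (pd j k)" "continuous_on UNIV f" "continuous_on UNIV (pd j f)"
    using k f by (simp_all add: C1_continuous C1_continuous_pd)
  have "(\<integral>z. pd j (\<lambda>z. k z * f (x - r *\<^sub>R z)) z \<partial>lborel) = 0"
    by (rule integral_pd_zero[where \<rho>=1]) (auto simp: k)
  also have "(\<lambda>z. pd j (\<lambda>z. k z * f (x - r *\<^sub>R z)) z)
      = (\<lambda>z. pd j k z * f (x - r *\<^sub>R z) - r * (k z * pd j f (x - r *\<^sub>R z)))"
    using k by (simp add: pd_mult fun_eq_iff)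
  finally have 0: "(\<integral>z. pd j k z * f (x - r *\<^sub>R z) - r * (k z * pd j f (x - r *\<^sub>R z)) \<partial>lborel) = 0" .
  have "integrable lborel (\<lambda>z. pd j k z * f (x - r *\<^sub>R z))"
  proof (rule integrable_continuous_support[where \<rho>=1])
    show "pd j k z * f (x - r *\<^sub>R z) = 0" if "1 < norm z" for z
      using pd_unit_support[OF k, of z j] that by simp
  qed (intro continuous_intros c continuous_on_compose2[OF c(3)], simp)
  moreover have "integrable lborel (\<lambda>z. k z * pd j f (x - r *\<^sub>R z))"
  proof (rule integrable_continuous_support[where \<rho>=1])
    show "k z * pd j f (x - r *\<^sub>R z) = 0" if "1 < norm z" for z
      using k(2)[of z] that by simp
  qed (intro continuous_intros c continuous_on_compose2[OF c(4)], simp)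
  ultimately have "(\<integral>z. pd j k z * f (x - r *\<^sub>R z) \<partial>lborel) = r * (\<integral>z. k z * pd j f (x - r *\<^sub>R z) \<partial>lborel)"
    using 0 by simp
  then show ?thesis
    using k by (subst (1 2) avg_eq_lborel) (auto simp: pd_unit_support[OF k] c)
qed

text \<open>Differentiating in \<open>r\<close> brings out \<open>- z $ j\<close> times
  \<open>mollifier\<close>, which is \<open>pd j bump\<close>; integrating by parts once more puts a
  second derivative on \<open>f\<close> and produces the factor \<open>r\<close>.\<close>

lemma avg_mollifier_derivative:
  fixes f :: "real ^ 'n::finite \<Rightarrow> real"
  assumes "C2 f"
  shows "((\<lambda>r. avg mollifier f r x) has_real_derivative
           r * avg bump (\<lambda>x. \<Sum>k\<in>UNIV. pd k (pd k f) x) r x) (at r)"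
proof -
  have f: "C1 f" "C1 (pd j f)" for j using assms by (auto simp: C2_C1 C2_C1_pd)
  have c: "continuous_on UNIV f" "continuous_on UNIV (pd j f)" "continuous_on UNIV (pd j (pd i f))" for i j
    using f by (auto simp: C1_continuous C1_continuous_pd)
  let ?fx = "\<lambda>r z. \<Sum>j\<in>UNIV. pd j bump z * pd j f (x - r *\<^sub>R z)"
  have "((\<lambda>r. integral (cbox (-1) 1) (\<lambda>z. mollifier z * f (x - r *\<^sub>R z))) has_real_derivative
      integral (cbox (-1) 1) (?fx r)) (at r)"
  proof (rule leibniz_rule_field_derivative[where U=UNIV])
    fix r and z :: "real ^ 'n"
    have "((\<lambda>r. f (x + r *\<^sub>R (- z))) has_real_derivative (\<Sum>j\<in>UNIV. (- z) $ j * pd j f (x + r *\<^sub>R (- z)))) (at r)"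
      using has_vector_derivative_line[of f x r "- z" UNIV] f by (simp add: has_real_derivative_iff_has_vector_derivative)
    from DERIV_cmult[OF this, of "mollifier z"]
    show "((\<lambda>r. mollifier z * f (x - r *\<^sub>R z)) has_real_derivative ?fx r z) (at r)"
      by (simp add: pd_bump sum_distrib_left sum_negf mult_ac)
  next
    show "(\<lambda>z. mollifier z * f (x - r *\<^sub>R z)) integrable_on cbox (-1) 1" for r
      by (rule avg_integrable[OF mollifier_continuous c(1)])
    show "continuous_on (UNIV \<times> cbox (-1) 1) (\<lambda>(r, z). ?fx r z)"
      unfolding split_beta
      by (intro continuous_intros continuous_on_compose2[OF C1_continuous_pd[OF bump_C1, of UNIV]] continuous_on_compose2[OF c(2)]) auto
  qed auto
  moreover have "integral (cbox (-1) 1) (?fx r) = (\<Sum>j\<in>UNIV. avg (pd j bump) (pd j f) r x)"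
    unfolding avg_def by (rule integral_sum) (auto intro!: avg_integrable C1_continuous_pd c)
  moreover have "avg (pd j bump) (pd j f) r x = r * avg bump (pd j (pd j f)) r x" for j
    by (rule avg_by_parts) (auto simp: f bump_outside)
  moreover have "(\<Sum>j\<in>UNIV. avg bump (pd j (pd j f)) r x) = avg bump (\<lambda>x. \<Sum>k\<in>UNIV. pd k (pd k f) x) r x"
    unfolding avg_def sum_distrib_left
    by (rule integral_sum[symmetric]) (auto intro!: avg_integrable bump_continuous c)
  ultimately show ?thesis by (simp add: avg_def flip: sum_distrib_left)
qed

text \<open>The radial derivative of the \<open>mollifier\<close> average is integrated from 0 to
  \<open>R\<close>. At radius 0 the average is \<open>f\<close> itself because
  \<open>mollifier\<close> has mass one.\<close>

lemma potential_laplacian: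
  fixes f :: "real ^ 'n::finite \<Rightarrow> real"
  assumes "C2 f" "0 \<le> R"
  shows "potential R (\<lambda>x. \<Sum>k\<in>UNIV. pd k (pd k f) x) x = avg mollifier f R x - f x"
proof -
  have f: "C1 f" "C1 (pd j f)" for j using assms by (auto simp: C2_C1 C2_C1_pd)
  have "potential R (\<lambda>x. \<Sum>k\<in>UNIV. pd k (pd k f) x) x
      = integral {0..R} (\<lambda>r. r * avg bump (\<lambda>x. \<Sum>k\<in>UNIV. pd k (pd k f) x) r x)"
    by (rule potential_eq_integral_avg) (intro continuous_intros C1_continuous_pd f)
  also have "\<dots> = avg mollifier f R x - avg mollifier f 0 x"
    using avg_mollifier_derivative[OF assms(1)] assms(2)
    by (intro integral_unique fundamental_theorem_of_calculus)
       (auto simp: has_real_derivative_iff_has_vector_derivative intro: has_vector_derivative_at_within)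
  also have "avg mollifier f 0 x = f x"
    using integral_mollifier[where 'n='n]
    by (subst avg_eq_lborel) (auto simp: mollifier_continuous mollifier_outside C1_continuous f)
  finally show ?thesis .
qed

lemma smooth_imp:
  fixes f :: "real ^ 'n::finite \<Rightarrow> real"
  assumes "smooth_function f"
  shows "C1 f" "C2 f" "C2 (pd j f)" "C2 (pd i (pd j f))" "continuous_on UNIV f"
    "continuous_on UNIV (pd j f)" "continuous_on UNIV (pd i (pd j f))"
  using assms by (auto simp: smooth_C1 smooth_C2 smooth_partial_deriv C1_continuous)

section \<open>The truncated Newtonian potential of the vorticity of a solenoidal field\<close>

locale solenoidal =
  fixes U :: "'n::finite \<Rightarrow> real ^ 'n \<Rightarrow> real" and R :: real
  assumes smooth: "\<And>i. smooth_function (U i)"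
    and div_free: "\<And>x. (\<Sum>j\<in>UNIV. pd j (U j) x) = 0"
    and R_nonneg: "0 \<le> R"
begin

text \<open>The sign is chosen so that the divergence in the second index is the Laplacian of
  \<open>U i\<close>.\<close>

definition vort :: "'n \<Rightarrow> 'n \<Rightarrow> real ^ 'n \<Rightarrow> real" where
  "vort i j = (\<lambda>x. pd j (U i) x - pd i (U j) x)"

text \<open>The minus sign compensates \<open>potential_laplacian\<close>, where the parametrix of a
  Laplacian is the average minus the function; the divergence thus becomes
  \<open>remainder\<close>.\<close>

definition skew_pot :: "'n \<Rightarrow> 'n \<Rightarrow> real ^ 'n \<Rightarrow> real" where
  "skew_pot i j = (\<lambda>x. - potential R (vort i j) x)"

definition remainder :: "'n \<Rightarrow> real ^ 'n \<Rightarrow> real" where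
  "remainder i = (\<lambda>x. U i x - avg mollifier (U i) R x)"

lemma vort_C2: "C2 (vort i j)"
  unfolding vort_def by (intro C2_diff smooth_imp smooth)

lemma C2_uminus: "C2 f \<Longrightarrow> C2 (\<lambda>x. - f x)"
  using C2_diff[of "\<lambda>x. 0" f] smooth_C2[OF bump_alg_smooth[OF bump_alg.const[of 0]]] by simp

lemma skew_pot_C2: "C2 (skew_pot i j)"
  unfolding skew_pot_def by (intro C2_uminus C2_potential vort_C2)

lemma vort_skew: "vort j i x = - vort i j x"
  by (simp add: vort_def)

lemma skew_pot_skew: "skew_pot j i x = - skew_pot i j x"
proof -
  have "potential R (vort j i) x = - potential R (vort i j) x"
    unfolding potential_def vort_skew[of j i] by (simp flip: integral_neg)
  then show ?thesis by (simp add: skew_pot_def)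
qed

lemma remainder_C1: "C1 (remainder i)"
  unfolding remainder_def by (intro C1_diff C1_avg smooth_imp smooth mollifier_continuous)

lemma remainder_eq: "remainder i x = - potential R (\<lambda>x. \<Sum>k\<in>UNIV. pd k (pd k (U i)) x) x"
  using potential_laplacian[OF smooth_imp(2)[OF smooth] R_nonneg, of i x] by (simp add: remainder_def)

text \<open>The transposed derivatives add up to a derivative of the divergence of the field, which
  is zero.\<close>

lemma div_vort: "(\<Sum>j\<in>UNIV. pd j (vort i j) x) = (\<Sum>k\<in>UNIV. pd k (pd k (U i)) x)"
proof -
  have "(\<Sum>j\<in>UNIV. pd j (pd i (U j)) x) = (\<Sum>j\<in>UNIV. pd i (pd j (U j)) x)"
    by (intro sum.cong refl pd_commute smooth_imp smooth)
  also have "\<dots> = pd i (\<lambda>x. \<Sum>j\<in>UNIV. pd j (U j) x) x"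
    by (rule pd_sum[symmetric]) (auto intro!: C1_differentiable C2_C1[OF smooth_imp(3)[OF smooth]])
  also have "\<dots> = 0" by (simp add: div_free)
  finally have 0: "(\<Sum>j\<in>UNIV. pd j (pd i (U j)) x) = 0" .
  have "pd j (vort i j) x = pd j (pd j (U i)) x - pd j (pd i (U j)) x" for j
    unfolding vort_def by (intro pd_diff C1_differentiable C2_C1 smooth_imp smooth)
  then show ?thesis using 0 by (simp add: sum_subtractf)
qed

text \<open>\<open>potential\<close> commutes with derivatives, so the divergence falls on the
  vorticity and becomes the Laplacian that the parametrix inverts up to mollification.\<close>

lemma div_skew_pot: "(\<Sum>j\<in>UNIV. pd j (skew_pot i j) x) = remainder i x"
proof -
  have v: "C1 (vort i j)" for j by (intro C2_C1 vort_C2)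
  have "pd j (skew_pot i j) x = - potential R (pd j (vort i j)) x" for j
    unfolding skew_pot_def using v[of j]
    by (simp add: pd_minus C1_differentiable[OF C1_potential] pd_potential)
  then have "(\<Sum>j\<in>UNIV. pd j (skew_pot i j) x) = - (\<Sum>j\<in>UNIV. potential R (pd j (vort i j)) x)"
    by (simp add: sum_negf)
  also have "(\<Sum>j\<in>UNIV. potential R (pd j (vort i j)) x) = potential R (\<lambda>x. \<Sum>j\<in>UNIV. pd j (vort i j) x) x"
    using v by (intro potential_sum[symmetric]) (auto intro: C1_continuous_pd)
  finally show ?thesis by (simp add: div_vort remainder_eq)
qed

text \<open>The Laplacian of the vorticity is the curl of the Laplacian of the field, and the
  parametrix turns the latter into minus \<open>remainder\<close>. This is the divergence form that
  \<open>caccioppoli\<close> takes.\<close>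

lemma laplacian_skew_pot:
  "(\<Sum>k\<in>UNIV. pd k (pd k (skew_pot i j)) x) = pd j (remainder i) x - pd i (remainder j) x"
proof -
  define L where "L = (\<lambda>i x. \<Sum>k\<in>UNIV. pd k (pd k (U i)) x)"
  have LC1: "C1 (L i)" for i
    unfolding L_def by (intro C1_sum C2_C1 smooth_imp smooth)
  have v: "C2 (vort i j)" by (rule vort_C2)
  have 1: "pd k (skew_pot i j) = (\<lambda>x. - potential R (pd k (vort i j)) x)" for k
    unfolding skew_pot_def using v
    by (auto simp: fun_eq_iff pd_minus C1_differentiable[OF C1_potential] pd_potential C2_C1)
  have 2: "pd k (pd k (skew_pot i j)) x = - potential R (pd k (pd k (vort i j))) x" for k
    unfolding 1 using C2_C1_pd[OF v, of k]
    by (simp add: pd_minus C1_differentiable[OF C1_potential] pd_potential)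
  have "(\<Sum>k\<in>UNIV. pd k (pd k (skew_pot i j)) x) = - potential R (\<lambda>x. \<Sum>k\<in>UNIV. pd k (pd k (vort i j)) x) x"
    unfolding 2 using C2_C1_pd[OF v]
    by (subst potential_sum) (auto simp: sum_negf intro: C1_continuous_pd)
  also have "(\<lambda>x. \<Sum>k\<in>UNIV. pd k (pd k (vort i j)) x) = (\<lambda>x. pd j (L i) x - pd i (L j) x)"
  proof
    fix x
    have s: "C1 (pd a (U b))" "C1 (pd c (pd a (U b)))" "C2 (U b)" "C2 (pd a (U b))" for a b c
      by (intro C2_C1 smooth_imp smooth)+
    have "pd k (vort i j) = (\<lambda>x. pd k (pd j (U i)) x - pd k (pd i (U j)) x)" for k
      unfolding vort_def by (rule pd_fun_diff) (rule s)+
    then have "pd k (pd k (vort i j)) x = pd k (pd k (pd j (U i))) x - pd k (pd k (pd i (U j))) x" for k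
      by (simp add: pd_diff s)
    moreover have "(\<Sum>k\<in>UNIV. pd k (pd k (pd a (U b))) x) = (\<Sum>k\<in>UNIV. pd a (pd k (pd k (U b))) x)" for a b
    proof (rule sum.cong)
      fix k
      have "pd k (pd a (U b)) = pd a (pd k (U b))"
        by (rule ext) (rule pd_commute[OF s(3)])
      then show "pd k (pd k (pd a (U b))) x = pd a (pd k (pd k (U b))) x"
        by (simp add: pd_commute[OF s(4)])
    qed simp
    moreover have "pd a (L b) x = (\<Sum>k\<in>UNIV. pd a (pd k (pd k (U b))) x)" for a b
      unfolding L_def by (rule pd_sum) (auto intro: C1_differentiable s)
    ultimately show "(\<Sum>k\<in>UNIV. pd k (pd k (vort i j)) x) = pd j (L i) x - pd i (L j) x"
      by (simp only: sum_subtractf)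
  qed
  also have "potential R (\<lambda>x. pd j (L i) x - pd i (L j) x) x = potential R (pd j (L i)) x - potential R (pd i (L j)) x"
    by (rule potential_diff) (intro C1_continuous_pd LC1)+
  finally have "(\<Sum>k\<in>UNIV. pd k (pd k (skew_pot i j)) x) = - (potential R (pd j (L i)) x - potential R (pd i (L j)) x)" .
  moreover have "potential R (pd a (L b)) x = - pd a (remainder b) x" for a b
  proof -
    have "remainder b = (\<lambda>x. - potential R (L b) x)"
      by (rule ext) (simp add: remainder_eq L_def)
    then show ?thesis
      using LC1[of b] by (simp add: pd_minus C1_differentiable[OF C1_potential] pd_potential)
  qed
  ultimately show ?thesis by simp
qed

text \<open>Shows that the integrand in \<open>skew_pot_eq\<close> involves no derivative of the
  field. Hence it can be bounded both through the \<open>BMO_inv\<close> hypothesis and through the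
  L^q norm.\<close>

lemma scaled_avg_vort:
  "r * avg bump (vort i j) r x = avg (pd j bump) (U i) r x - avg (pd i bump) (U j) r x"
proof -
  have "avg bump (vort i j) r x = avg bump (pd j (U i)) r x - avg bump (pd i (U j)) r x"
    unfolding avg_def vort_def right_diff_distrib
    by (rule integral_diff) (intro avg_integrable bump_continuous smooth_imp smooth)+
  moreover have "avg (pd a bump) (U b) r x = r * avg bump (pd a (U b)) r x" for a b
    by (rule avg_by_parts[OF bump_C1 bump_outside smooth_imp(1)[OF smooth]])
  ultimately show ?thesis by (simp add: right_diff_distrib)
qed

lemma skew_pot_eq: "skew_pot i j x = - integral {0..R} (\<lambda>r. r * avg bump (vort i j) r x)"
  unfolding skew_pot_def by (simp add: potential_eq_integral_avg C1_continuous C2_C1 vort_C2)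

end

section \<open>Mollified \<open>BMO\<close> potentials\<close>

lemma continuous_borel_lebesgue:
  fixes g :: "'a::euclidean_space \<Rightarrow> real"
  assumes "continuous_on UNIV g"
  shows "g \<in> borel_measurable lebesgue"
  by (rule measurable_completion) (simp add: borel_measurable_continuous_onI assms)

lemma
  fixes f g :: "'a::euclidean_space \<Rightarrow> real"
  assumes f: "set_integrable lebesgue S f" and g: "continuous_on UNIV g"
    and supp: "\<And>y. y \<notin> S \<Longrightarrow> g y = 0" and bnd: "\<And>y. \<bar>g y\<bar> \<le> B"
  shows integrable_bounded_mult: "integrable lebesgue (\<lambda>y. g y * f y)"
    and abs_integral_bounded_mult: "\<bar>\<integral>y. g y * f y \<partial>lebesgue\<bar> \<le> B * (LINT y:S|lebesgue. \<bar>f y\<bar>)"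
proof -
  let ?F = "\<lambda>y. indicator S y *\<^sub>R f y"
  have F: "integrable lebesgue ?F" using f by (simp add: set_integrable_def)
  then have FB: "integrable lebesgue (\<lambda>y. B * \<bar>?F y\<bar>)" by (intro integrable_mult_right integrable_abs)
  have eq: "(\<lambda>y. g y * f y) = (\<lambda>y. g y * ?F y)"
    using supp by (auto simp: fun_eq_iff indicator_def)
  have le: "\<bar>g y * ?F y\<bar> \<le> B * \<bar>?F y\<bar>" for y
    unfolding abs_mult by (rule mult_right_mono) (auto simp: bnd)
  have m: "(\<lambda>y. g y * ?F y) \<in> borel_measurable lebesgue"
    by (rule borel_measurable_times[OF continuous_borel_lebesgue[OF g] borel_measurable_integrable[OF F]])
  show i: "integrable lebesgue (\<lambda>y. g y * f y)"
    unfolding eq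
  proof (rule Bochner_Integration.integrable_bound[OF FB m], rule AE_I2)
    fix y show "norm (g y * ?F y) \<le> norm (B * \<bar>?F y\<bar>)"
      using le[of y] abs_ge_self[of "B * \<bar>?F y\<bar>"] unfolding real_norm_def by (rule order_trans)
  qed
  have "\<bar>\<integral>y. g y * f y \<partial>lebesgue\<bar> \<le> (\<integral>y. \<bar>g y * f y\<bar> \<partial>lebesgue)"
    using integral_norm_bound[of lebesgue "\<lambda>y. g y * f y"] unfolding real_norm_def .
  also have "\<dots> \<le> (\<integral>y. B * \<bar>?F y\<bar> \<partial>lebesgue)"
  proof (rule integral_mono)
    show "integrable lebesgue (\<lambda>y. \<bar>g y * f y\<bar>)" using i by (rule integrable_abs)
    show "\<bar>g y * f y\<bar> \<le> B * \<bar>?F y\<bar>" for y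
      using le[of y] fun_cong[OF eq, of y] by (simp only:)
  qed (rule FB)
  also have "\<dots> = B * (LINT y:S|lebesgue. \<bar>f y\<bar>)"
    by (simp add: set_lebesgue_integral_def abs_mult)
  finally show "\<bar>\<integral>y. g y * f y \<partial>lebesgue\<bar> \<le> B * (LINT y:S|lebesgue. \<bar>f y\<bar>)" .
qed

lemma locally_integrable_set_integrable:
  assumes "locally_integrable f"
  shows "set_integrable lebesgue (cball x r) f" "set_integrable lebesgue (ball x r) f"
proof -
  show 1: "set_integrable lebesgue (cball x r) f" using assms by (simp add: locally_integrable_def)
  show "set_integrable lebesgue (ball x r) f" by (rule set_integrable_subset[OF 1]) auto
qed

lemma set_integrable_const_ball:
  "set_integrable lebesgue (ball x r) (\<lambda>y. c :: real)" "set_integrable lebesgue (cball x r) (\<lambda>y. c :: real)"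
proof -
  have 1: "integrable lborel (\<lambda>y. indicator (cball x r) y *\<^sub>R c)"
    by (intro borel_integrable_compact continuous_intros) auto
  then show 2: "set_integrable lebesgue (cball x r) (\<lambda>y. c :: real)"
    unfolding set_integrable_def by (subst integrable_completion) auto
  show "set_integrable lebesgue (ball x r) (\<lambda>y. c :: real)" by (rule set_integrable_subset[OF 2]) auto
qed

lemma locally_integrable_diff_const:
  assumes "locally_integrable f"
  shows "locally_integrable (\<lambda>y. f y - c)"
  unfolding locally_integrable_def
proof (intro allI impI)
  fix K :: "'a set"
  assume K: "compact K"
  have "integrable lborel (\<lambda>y. indicator K y *\<^sub>R c)"
    using K by (intro borel_integrable_compact continuous_intros) auto
  then have "set_integrable lebesgue K (\<lambda>y. c)"
    unfolding set_integrable_def using K by (subst integrable_completion) (auto simp: borel_compact)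
  with assms K show "set_integrable lebesgue K (\<lambda>y. f y - c)"
    by (auto simp: locally_integrable_def intro: set_integral_diff)
qed

section \<open>Oscillation, test functions and bump averages of a field in
  \<open>BMO_inv\<close>\<close>

lemma BMO_ball_oscillation:
  fixes f :: "real ^ 3 \<Rightarrow> real"
  assumes "f \<in> BMO"
  obtains C where "0 \<le> C" "\<And>x r. 0 < r \<Longrightarrow> (LINT y:ball x r|lebesgue. \<bar>f y - mean_on (ball x r) f\<bar>) \<le> C * r ^ 3"
proof -
  obtain C where C: "\<And>x r. r > 0 \<Longrightarrow> mean_on (ball x r) (\<lambda>y. \<bar>f y - mean_on (ball x r) f\<bar>) \<le> C"
    using assms unfolding BMO_def mem_Collect_eq by metis
  have "(LINT y:ball x r|lebesgue. \<bar>f y - mean_on (ball x r) f\<bar>) \<le> \<bar>C\<bar> * measure lborel (ball (0 :: real ^ 3) 1) * r ^ 3"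
    if r: "0 < r" for x r
  proof -
    have m: "0 < measure lborel (ball x r)" using r by (rule content_ball_pos)
    have "(LINT y:ball x r|lebesgue. \<bar>f y - mean_on (ball x r) f\<bar>) / measure lebesgue (ball x r) \<le> C"
      using C[OF r, of x] by (simp only: mean_on_def)
    moreover have "measure lebesgue (ball x r) = measure lborel (ball x r)" by (rule measure_completion) simp
    ultimately have "(LINT y:ball x r|lebesgue. \<bar>f y - mean_on (ball x r) f\<bar>) \<le> C * measure lborel (ball x r)"
      using m by (simp add: field_simps)
    also have "\<dots> \<le> \<bar>C\<bar> * measure lborel (ball x r)"
      by (rule mult_right_mono) auto
    also have "measure lborel (ball x r) = r ^ 3 * measure lborel (ball (0 :: real ^ 3) 1)"
      using content_ball_conv_unit_ball[of r x] r by simp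
    finally show ?thesis by (simp add: algebra_simps)
  qed
  then show ?thesis using that[of "\<bar>C\<bar> * measure lborel (ball (0 :: real ^ 3) 1)"] by simp
qed

lemma pd_zero_open:
  fixes f :: "real ^ 'n::finite \<Rightarrow> real"
  assumes "open S" "x \<in> S" "\<And>y. y \<in> S \<Longrightarrow> f y = 0"
  shows "pd j f x = 0"
proof -
  have "(f has_derivative (\<lambda>h. 0)) (at x)"
    by (rule has_derivative_transform_within_open[of "\<lambda>x. 0" _ _ _ S]) (use assms in auto)
  from pd_eq[OF this] show ?thesis by simp
qed

lemma integral_lebesgue_pd_zero:
  fixes f :: "real ^ 'n::finite \<Rightarrow> real"
  assumes "C1 f" "\<And>x. \<rho> < norm x \<Longrightarrow> f x = 0"
  shows "(\<integral>x. pd j f x \<partial>lebesgue) = 0"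
  using integral_pd_zero[OF assms]
  by (subst integral_completion) (auto intro!: borel_measurable_continuous_onI C1_continuous_pd assms)

text \<open>The pairing of a \<open>BMO\<^sup>-\<^sup>1\<close> field with a bump function at scale \<open>r\<close> sees only the oscillation of
  the potential at that scale.\<close>

lemma BMO_inv_test_bound:
  assumes "u \<in> BMO_inv"
  obtains C where "0 \<le> C"
    "\<And>x r \<theta> i B. 0 < r \<Longrightarrow> test_function \<theta> \<Longrightarrow> (\<And>y. r \<le> dist x y \<Longrightarrow> \<theta> y = 0) \<Longrightarrow> (\<And>k y. \<bar>pd k \<theta> y\<bar> \<le> B)
      \<Longrightarrow> \<bar>\<integral>y. u y $ i * \<theta> y \<partial>lebesgue\<bar> \<le> C * r ^ 3 * B"
proof -
  obtain d where d: "\<And>i j. (\<lambda>x. d x $ i $ j) \<in> BMO" "is_weak_divergence u d"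
    using assms by (auto simp: BMO_inv_def)
  have "\<exists>C\<ge>0. \<forall>x r. 0 < r \<longrightarrow> (LINT y:ball x r|lebesgue. \<bar>d y $ i $ j - mean_on (ball x r) (\<lambda>x. d x $ i $ j)\<bar>) \<le> C * r ^ 3" for i j
    using BMO_ball_oscillation[OF d(1)[of i j]] by metis
  then obtain C where C: "\<And>i j. 0 \<le> C i j"
    "\<And>i j x r. 0 < r \<Longrightarrow> (LINT y:ball x r|lebesgue. \<bar>d y $ i $ j - mean_on (ball x r) (\<lambda>x. d x $ i $ j)\<bar>) \<le> C i j * r ^ 3"
    by metis
  define K where "K = (\<Sum>i\<in>UNIV. \<Sum>j\<in>UNIV. C i j)"
  have K: "C i j \<le> K" "0 \<le> K" for i j
    unfolding K_def using C(1) by (auto intro: member_le_double_sum sum_nonneg)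
  \<comment> \<open>24 = 3 * 8: three terms of the divergence, and 2^3 from doubling the
    radius.\<close>
  have "\<bar>\<integral>y. u y $ i * \<theta> y \<partial>lebesgue\<bar> \<le> (24 * K) * r ^ 3 * B"
    if r: "0 < r" and \<theta>: "test_function \<theta>" and supp: "\<And>y. r \<le> dist x y \<Longrightarrow> \<theta> y = 0" and B: "\<And>k y. \<bar>pd k \<theta> y\<bar> \<le> B"
    for x r \<theta> i B
  proof -
    have \<theta>1: "C1 \<theta>" using \<theta> by (simp add: test_function_def smooth_C1)
    \<comment> \<open>The derivative is known to vanish off the closed ball of radius
      \<open>r\<close>; the open ball of twice the radius contains that closed ball.\<close>
    have supp': "pd k \<theta> y = 0" if "y \<notin> ball x (2 * r)" for k y
      by (rule pd_zero_open[of "- cball x r"]) (use that r supp in auto)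
    have t: "\<bar>\<integral>y. d y $ i $ j * pd j \<theta> y \<partial>lebesgue\<bar> \<le> B * (K * (2 * r) ^ 3)" for j
    proof -
      define c where "c = mean_on (ball x (2 * r)) (\<lambda>x. d x $ i $ j)"
      have li: "locally_integrable (\<lambda>y. d y $ i $ j)" using d(1) by (simp add: BMO_def)
      have s1: "set_integrable lebesgue (ball x (2 * r)) (\<lambda>y. d y $ i $ j - c)"
        by (rule locally_integrable_set_integrable[OF locally_integrable_diff_const[OF li]])
      note c\<theta> = C1_continuous_pd[OF \<theta>1, of UNIV j]
      have i1: "integrable lebesgue (\<lambda>y. pd j \<theta> y * (d y $ i $ j - c))"
        by (rule integrable_bounded_mult[OF s1 c\<theta> supp' B])
      have i2: "integrable lebesgue (\<lambda>y. pd j \<theta> y * c)"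
        by (rule integrable_bounded_mult[OF set_integrable_const_ball(1) c\<theta> supp' B])
      \<comment> \<open>The derivative of a test function has mean zero, which permits subtracting
        the mean \<open>c\<close> from the potential and leaves only its oscillation.\<close>
      have z: "(\<integral>y. pd j \<theta> y \<partial>lebesgue) = 0"
      proof (rule integral_lebesgue_pd_zero[OF \<theta>1, where \<rho>="norm x + r"])
        fix y :: "real ^ 3" assume "norm x + r < norm y"
        then show "\<theta> y = 0" using norm_triangle_ineq2[of y x] by (intro supp) (simp add: dist_norm norm_minus_commute)
      qed
      have "(\<integral>y. d y $ i $ j * pd j \<theta> y \<partial>lebesgue) = (\<integral>y. pd j \<theta> y * (d y $ i $ j - c) + pd j \<theta> y * c \<partial>lebesgue)"
        by (simp add: algebra_simps)
      also have "\<dots> = (\<integral>y. pd j \<theta> y * (d y $ i $ j - c) \<partial>lebesgue)"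
        using i1 i2 z by simp
      also have "\<bar>\<dots>\<bar> \<le> B * (LINT y:ball x (2 * r)|lebesgue. \<bar>d y $ i $ j - c\<bar>)"
        by (rule abs_integral_bounded_mult[OF s1 c\<theta> supp' B])
      also have "\<dots> \<le> B * (K * (2 * r) ^ 3)"
      proof (rule mult_left_mono)
        have "(LINT y:ball x (2 * r)|lebesgue. \<bar>d y $ i $ j - c\<bar>) \<le> C i j * (2 * r) ^ 3"
          unfolding c_def using r by (intro C(2)) auto
        also have "\<dots> \<le> K * (2 * r) ^ 3" using r by (intro mult_right_mono K) auto
        finally show "(LINT y:ball x (2 * r)|lebesgue. \<bar>d y $ i $ j - c\<bar>) \<le> K * (2 * r) ^ 3" .
        show "0 \<le> B" using B[of j x] by linarith
      qed
      finally show ?thesis .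
    qed
    have "(\<integral>y. u y $ i * \<theta> y \<partial>lebesgue) = - (\<Sum>j\<in>UNIV. \<integral>y. d y $ i $ j * pd j \<theta> y \<partial>lebesgue)"
      using d(2) \<theta> by (simp add: is_weak_divergence_def)
    also have "\<bar>\<dots>\<bar> \<le> CARD(3) * (B * (K * (2 * r) ^ 3))"
      unfolding abs_minus_cancel by (rule abs_sum_le_card[OF t])
    finally show ?thesis by (simp add: power_mult_distrib algebra_simps)
  qed
  note main = this
  show ?thesis
  proof (rule that[of "24 * K"])
    show "0 \<le> 24 * K" using K(2) by simp
    show "\<bar>\<integral>y. u y $ i * \<theta> y \<partial>lebesgue\<bar> \<le> 24 * K * r ^ 3 * B"
      if "0 < r" "test_function \<theta>" "\<And>y. r \<le> dist x y \<Longrightarrow> \<theta> y = 0" "\<And>k y. \<bar>pd k \<theta> y\<bar> \<le> B"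
      for x r \<theta> i B
      by (rule main[OF that(1,2) that(3) that(4)])
  qed
qed

text \<open>Links averages with distributions: pairing a continuous field with this
  \<open>\<theta>\<close> gives \<open>r ^ 3\<close> times its average with kernel \<open>K\<close>
  (\<open>avg_eq_lebesgue\<close>), so the weak divergence identity becomes applicable to
  averages.\<close>

lemma test_function_reflected:
  fixes K :: "real ^ 'n::finite \<Rightarrow> real" and x :: "real ^ 'n"
  assumes K: "smooth_function K" "\<And>z. 1 \<le> norm z \<Longrightarrow> K z = 0" and r: "0 < r"
  defines "\<theta> \<equiv> \<lambda>y. K ((1 / r) *\<^sub>R (x - y))"
  shows "test_function \<theta>" "\<And>y. r \<le> dist x y \<Longrightarrow> \<theta> y = 0"
    "\<And>k y. pd k \<theta> y = - (1 / r) * pd k K ((1 / r) *\<^sub>R (x - y))"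
proof -
  have eq: "(1 / r) *\<^sub>R (x - y) = (- (1 / r)) *\<^sub>R y + (1 / r) *\<^sub>R x" for y
    by (simp add: algebra_simps)
  have \<theta>: "\<theta> = (\<lambda>y. K ((- (1 / r)) *\<^sub>R y + (1 / r) *\<^sub>R x))"
    by (simp only: \<theta>_def eq)
  show supp: "\<theta> y = 0" if "r \<le> dist x y" for y
  proof -
    have "norm ((1 / r) *\<^sub>R (x - y)) = norm (x - y) / r" using r by (simp only: norm_scaleR) simp
    then show ?thesis
      unfolding \<theta>_def using that r by (intro K(2)) (simp only: dist_norm le_divide_eq_1_pos)
  qed
  show "pd k \<theta> y = - (1 / r) * pd k K ((1 / r) *\<^sub>R (x - y))" for k y
    unfolding \<theta> eq by (rule pd_affine[OF smooth_C1[OF K(1)]])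
  have "closure {y. \<theta> y \<noteq> 0} \<subseteq> cball x r"
    by (rule closure_minimal) (use supp in \<open>force+\<close>)
  then have "compact (closure {y. \<theta> y \<noteq> 0})"
    by (meson bounded_cball bounded_subset closed_closure compact_eq_bounded_closed)
  then show "test_function \<theta>"
    unfolding test_function_def \<theta> using smooth_affine[OF K(1)] by blast
qed

lemma lborel_integral_affine:
  fixes f :: "'a::euclidean_space \<Rightarrow> real"
  assumes [measurable]: "f \<in> borel_measurable borel" and "c \<noteq> 0"
  shows "(\<integral>x. f x \<partial>lborel) = \<bar>c\<bar> ^ DIM('a) * (\<integral>x. f (t + c *\<^sub>R x) \<partial>lborel)"
proof -
  have "(\<integral>x. f x \<partial>lborel) = (\<integral>x. f x \<partial>density (distr lborel borel (\<lambda>x. t + c *\<^sub>R x)) (\<lambda>_. \<bar>c\<bar> ^ DIM('a)))"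
    using lborel_affine[OF assms(2), of t] by simp
  also have "\<dots> = (\<integral>x. \<bar>c\<bar> ^ DIM('a) *\<^sub>R f x \<partial>distr lborel borel (\<lambda>x. t + c *\<^sub>R x))"
    by (rule integral_density) auto
  also have "\<dots> = (\<integral>x. \<bar>c\<bar> ^ DIM('a) *\<^sub>R f (t + c *\<^sub>R x) \<partial>lborel)"
    by (rule integral_distr) auto
  finally show ?thesis by simp
qed

lemma avg_eq_lebesgue:
  fixes K f :: "real ^ 3 \<Rightarrow> real"
  assumes K: "continuous_on UNIV K" "\<And>z. 1 \<le> norm z \<Longrightarrow> K z = 0" and f: "continuous_on UNIV f" and r: "0 < r"
  shows "(\<integral>y. f y * K ((1 / r) *\<^sub>R (x - y)) \<partial>lebesgue) = r ^ 3 * avg K f r x"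
proof -
  have c: "continuous_on UNIV (\<lambda>y. f y * K ((1 / r) *\<^sub>R (x - y)))"
    by (intro continuous_intros f continuous_on_compose2[OF K(1)]) auto
  then have m: "(\<lambda>y. f y * K ((1 / r) *\<^sub>R (x - y))) \<in> borel_measurable borel"
    by (rule borel_measurable_continuous_onI)
  have "(\<integral>y. f y * K ((1 / r) *\<^sub>R (x - y)) \<partial>lebesgue) = (\<integral>y. f y * K ((1 / r) *\<^sub>R (x - y)) \<partial>lborel)"
    using m by (subst integral_completion) auto
  also have "\<dots> = r ^ 3 * (\<integral>z. f (x + (- r) *\<^sub>R z) * K ((1 / r) *\<^sub>R (x - (x + (- r) *\<^sub>R z))) \<partial>lborel)"
    using lborel_integral_affine[OF m, of "- r" x] r by simp
  also have "(\<lambda>z. f (x + (- r) *\<^sub>R z) * K ((1 / r) *\<^sub>R (x - (x + (- r) *\<^sub>R z)))) = (\<lambda>z. K z * f (x - r *\<^sub>R z))"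
    using r by (simp add: fun_eq_iff)
  finally show ?thesis using avg_eq_lborel[OF K f, of r x] by simp
qed

text \<open>Scaling: the pairing equals \<open>r ^ 3\<close> times the average, and the gradient of
  the rescaled kernel is O(1/r). This is the embedding of BMO^-1 into the Besov space of order -1
  with indices infinity, expressed with smooth averages.\<close>

lemma BMO_inv_avg_bound:
  fixes u :: "real ^ 3 \<Rightarrow> real ^ 3"
  assumes u: "u \<in> BMO_inv" "smooth_function u" and K: "smooth_function K" "\<And>z. 1 \<le> norm z \<Longrightarrow> K z = 0"
  obtains C where "0 \<le> C" "\<And>r x i. 0 < r \<Longrightarrow> \<bar>avg K (\<lambda>x. u x $ i) r x\<bar> \<le> C / r"
proof -
  obtain C where C: "0 \<le> C"
    "\<And>x r \<theta> i B. 0 < r \<Longrightarrow> test_function \<theta> \<Longrightarrow> (\<And>y. r \<le> dist x y \<Longrightarrow> \<theta> y = 0) \<Longrightarrow> (\<And>k y. \<bar>pd k \<theta> y\<bar> \<le> B)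
      \<Longrightarrow> \<bar>\<integral>y. u y $ i * \<theta> y \<partial>lebesgue\<bar> \<le> C * r ^ 3 * B"
    using BMO_inv_test_bound[OF u(1)] by blast
  have "\<exists>M\<ge>0. \<forall>z. \<bar>pd k K z\<bar> \<le> M" for k
    using continuous_support_bounded[of "pd k K" 1] pd_zero_outside[of 1 K] K
    by (metis C1_continuous_pd less_imp_le smooth_C1)
  then obtain M where M: "\<And>k. 0 \<le> M k" "\<And>k z. \<bar>pd k K z\<bar> \<le> M k" by metis
  define M' where "M' = (\<Sum>k\<in>UNIV. M k)"
  have M': "0 \<le> M'" "\<bar>pd k K z\<bar> \<le> M'" for k z
    unfolding M'_def using M by (auto intro!: sum_nonneg order_trans[OF M(2)] member_le_sum)
  have "\<bar>avg K (\<lambda>x. u x $ i) r x\<bar> \<le> (C * M') / r" if r: "0 < r" for r x i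
  proof -
    note \<theta> = test_function_reflected[where x=x, OF K r]
    have "\<bar>\<integral>y. u y $ i * K ((1 / r) *\<^sub>R (x - y)) \<partial>lebesgue\<bar> \<le> C * r ^ 3 * (M' / r)"
    proof (rule C(2)[OF r \<theta>(1) \<theta>(2)])
      show "\<bar>pd k (\<lambda>y. K ((1 / r) *\<^sub>R (x - y))) y\<bar> \<le> M' / r" for k y
      proof -
        have "\<bar>- (1 / r) * t\<bar> = \<bar>t\<bar> / r" for t using r by (simp add: abs_mult)
        then have "\<bar>pd k (\<lambda>y. K ((1 / r) *\<^sub>R (x - y))) y\<bar> = \<bar>pd k K ((1 / r) *\<^sub>R (x - y))\<bar> / r"
          using \<theta>(3)[of k y] by (simp only:)
        also have "\<dots> \<le> M' / r" using r by (intro divide_right_mono M'(2)) simp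
        finally show ?thesis .
      qed
    qed
    also have "(\<integral>y. u y $ i * K ((1 / r) *\<^sub>R (x - y)) \<partial>lebesgue) = r ^ 3 * avg K (\<lambda>x. u x $ i) r x"
      by (rule avg_eq_lebesgue[OF C1_continuous[OF smooth_C1[OF K(1)]] K(2)
          C1_continuous[OF smooth_C1[OF smooth_component[OF u(2)]]] r])
    finally have "r ^ 3 * \<bar>avg K (\<lambda>x. u x $ i) r x\<bar> \<le> r ^ 3 * ((C * M') / r)"
      using r by (simp add: abs_mult algebra_simps)
    then show ?thesis using r by (simp only: mult_le_cancel_left_pos zero_less_power)
  qed
  then show ?thesis using that[of "C * M'"] C(1) M'(1) by simp
qed

section \<open>Convolution of a smooth kernel with a locally integrable function\<close>

text \<open>Taken with respect to \<open>lebesgue\<close> because the components of the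
  \<open>BMO\<close> tensor are only Lebesgue measurable, in contrast to the continuous arguments of
  \<open>avg\<close>.\<close>

definition conv :: "(real ^ 'n::finite \<Rightarrow> real) \<Rightarrow> (real ^ 'n \<Rightarrow> real) \<Rightarrow> real ^ 'n \<Rightarrow> real" where
  "conv k f x = (\<integral>y. k (x - y) * f y \<partial>lebesgue)"

text \<open>All derivatives fall on the kernel. Since \<open>f\<close> is merely locally integrable,
  differentiability is obtained from a quadratic Taylor bound for the kernel, uniform in
  \<open>y\<close>, times the integral of the absolute value of \<open>f\<close> over a slightly
  larger ball.\<close>

lemma
  fixes k f :: "real ^ 'n::finite \<Rightarrow> real"
  assumes k: "C2 k" "\<And>z. \<rho> < norm z \<Longrightarrow> k z = 0" and f: "locally_integrable f"
  shows C1_conv: "C1 (conv k f)" and pd_conv: "pd j (conv k f) = conv (pd j k) f"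
proof -
  have k1: "C1 k" "C1 (pd j k)" for j using k by (auto simp: C2_C1 C2_C1_pd)
  have pk0: "pd j k z = 0" if "\<rho> < norm z" for j z using pd_zero_outside[OF k(2) that] by simp
  have pk02: "pd i (pd j k) z = 0" if "\<rho> < norm z" for i j z using pd_zero_outside[OF pk0 that] by simp
  have "\<exists>B\<ge>0. \<forall>z. \<bar>pd i (pd j k) z\<bar> \<le> B" for i j
    using continuous_support_bounded[of "pd i (pd j k)" \<rho>] pk02 C1_continuous_pd[OF k1(2)] by metis
  then obtain B where B: "\<And>i j. 0 \<le> B i j" "\<And>i j z. \<bar>pd i (pd j k) z\<bar> \<le> B i j" by metis
  define b where "b = (\<Sum>i\<in>UNIV. \<Sum>j\<in>UNIV. B i j)"
  have b: "0 \<le> b" "\<bar>pd i (pd j k) z\<bar> \<le> b" for i j z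
    unfolding b_def using B(1) by (auto intro!: sum_nonneg order_trans[OF B(2)] member_le_double_sum)
  have S: "set_integrable lebesgue (cball x (\<rho> + 1)) f" for x
    by (rule locally_integrable_set_integrable[OF f])
  define N where "N = (\<lambda>x. LINT y:cball x (\<rho> + 1)|lebesgue. \<bar>f y\<bar>)"
  \<comment> \<open>For increments of norm at most 1 all translated kernels live in one ball of
    radius \<open>\<rho> + 1\<close>.\<close>
  have out: "\<rho> < norm (x + h - y)" if "y \<notin> cball x (\<rho> + 1)" "norm h \<le> 1" for x h y :: "real ^ 'n"
  proof -
    have "norm (x - y) \<le> norm (x + h - y) + norm h"
      using norm_triangle_ineq4[of "x + h - y" h] by simp
    then show ?thesis using that by (simp add: dist_norm)
  qed
  have cont: "continuous_on UNIV (\<lambda>y. g (a - y))" if "continuous_on UNIV g" for g :: "real ^ 'n \<Rightarrow> real" and a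
    by (intro continuous_on_compose2[OF that] continuous_intros) auto
  have int: "integrable lebesgue (\<lambda>y. g (x + h - y) * f y)"
    if g: "continuous_on UNIV g" "\<And>z. \<rho> < norm z \<Longrightarrow> g z = 0" and h: "norm h \<le> 1" for g x h
  proof -
    obtain M where M: "\<And>z. \<bar>g z\<bar> \<le> M" using continuous_support_bounded[of g \<rho>] g by metis
    show ?thesis
      by (rule integrable_bounded_mult[OF S[of x] cont[OF g(1)], of _ M])
         (use M g(2) out h in auto)
  qed
  have kc: "continuous_on UNIV k" "continuous_on UNIV (pd j k)" for j using k1 by (auto intro: C1_continuous)
  \<comment> \<open>Taylor remainder of the kernel: the mean value theorem for \<open>k\<close>,
    then the Lipschitz bound for its partial derivatives at the intermediate point.\<close>
  have main: "\<bar>conv k f (x + h) - conv k f x - (\<Sum>j\<in>UNIV. h $ j * conv (pd j k) f x)\<bar>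
      \<le> (CARD('n) * (CARD('n) * b) * (norm h)\<^sup>2) * N x" if h: "norm h \<le> 1" for x h
  proof -
    define g where "g = (\<lambda>y. k (x + h - y) - k (x - y) - (\<Sum>j\<in>UNIV. h $ j * pd j k (x - y)))"
    have g1: "\<bar>g y\<bar> \<le> CARD('n) * (CARD('n) * b) * (norm h)\<^sup>2" for y
    proof -
      obtain t where t: "0 < t" "t < 1" "k (x - y + h) - k (x - y) = (\<Sum>j\<in>UNIV. h $ j * pd j k (x - y + t *\<^sub>R h))"
        by (rule mean_value_line[where f=k and x="x - y" and h=h, OF C1_differentiable[OF k1(1)]], rule that)
      have "g y = (\<Sum>j\<in>UNIV. h $ j * (pd j k (x - y + t *\<^sub>R h) - pd j k (x - y)))"
      proof -
        have "x + h - y = x - y + h" by simp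
        then have "g y = k (x - y + h) - k (x - y) - (\<Sum>j\<in>UNIV. h $ j * pd j k (x - y))"
          by (simp only: g_def)
        then show ?thesis unfolding t(3) by (simp only: right_diff_distrib sum_subtractf)
      qed
      also have "\<bar>\<dots>\<bar> \<le> CARD('n) * (norm h * (CARD('n) * b * norm h))"
      proof (rule abs_sum_le_card)
        fix j
        have "\<bar>pd j k (x - y + t *\<^sub>R h) - pd j k (x - y)\<bar> \<le> CARD('n) * b * norm (t *\<^sub>R h)"
          by (rule pd_bounded_imp_Lipschitz[OF C1_differentiable[OF k1(2)] b(2)])
        also have "\<dots> \<le> CARD('n) * b * norm h"
          using t b(1) by (intro mult_left_mono) (auto intro: mult_left_le_one_le)
        finally show "\<bar>h $ j * (pd j k (x - y + t *\<^sub>R h) - pd j k (x - y))\<bar> \<le> norm h * (CARD('n) * b * norm h)"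
          unfolding abs_mult using component_le_norm_cart[of h j] by (intro mult_mono) auto
      qed
      finally show ?thesis by (simp add: power2_eq_square algebra_simps)
    qed
    have g2: "g y = 0" if "y \<notin> cball x (\<rho> + 1)" for y
      using out[OF that h] out[OF that, of 0] by (simp add: g_def k pk0)
    have g3: "continuous_on UNIV g"
      unfolding g_def by (intro continuous_intros cont kc)
    have "(\<integral>y. g y * f y \<partial>lebesgue) = (\<integral>y. k (x + h - y) * f y - k (x - y) * f y - (\<Sum>j\<in>UNIV. h $ j * (pd j k (x - y) * f y)) \<partial>lebesgue)"
      by (simp only: g_def left_diff_distrib sum_distrib_right mult.assoc)
    also have "\<dots> = conv k f (x + h) - conv k f x - (\<Sum>j\<in>UNIV. h $ j * conv (pd j k) f x)"
      unfolding conv_def using int[where x=x and h=h, OF kc(1) k(2) h]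
        int[where x=x and h=0, OF kc(1) k(2)] int[where x=x and h=0, OF kc(2) pk0] by simp
    finally show ?thesis
      using abs_integral_bounded_mult[OF S[of x] g3 g2 g1] by (simp add: N_def)
  qed
  have D: "(conv k f has_derivative (\<lambda>h. \<Sum>j\<in>UNIV. h $ j * conv (pd j k) f x)) (at x)" for x
    unfolding has_derivative_at
  proof
    show "bounded_linear (\<lambda>h. \<Sum>j\<in>UNIV. h $ j * conv (pd j k) f x)"
      by (intro bounded_linear_sum bounded_linear_mult_const bounded_linear_vec_nth)
    let ?Q = "\<lambda>h. norm (conv k f (x + h) - conv k f x - (\<Sum>j\<in>UNIV. h $ j * conv (pd j k) f x)) / norm h"
    define L where "L = CARD('n) * (CARD('n) * b) * N x"
    show "(?Q \<longlongrightarrow> 0) (at 0)"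
    proof (rule Lim_null_comparison)
      have "eventually (\<lambda>h :: real ^ 'n. norm h < 1) (at 0)"
        unfolding eventually_at by (intro exI[of _ 1]) auto
      then show "\<forall>\<^sub>F h in at 0. norm (?Q h) \<le> L * norm h"
      proof eventually_elim
        case (elim h)
        have "\<bar>conv k f (x + h) - conv k f x - (\<Sum>j\<in>UNIV. h $ j * conv (pd j k) f x)\<bar> \<le> (L * norm h) * norm h"
          using main[of h x] elim by (simp add: L_def power2_eq_square algebra_simps)
        then show ?case by (cases "h = 0") (auto simp: divide_le_eq)
      qed
      show "((\<lambda>h. L * norm h) \<longlongrightarrow> 0) (at (0 :: real ^ 'n))"
        by (auto intro!: tendsto_eq_intros)
    qed
  qed
  have Cc: "continuous_on UNIV (conv (pd j k) f)" for j
  proof (rule continuous_at_imp_continuous_on, rule ballI)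
    fix x
    define L where "L = CARD('n) * b * N x"
    have lip: "\<bar>conv (pd j k) f (x + h) - conv (pd j k) f x\<bar> \<le> L * norm h" if h: "norm h \<le> 1" for h
    proof -
      have "\<bar>\<integral>y. (pd j k (x + h - y) - pd j k (x - y)) * f y \<partial>lebesgue\<bar> \<le> (CARD('n) * b * norm h) * (LINT y:cball x (\<rho> + 1)|lebesgue. \<bar>f y\<bar>)"
      proof (rule abs_integral_bounded_mult[OF S[of x]])
        show "continuous_on UNIV (\<lambda>y. pd j k (x + h - y) - pd j k (x - y))"
          by (intro continuous_intros cont kc)
        show "pd j k (x + h - y) - pd j k (x - y) = 0" if "y \<notin> cball x (\<rho> + 1)" for y
          using out[OF that h] out[OF that, of 0] by (simp add: pk0)
        show "\<bar>pd j k (x + h - y) - pd j k (x - y)\<bar> \<le> CARD('n) * b * norm h" for y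
        proof -
          have e: "x + h - y = x - y + h" by simp
          show ?thesis unfolding e by (rule pd_bounded_imp_Lipschitz[OF C1_differentiable[OF k1(2)] b(2)])
        qed
      qed
      moreover have "conv (pd j k) f (x + h) - conv (pd j k) f x = (\<integral>y. (pd j k (x + h - y) - pd j k (x - y)) * f y \<partial>lebesgue)"
        unfolding conv_def left_diff_distrib
        using int[where x=x and h=h, OF kc(2) pk0 h] int[where x=x and h=0, OF kc(2) pk0] by simp
      ultimately show ?thesis by (simp only: L_def N_def mult_ac)
    qed
    have "((\<lambda>h. conv (pd j k) f (x + h) - conv (pd j k) f x) \<longlongrightarrow> 0) (at 0)"
    proof (rule Lim_null_comparison)
      have "eventually (\<lambda>h :: real ^ 'n. norm h < 1) (at 0)"
        unfolding eventually_at by (intro exI[of _ 1]) auto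
      then show "\<forall>\<^sub>F h in at 0. norm (conv (pd j k) f (x + h) - conv (pd j k) f x) \<le> L * norm h"
        by eventually_elim (use lip in auto)
      show "((\<lambda>h. L * norm h) \<longlongrightarrow> 0) (at (0 :: real ^ 'n))"
        by (auto intro!: tendsto_eq_intros)
    qed
    then show "isCont (conv (pd j k) f) x"
      by (simp add: isCont_iff LIM_zero_iff)
  qed
  show "C1 (conv k f)" "pd j (conv k f) = conv (pd j k) f"
    using C1I[OF D Cc] by auto
qed

text \<open>The part of the potential at scale \<open>R\<close>: a mollification of the \<open>BMO\<close> tensor, normalised by its mean.\<close>

lemma BMO_inv_mollified_potential:
  fixes u :: "real ^ 3 \<Rightarrow> real ^ 3"
  assumes u: "u \<in> BMO_inv" "smooth_function u"
  obtains C where "0 \<le> C" "\<And>R. 0 < R \<Longrightarrow> \<exists>E :: 3 \<Rightarrow> 3 \<Rightarrow> real ^ 3 \<Rightarrow> real.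
     (\<forall>i j. C1 (E i j)) \<and> (\<forall>i j x. E i j x = - E j i x) \<and>
     (\<forall>i x. (\<Sum>j\<in>UNIV. pd j (E i j) x) = avg mollifier (\<lambda>x. u x $ i) R x) \<and>
     (\<forall>i j x. norm x \<le> 2 * R \<longrightarrow> \<bar>E i j x\<bar> \<le> C \<and> (\<forall>k. \<bar>pd k (E i j) x\<bar> \<le> C / R))"
proof -
  obtain d where d: "\<And>i j. (\<lambda>x. d x $ i $ j) \<in> BMO" "is_weak_divergence u d" "\<And>x i j. d x $ i $ j = - d x $ j $ i"
    using u(1) unfolding BMO_inv_def mem_Collect_eq by blast
  have "\<exists>C\<ge>0. \<forall>x r. 0 < r \<longrightarrow> (LINT y:ball x r|lebesgue. \<bar>d y $ i $ j - mean_on (ball x r) (\<lambda>x. d x $ i $ j)\<bar>) \<le> C * r ^ 3" for i j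
    using BMO_ball_oscillation[OF d(1)[of i j]] by metis
  then obtain C where C: "\<And>i j. 0 \<le> C i j"
    "\<And>i j x r. 0 < r \<Longrightarrow> (LINT y:ball x r|lebesgue. \<bar>d y $ i $ j - mean_on (ball x r) (\<lambda>x. d x $ i $ j)\<bar>) \<le> C i j * r ^ 3"
    by metis
  define K where "K = (\<Sum>i\<in>UNIV. \<Sum>j\<in>UNIV. C i j)"
  have K: "C i j \<le> K" "0 \<le> K" for i j
    unfolding K_def using C(1) by (auto intro: member_le_double_sum sum_nonneg)
  obtain M0 where M0: "0 \<le> M0" "\<And>z :: real ^ 3. \<bar>mollifier z\<bar> \<le> M0"
    by (rule continuous_support_bounded[of "mollifier :: real ^ 3 \<Rightarrow> real" 1])
       (auto simp: mollifier_continuous mollifier_outside)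
  have "\<exists>M\<ge>0. \<forall>z. \<bar>pd k (mollifier :: real ^ 3 \<Rightarrow> real) z\<bar> \<le> M" for k
    using continuous_support_bounded[of "pd k (mollifier :: real ^ 3 \<Rightarrow> real)" 1] C1_continuous_pd[OF mollifier_C1]
      pd_unit_support[OF mollifier_C1 mollifier_outside]
    by (metis less_imp_le)
  then obtain M where M: "\<And>k. 0 \<le> M k" "\<And>k z. \<bar>pd k (mollifier :: real ^ 3 \<Rightarrow> real) z\<bar> \<le> M k" by metis
  define M1 where "M1 = M0 + (\<Sum>k\<in>UNIV. M k)"
  have M1: "0 \<le> M1" "\<bar>mollifier z\<bar> \<le> M1" "\<bar>pd k mollifier z\<bar> \<le> M1" for k and z :: "real ^ 3"
  proof -
    have s: "0 \<le> (\<Sum>k\<in>UNIV. M k)" "M k \<le> (\<Sum>k\<in>UNIV. M k)" using M by (auto intro!: sum_nonneg member_le_sum)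
    show "0 \<le> M1" "\<bar>mollifier z\<bar> \<le> M1" "\<bar>pd k mollifier z\<bar> \<le> M1"
      unfolding M1_def using s M0(1) M0(2)[of z] M(2)[of k z] by linarith+
  qed
  have "\<exists>E :: 3 \<Rightarrow> 3 \<Rightarrow> real ^ 3 \<Rightarrow> real.
     (\<forall>i j. C1 (E i j)) \<and> (\<forall>i j x. E i j x = - E j i x) \<and>
     (\<forall>i x. (\<Sum>j\<in>UNIV. pd j (E i j) x) = avg mollifier (\<lambda>x. u x $ i) R x) \<and>
     (\<forall>i j x. norm x \<le> 2 * R \<longrightarrow> \<bar>E i j x\<bar> \<le> 64 * K * M1 \<and> (\<forall>k. \<bar>pd k (E i j) x\<bar> \<le> 64 * K * M1 / R))"
    if R: "0 < R" for R
  proof -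
    \<comment> \<open>For \<open>norm x \<le> 2 * R\<close> the kernel reaches points of norm at
      most 3R, so one ball of radius 4R serves all such \<open>x\<close>; 4^3 is the factor 64 in
      the bounds. Subtracting \<open>c\<close> preserves skewness.\<close>
    define c where "c = (\<lambda>i j. mean_on (ball (0 :: real ^ 3) (4 * R)) (\<lambda>y. d y $ i $ j))"
    have c: "c i j = - c j i" for i j
      unfolding c_def mean_on_def d(3)[of _ i j] by (simp add: set_lebesgue_integral_def)
    define k where "k = (\<lambda>w :: real ^ 3. (1 / R ^ 3) * mollifier ((1 / R) *\<^sub>R w))"
    have sc: "C1 (\<lambda>w. g ((1 / R) *\<^sub>R w))" "pd j (\<lambda>w. g ((1 / R) *\<^sub>R w)) = (\<lambda>w. (1 / R) * pd j g ((1 / R) *\<^sub>R w))"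
      if "smooth_function g" for g :: "real ^ 3 \<Rightarrow> real" and j
      using smooth_C1[OF smooth_affine[OF that, of "1 / R" 0]] pd_affine[OF smooth_C1[OF that], of j "1 / R" 0] by auto
    have pk: "pd j k = (\<lambda>w. (1 / R ^ 4) * pd j mollifier ((1 / R) *\<^sub>R w))" for j
      unfolding k_def using sc[OF mollifier_smooth]
      by (simp add: fun_eq_iff pd_cmult del: times_divide_eq_left) (simp add: field_simps eval_nat_numeral)
    have k: "C2 k"
      unfolding C2_def
    proof
      show "C1 k" unfolding k_def by (intro C1_mult C1_const sc mollifier_smooth)
      show "\<forall>j. C1 (pd j k)" unfolding pk by (intro allI C1_mult C1_const sc smooth_partial_deriv mollifier_smooth)
    qed
    have k0: "k w = 0" if "R \<le> norm w" for w
      using that R mollifier_outside[of "(1 / R) *\<^sub>R w"] by (simp add: k_def field_simps)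
    have k0': "k w = 0" if "R < norm w" for w using k0 that by simp
    have pk0: "pd j k w = 0" if "R < norm w" for j w by (rule pd_zero_outside[OF k0' that])
    have kb: "\<bar>k w\<bar> \<le> M1 / R ^ 3" "\<bar>pd j k w\<bar> \<le> M1 / R ^ 4" for j w
    proof -
      show "\<bar>k w\<bar> \<le> M1 / R ^ 3" unfolding k_def using M1(2)[of "(1 / R) *\<^sub>R w"] R by (simp add: abs_mult field_simps)
      show "\<bar>pd j k w\<bar> \<le> M1 / R ^ 4" unfolding pk using M1(3)[of j "(1 / R) *\<^sub>R w"] R by (simp add: abs_mult field_simps)
    qed
    define f where "f = (\<lambda>i j y. d y $ i $ j - c i j)"
    have li0: "locally_integrable (\<lambda>y. d y $ i $ j)" for i j using d(1) by (simp add: BMO_def)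
    have li: "locally_integrable (f i j)" for i j
      unfolding f_def by (rule locally_integrable_diff_const[OF li0])
    have fR: "(LINT y:ball 0 (4 * R)|lebesgue. \<bar>f i j y\<bar>) \<le> 64 * K * R ^ 3" for i j
    proof -
      have "(LINT y:ball 0 (4 * R)|lebesgue. \<bar>f i j y\<bar>) \<le> C i j * (4 * R) ^ 3"
        unfolding f_def c_def using R by (intro C(2)) auto
      also have "\<dots> \<le> K * (4 * R) ^ 3" using R by (intro mult_right_mono K) auto
      finally show ?thesis by (simp add: power_mult_distrib)
    qed
    define E where "E = (\<lambda>i j. conv k (f i j))"
    have pE: "pd l (E i j) = conv (pd l k) (f i j)" for i j l
      unfolding E_def by (rule pd_conv[OF k k0' li])
    have bound: "\<bar>conv g (f i j) x\<bar> \<le> m * (64 * K * R ^ 3)"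
      if g: "continuous_on UNIV g" "\<And>w. R < norm w \<Longrightarrow> g w = 0" "\<And>w. \<bar>g w\<bar> \<le> m" and x: "norm x \<le> 2 * R" for g m i j x
    proof -
      have "\<bar>conv g (f i j) x\<bar> \<le> m * (LINT y:ball 0 (4 * R)|lebesgue. \<bar>f i j y\<bar>)"
        unfolding conv_def
      proof (rule abs_integral_bounded_mult)
        show "set_integrable lebesgue (ball 0 (4 * R)) (f i j)" by (rule locally_integrable_set_integrable[OF li])
        show cg: "continuous_on UNIV (\<lambda>y. g (x - y))"
          by (intro continuous_on_compose2[OF g(1)] continuous_intros) auto
        show "g (x - y) = 0" if y: "y \<notin> ball 0 (4 * R)" for y
        proof -
          have "4 * R \<le> norm y" using y by simp
          then have "R < norm (x - y)"
            using x R norm_triangle_ineq2[of y x] by (simp add: norm_minus_commute)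
          then show ?thesis by (rule g(2))
        qed
        show "\<bar>g (x - y)\<bar> \<le> m" for y by (rule g(3))
      qed
      also have "\<dots> \<le> m * (64 * K * R ^ 3)"
        using g(3)[of 0] by (intro mult_left_mono fR) linarith
      finally show ?thesis .
    qed
    have kc: "continuous_on UNIV k" "continuous_on UNIV (pd j k)" for j
      using k by (auto intro: C1_continuous C2_C1 C1_continuous_pd)
    \<comment> \<open>The mollified tensor has the mollified field as divergence: up to the factor
      \<open>R ^ 3\<close> the kernel is a test function of \<open>y\<close>, to which the weak
      divergence identity is applied.\<close>
    have div: "(\<Sum>j\<in>UNIV. pd j (E i j) x) = avg mollifier (\<lambda>x. u x $ i) R x" for i x
    proof -
      define \<theta> where "\<theta> = (\<lambda>y. mollifier ((1 / R) *\<^sub>R (x - y)))"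
      have \<theta>: "test_function \<theta>" "\<And>y. R \<le> dist x y \<Longrightarrow> \<theta> y = 0" "\<And>k y. pd k \<theta> y = - (1 / R) * pd k mollifier ((1 / R) *\<^sub>R (x - y))"
        unfolding \<theta>_def by (rule test_function_reflected[where x=x, OF mollifier_smooth mollifier_outside R]; simp)+
      have \<theta>1: "C1 \<theta>" using \<theta>(1) by (simp add: test_function_def smooth_C1)
      have z: "(\<integral>y. pd j \<theta> y \<partial>lebesgue) = 0" for j
      proof (rule integral_lebesgue_pd_zero[OF \<theta>1, where \<rho>="norm x + R"])
        fix y :: "real ^ 3" assume "norm x + R < norm y"
        then show "\<theta> y = 0" using norm_triangle_ineq2[of y x] by (intro \<theta>(2)) (simp add: dist_norm norm_minus_commute)
      qed
      \<comment> \<open>The derivative in \<open>x\<close> is minus the derivative in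
        \<open>y\<close>; this sign matches the one in \<open>is_weak_divergence\<close>.\<close>
      have th: "pd j k (x - y) = - (1 / R ^ 3) * pd j \<theta> y" for j y
        unfolding pk \<theta>(3) using R by (simp add: field_simps eval_nat_numeral)
      have p: "pd j (E i j) x = - (1 / R ^ 3) * (\<integral>y. d y $ i $ j * pd j \<theta> y \<partial>lebesgue)" for j
      proof -
        have s0: "pd j \<theta> y = 0" if "y \<notin> cball x R" for y
          by (rule pd_zero_open[of "- cball x R"]) (use that \<theta>(2) in auto)
        have bb: "\<bar>pd j \<theta> y\<bar> \<le> M1 / R" for y
          unfolding \<theta>(3) using M1(3)[of j "(1 / R) *\<^sub>R (x - y)"] R by (simp add: abs_mult field_simps)
        note c\<theta> = C1_continuous_pd[OF \<theta>1, of UNIV j]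
        have i1: "integrable lebesgue (\<lambda>y. pd j \<theta> y * d y $ i $ j)"
          by (rule integrable_bounded_mult[OF locally_integrable_set_integrable(1)[OF li0] c\<theta> s0 bb])
        have i2: "integrable lebesgue (\<lambda>y. pd j \<theta> y * c i j)"
          by (rule integrable_bounded_mult[OF set_integrable_const_ball(2) c\<theta> s0 bb])
        have "pd j (E i j) x = (\<integral>y. - (1 / R ^ 3) * (pd j \<theta> y * d y $ i $ j - pd j \<theta> y * c i j) \<partial>lebesgue)"
          unfolding pE conv_def th f_def by (simp only: right_diff_distrib mult.assoc)
        also have "\<dots> = - (1 / R ^ 3) * ((\<integral>y. pd j \<theta> y * d y $ i $ j \<partial>lebesgue) - (\<integral>y. pd j \<theta> y * c i j \<partial>lebesgue))"
          using i1 i2 by simp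
        \<comment> \<open>The normalising constant drops out since a derivative of a test function
          has mean zero.\<close>
        also have "(\<integral>y. pd j \<theta> y * c i j \<partial>lebesgue) = 0" using z by simp
        finally show ?thesis by (simp add: mult.commute)
      qed
      have "(\<Sum>j\<in>UNIV. pd j (E i j) x) = (1 / R ^ 3) * (- (\<Sum>j\<in>UNIV. \<integral>y. d y $ i $ j * pd j \<theta> y \<partial>lebesgue))"
        unfolding p by (simp add: sum_distrib_left sum_negf)
      also have "- (\<Sum>j\<in>UNIV. \<integral>y. d y $ i $ j * pd j \<theta> y \<partial>lebesgue) = (\<integral>y. u y $ i * \<theta> y \<partial>lebesgue)"
        using d(2) \<theta>(1) by (simp add: is_weak_divergence_def)
      also have "\<dots> = R ^ 3 * avg mollifier (\<lambda>x. u x $ i) R x"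
        unfolding \<theta>_def
        by (rule avg_eq_lebesgue[OF mollifier_continuous mollifier_outside
            C1_continuous[OF smooth_C1[OF smooth_component[OF u(2)]]] R])
      finally show ?thesis using R by simp
    qed
    have skewE: "E i j x = - E j i x" for i j x
    proof -
      have "f i j y = - f j i y" for y unfolding f_def using d(3)[of y i j] c[of i j] by simp
      then have "(\<lambda>y. k (x - y) * f i j y) = (\<lambda>y. - (k (x - y) * f j i y))" by (simp add: fun_eq_iff)
      then show ?thesis unfolding E_def conv_def by simp
    qed
    have b1: "\<bar>E i j x\<bar> \<le> 64 * K * M1" if "norm x \<le> 2 * R" for i j x
      using bound[OF kc(1) k0' kb(1) that] R unfolding E_def by (simp add: mult_ac)
    have b2: "\<bar>pd l (E i j) x\<bar> \<le> 64 * K * M1 / R" if "norm x \<le> 2 * R" for i j l x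
      using bound[OF kc(2) pk0 kb(2) that] R unfolding pE by (simp add: field_simps eval_nat_numeral)
    show ?thesis
    proof (intro exI[of _ E] conjI allI impI)
      show "C1 (E i j)" for i j unfolding E_def by (rule C1_conv[OF k k0' li])
    qed (rule skewE div b1 b2; assumption?)+
  qed
  moreover have "0 \<le> 64 * K * M1" using K(2) M1(1) by simp
  ultimately show ?thesis using that[of "64 * K * M1"] by blast
qed

section \<open>The weighted square estimate\<close>

lemma emeasure_cball_scale:
  fixes x :: "real ^ 3"
  assumes "0 \<le> r"
  shows "emeasure lborel (cball x r) = ennreal (r ^ 3 * measure lborel (cball (0 :: real ^ 3) 1))"
proof -
  have "measure lborel (cball x r) = r ^ 3 * measure lborel (cball (0 :: real ^ 3) 1)"
    using content_ball_conv_unit_ball[of r x] assms unfolding content_cball_conv_ball by simp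
  moreover have "emeasure lborel (cball x r) = ennreal (measure lborel (cball x r))"
    using emeasure_compact_finite[OF compact_cball, of x r] by (intro emeasure_eq_ennreal_measure) auto
  ultimately show ?thesis by simp
qed

text \<open>For the largest exponent c = (q-2)/q this is Young's inequality with conjugate exponents
  q/2 and q/(q-2), proved by comparing \<open>V\<close> with \<open>g powr q\<close>. The summand 1
  covers \<open>V \<le> 1\<close>, where smaller exponents give larger powers.\<close>

lemma square_mult_powr_le:
  fixes g V :: real
  assumes "0 \<le> g" "0 \<le> V" "0 < a" "2 < q" "a \<le> (q - 2) / q"
  shows "g\<^sup>2 * V powr a \<le> 1 + g powr q + V"
proof (cases "V \<le> 1")
  case True
  have "V powr a \<le> 1" using True assms by (intro powr_le1) auto
  then have "g\<^sup>2 * V powr a \<le> g\<^sup>2" using mult_left_mono[of "V powr a" 1 "g\<^sup>2"] by simp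
  also have "g\<^sup>2 \<le> 1 + g powr q"
  proof (cases "g \<le> 1")
    case True
    then have "g\<^sup>2 \<le> 1" using assms by (simp add: power_le_one)
    then show ?thesis using powr_ge_zero[of g q] by linarith
  next
    case False
    then have "g\<^sup>2 = g powr 2" by simp
    also have "\<dots> \<le> g powr q" using False assms by (intro powr_mono) auto
    finally show ?thesis by simp
  qed
  finally show ?thesis using assms by simp
next
  case False
  define c where "c = (q - 2) / q"
  have V: "V powr a \<le> V powr c" using False assms unfolding c_def by (intro powr_mono) auto
  have c: "0 < c" "q * c = q - 2" using assms by (auto simp: c_def)
  have "g\<^sup>2 * V powr c \<le> g powr q + V"
  proof (cases "V \<le> g powr q")
    case True
    then have g: "0 < g" using False assms by (cases "g = 0") auto
    have "V powr c \<le> (g powr q) powr c" using True False c by (intro powr_mono2) auto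
    also have "\<dots> = g powr (q - 2)" by (simp add: powr_powr c)
    finally have "g\<^sup>2 * V powr c \<le> g powr 2 * g powr (q - 2)" using g by (intro mult_mono) auto
    also have "\<dots> = g powr q" by (simp add: powr_add[symmetric])
    finally show ?thesis using assms by simp
  next
    case F2: False
    have "g = (g powr q) powr (1 / q)" using assms by (simp add: powr_powr)
    also have "\<dots> \<le> V powr (1 / q)" using F2 assms by (intro powr_mono2) auto
    finally have "g\<^sup>2 \<le> (V powr (1 / q))\<^sup>2" using assms by (intro power_mono) auto
    also have "\<dots> = V powr (2 / q)" using False by (simp add: power2_eq_square powr_add[symmetric])
    finally have "g\<^sup>2 * V powr c \<le> V powr (2 / q) * V powr c" by (intro mult_right_mono) auto
    also have "\<dots> = V powr (2 / q + c)" by (simp add: powr_add)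
    also have "2 / q + c = 1" using assms by (simp add: c_def field_simps)
    finally have "g\<^sup>2 * V powr c \<le> V" using False by simp
    then show ?thesis using powr_ge_zero[of g q] by linarith
  qed
  moreover have "g\<^sup>2 * V powr a \<le> g\<^sup>2 * V powr c" using V by (intro mult_left_mono) auto
  ultimately show ?thesis by linarith
qed

lemma le_one_plus_powr:
  fixes g :: real
  assumes "0 \<le> g" "1 \<le> q"
  shows "g \<le> 1 + g powr q"
proof (cases "g \<le> 1")
  case True
  then show ?thesis using powr_ge_zero[of g q] by linarith
next
  case False
  then have "g powr 1 \<le> g powr q" using assms by (intro powr_mono) auto
  then show ?thesis using False by simp
qed

text \<open>Interpolating the two bounds \<open>\<bar>F\<bar> \<le> C / r\<close> and \<open>F \<in> L\<^sup>q\<close> makes the integral over \<open>r\<close> converge at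
  zero at the price of an arbitrarily small power of \<open>R\<close>.\<close>

lemma weighted_square_estimate:
  fixes e g :: "real ^ 3 \<Rightarrow> real" and F :: "real \<Rightarrow> real ^ 3 \<Rightarrow> real" and u :: "real ^ 3 \<Rightarrow> real ^ 3"
  assumes q: "2 < q" "q < 6" and a: "0 < a" "a \<le> 1" "a \<le> (q - 2) / q" and R: "1 \<le> R"
    and F: "continuous_on UNIV (\<lambda>p. F (fst p) (snd p))" "\<And>x. F 0 x = 0"
    and e: "\<And>x. e x = - integral {0..R} (\<lambda>r. F r x)"
    and F1: "\<And>r x. 0 < r \<Longrightarrow> \<bar>F r x\<bar> \<le> C / r" and C: "0 \<le> C"
    and F2: "\<And>r x. 0 < r \<Longrightarrow> ennreal \<bar>F r x\<bar> \<le> ennreal M * (\<integral>\<^sup>+z. ennreal (indicator (cball 0 1) z * norm (u (x - r *\<^sub>R z))) \<partial>lborel)"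
    and M: "0 \<le> M"
    and u: "continuous_on UNIV u" "(\<integral>\<^sup>+x. ennreal (norm (u x) powr q) \<partial>lborel) \<le> ennreal N" and N: "0 \<le> N"
    and g: "continuous_on UNIV g" "\<And>x. 0 \<le> g x" and L: "0 \<le> L"
      "(\<integral>\<^sup>+x. ennreal (indicator (cball 0 (2 * R)) x * g x powr q) \<partial>lborel) \<le> ennreal (L * R ^ 3)"
    and v: "v = measure lborel (cball (0 :: real ^ 3) 1)"
  shows "(\<integral>\<^sup>+x. ennreal (indicator (cball 0 (2 * R)) x * ((g x)\<^sup>2 * (e x)\<^sup>2)) \<partial>lborel)
    \<le> ennreal ((C + 1)\<^sup>2 * 4 / a\<^sup>2 * (8 * v + L + M * (v * (8 * v + N))) * R powr (3 + a / 2))"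
proof -
  \<comment> \<open>With a = 2s the powers of \<open>r\<close> close up: (1 - s) + (a - 2) = s - 1,
    so both factors of the Cauchy-Schwarz inequality carry the weight \<open>r powr (s - 1)\<close>,
    which is integrable at 0.\<close>
  define s where "s = a / 2"
  \<comment> \<open>\<open>R powr b\<close> times the field has q-th power integral O(R^3), the same
    order as the volume of the ball.\<close>
  define b where "b = 3 / q"
  \<comment> \<open>Adding 1 makes the base at least 1, so that \<open>K0 powr (2 - a)\<close> is at
    most \<open>K0\<^sup>2\<close>.\<close>
  define K0 where "K0 = C + 1"
  have s: "0 < s" "a = 2 * s" using a by (auto simp: s_def)
  have K0: "1 \<le> K0" using C by (simp add: K0_def)
  have v0: "0 \<le> v" by (simp add: v)
  have [measurable]: "(\<lambda>p. F (fst p) (snd p)) \<in> borel_measurable (borel \<Otimes>\<^sub>M borel)"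
    unfolding borel_prod using F(1) by (rule borel_measurable_continuous_onI)
  have [measurable]: "(\<lambda>p. F (snd p) (fst p)) \<in> borel_measurable (borel \<Otimes>\<^sub>M borel)"
    unfolding borel_prod
    using continuous_on_compose2[OF F(1), of UNIV "\<lambda>p. (snd p, fst p)"]
    by (intro borel_measurable_continuous_onI) (simp add: continuous_intros)
  have [measurable]: "u \<in> borel_measurable borel" "g \<in> borel_measurable borel"
    using u(1) g(1) by (auto intro: borel_measurable_continuous_onI)
  have Fr: "continuous_on S (\<lambda>r. F r x)" for S x
    using continuous_on_compose2[OF F(1), of S "\<lambda>r. (r, x)"] by (simp add: continuous_intros)
  have Fm [measurable]: "(\<lambda>r. F r x) \<in> borel_measurable borel" for x
    using Fr[of UNIV x] by (rule borel_measurable_continuous_onI)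
  have Fx: "continuous_on S (\<lambda>x. F r x)" for S r
    using continuous_on_compose2[OF F(1), of S "\<lambda>x. (r, x)"] by (simp add: continuous_intros)
  have Fm' [measurable]: "(\<lambda>x. F r x) \<in> borel_measurable borel" for r
    using Fx[of UNIV r] by (rule borel_measurable_continuous_onI)
  have [measurable]: "cball (c :: real ^ 3) t \<in> sets borel" for c t by simp
  have contu: "continuous_on S (\<lambda>p. u (h p))" if "continuous_on S h" for S and h :: "'x::topological_space \<Rightarrow> real ^ 3"
    by (rule continuous_on_compose2[OF u(1) that]) auto
  let ?I = "\<lambda>r. indicator {0..R} r :: real"
  let ?B = "\<lambda>x :: real ^ 3. indicator (cball 0 (2 * R)) x :: real"
  have I1: "(\<integral>\<^sup>+r. ennreal (?I r * r powr (s - 1)) \<partial>lborel) = ennreal (R powr s / s)"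
    using nn_integral_has_integral_lebesgue[OF _ has_integral_powr_from_0[of "s - 1" R]] s R by simp
  \<comment> \<open>Cauchy-Schwarz in \<open>r\<close>, splitting off the weight
    \<open>r powr ((s - 1) / 2)\<close>; then the power 2 - a of \<open>F\<close> is spent on the
    bound \<open>K0 / r\<close>, and the power \<open>a\<close> is kept.\<close>
  have step1: "ennreal ((e x)\<^sup>2) \<le> ennreal (R powr s / s * K0\<^sup>2) * (\<integral>\<^sup>+r. ennreal (?I r * (r powr (s - 1) * \<bar>F r x\<bar> powr a)) \<partial>lborel)" for x
  proof -
    let ?f = "\<lambda>r. ennreal (?I r * r powr ((s - 1) / 2))"
    let ?g = "\<lambda>r. ennreal (?I r * (r powr ((1 - s) / 2) * \<bar>F r x\<bar>))"
    have int: "(\<lambda>r. \<bar>F r x\<bar>) integrable_on {0..R}" "(\<lambda>r. F r x) integrable_on {0..R}"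
      by (intro integrable_continuous_interval continuous_intros Fr)+
    have "\<bar>e x\<bar> \<le> integral {0..R} (\<lambda>r. \<bar>F r x\<bar>)"
      unfolding e abs_minus_cancel using integral_norm_bound_integral[OF int(2,1)] by simp
    then have "ennreal \<bar>e x\<bar> \<le> (\<integral>\<^sup>+r. ennreal (?I r * \<bar>F r x\<bar>) \<partial>lborel)"
      using nn_integral_has_integral_lebesgue[OF _ integrable_integral[OF int(1)]] by (simp add: ennreal_leI)
    also have "\<dots> = (\<integral>\<^sup>+r. ?f r * ?g r \<partial>lborel)"
    proof (intro nn_integral_cong)
      fix r
      have "?I r * \<bar>F r x\<bar> = (?I r * r powr ((s - 1) / 2)) * (?I r * (r powr ((1 - s) / 2) * \<bar>F r x\<bar>))"
      \<comment> \<open>At \<open>r = 0\<close> both weights are \<open>0 powr _ = 0\<close>, so the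
        splitting relies on \<open>F 0 x = 0\<close>.\<close>
      proof (cases "r \<le> 0")
        case True
        then show ?thesis using F(2)[of x] by (cases "r = 0") auto
      next
        case False
        have "r powr ((s - 1) / 2) * r powr ((1 - s) / 2) = r powr ((s - 1) / 2 + (1 - s) / 2)"
          by (rule powr_add[symmetric])
        also have "(s - 1) / 2 + (1 - s) / 2 = 0" by (simp add: field_simps)
        finally have "r powr ((s - 1) / 2) * r powr ((1 - s) / 2) = 1" using False by simp
        then have "\<bar>F r x\<bar> = (r powr ((s - 1) / 2) * r powr ((1 - s) / 2)) * \<bar>F r x\<bar>" by simp
        then show ?thesis by (auto simp: indicator_def)
      qed
      then show "ennreal (?I r * \<bar>F r x\<bar>) = ?f r * ?g r" by (simp add: ennreal_mult'[symmetric])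
    qed
    finally have "(ennreal \<bar>e x\<bar>)\<^sup>2 \<le> (\<integral>\<^sup>+r. ?f r * ?g r \<partial>lborel)\<^sup>2" by (rule power_mono) simp
    also have "\<dots> \<le> (\<integral>\<^sup>+r. (?f r)\<^sup>2 \<partial>lborel) * (\<integral>\<^sup>+r. (?g r)\<^sup>2 \<partial>lborel)"
      by (rule Cauchy_Schwarz_nn_integral) measurable
    also have "(\<integral>\<^sup>+r. (?f r)\<^sup>2 \<partial>lborel) = ennreal (R powr s / s)"
    proof -
      have "(?f r)\<^sup>2 = ennreal (?I r * r powr (s - 1))" for r
      proof -
        have "(?f r)\<^sup>2 = ennreal ((?I r * r powr ((s - 1) / 2))\<^sup>2)" by (rule ennreal_power) simp
        also have "(?I r * r powr ((s - 1) / 2))\<^sup>2 = ?I r * r powr (s - 1)"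
          by (auto simp: indicator_def power2_eq_square powr_add[symmetric])
        finally show ?thesis .
      qed
      then show ?thesis by (simp only: I1)
    qed
    also have "(\<integral>\<^sup>+r. (?g r)\<^sup>2 \<partial>lborel) \<le> (\<integral>\<^sup>+r. ennreal (K0\<^sup>2) * ennreal (?I r * (r powr (s - 1) * \<bar>F r x\<bar> powr a)) \<partial>lborel)"
    proof (intro nn_integral_mono)
      fix r
      have "?I r * (r powr (1 - s) * (F r x)\<^sup>2) \<le> K0\<^sup>2 * (?I r * (r powr (s - 1) * \<bar>F r x\<bar> powr a))"
      proof (cases "0 < r \<and> F r x \<noteq> 0")
        case False
        then show ?thesis using F(2)[of x] by (auto simp: indicator_def)
      next
        case True
        have "\<bar>F r x\<bar> powr (2 - a) \<le> (K0 / r) powr (2 - a)"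
          using F1[of r x] True a by (intro powr_mono2) (auto simp: K0_def field_simps)
        also have "\<dots> = K0 powr (2 - a) * r powr (a - 2)"
          using True K0 by (simp add: powr_divide powr_diff field_simps)
        also have "\<dots> \<le> K0\<^sup>2 * r powr (a - 2)"
        proof (rule mult_right_mono)
          have "K0 powr (2 - a) \<le> K0 powr 2" using K0 a by (intro powr_mono) auto
          then show "K0 powr (2 - a) \<le> K0\<^sup>2" using K0 by simp
        qed simp
        finally have 1: "\<bar>F r x\<bar> powr (2 - a) \<le> K0\<^sup>2 * r powr (a - 2)" .
        have "(F r x)\<^sup>2 = \<bar>F r x\<bar> powr 2" using True by simp
        also have "\<dots> = \<bar>F r x\<bar> powr (2 - a) * \<bar>F r x\<bar> powr a" by (simp add: powr_add[symmetric])
        also have "\<dots> \<le> K0\<^sup>2 * r powr (a - 2) * \<bar>F r x\<bar> powr a" using 1 by (rule mult_right_mono) simp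
        finally have "r powr (1 - s) * (F r x)\<^sup>2 \<le> r powr (1 - s) * (K0\<^sup>2 * r powr (a - 2) * \<bar>F r x\<bar> powr a)"
          by (rule mult_left_mono) simp
        also have "\<dots> = K0\<^sup>2 * ((r powr (1 - s) * r powr (a - 2)) * \<bar>F r x\<bar> powr a)" by simp
        also have "r powr (1 - s) * r powr (a - 2) = r powr (s - 1)"
          by (simp add: powr_add[symmetric] s(2))
        finally show ?thesis by (auto simp: indicator_def)
      qed
      moreover have "(?g r)\<^sup>2 = ennreal (?I r * (r powr (1 - s) * (F r x)\<^sup>2))"
        by (auto simp: ennreal_power indicator_def power_mult_distrib power2_eq_square[of "_ powr _"] powr_add[symmetric])
      ultimately show "(?g r)\<^sup>2 \<le> ennreal (K0\<^sup>2) * ennreal (?I r * (r powr (s - 1) * \<bar>F r x\<bar> powr a))"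
        by (simp add: ennreal_mult'[symmetric] ennreal_leI)
    qed
    also have "\<dots> = ennreal (K0\<^sup>2) * (\<integral>\<^sup>+r. ennreal (?I r * (r powr (s - 1) * \<bar>F r x\<bar> powr a)) \<partial>lborel)"
      by (rule nn_integral_cmult) measurable
    finally have "(ennreal \<bar>e x\<bar>)\<^sup>2 \<le> ennreal (R powr s / s) * (ennreal (K0\<^sup>2) * (\<integral>\<^sup>+r. ennreal (?I r * (r powr (s - 1) * \<bar>F r x\<bar> powr a)) \<partial>lborel))"
      by (simp add: mult_left_mono)
    moreover have "ennreal (R powr s / s * K0\<^sup>2) = ennreal (R powr s / s) * ennreal (K0\<^sup>2)"
      using s by (intro ennreal_mult) auto
    moreover have "(ennreal \<bar>e x\<bar>)\<^sup>2 = ennreal ((e x)\<^sup>2)" by (simp add: ennreal_power)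
    ultimately show ?thesis by (simp only: mult.assoc)
  qed
  define K2 where "K2 = 8 * v + L + M * (v * (8 * v + N))"
  have K2: "0 \<le> K2" using v0 L M N by (simp add: K2_def)
  define U where "U = (\<lambda>x. R powr b * norm (u x))"
  have Um [measurable]: "U \<in> borel_measurable borel" unfolding U_def by measurable
  have U: "(\<integral>\<^sup>+x. ennreal (U x powr q) \<partial>lborel) \<le> ennreal (N * R ^ 3)"
  proof -
    have "U x powr q = R ^ 3 * norm (u x) powr q" for x
      using R q by (simp add: U_def powr_mult powr_powr b_def powr_numeral)
    then have "(\<integral>\<^sup>+x. ennreal (U x powr q) \<partial>lborel) = ennreal (R ^ 3) * (\<integral>\<^sup>+x. ennreal (norm (u x) powr q) \<partial>lborel)"
      using R by (simp add: ennreal_mult' nn_integral_cmult)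
    also have "\<dots> \<le> ennreal (R ^ 3) * ennreal N" by (intro mult_left_mono u(2)) simp
    finally show ?thesis using R N by (simp add: ennreal_mult'[symmetric] mult.commute)
  qed
  have mU: "(\<lambda>z. norm (u (x - r *\<^sub>R z))) \<in> borel_measurable borel" "(\<lambda>x. U (x - y)) \<in> borel_measurable borel" for x y r
    unfolding U_def by (intro borel_measurable_continuous_onI continuous_intros contu)+
  note mU [measurable]
  have volB: "(\<integral>\<^sup>+x. ennreal (?B x) \<partial>lborel) = ennreal (8 * v * R ^ 3)"
    using emeasure_cball_scale[of "2 * R" "0 :: real ^ 3"] R by (simp add: v power_mult_distrib ennreal_indicator mult_ac)
  have vol1: "(\<integral>\<^sup>+z. ennreal (indicator (cball (0 :: real ^ 3) 1) z) \<partial>lborel) = ennreal v"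
    using emeasure_cball_scale[of 1 "0 :: real ^ 3"] by (simp add: v ennreal_indicator)
  \<comment> \<open>Uniform in the shift: \<open>U \<le> 1 + U powr q\<close>, where the 1 is paid
    by the volume of the ball and the power by the translation-invariant integral over the whole
    space.\<close>
  have shiftU: "(\<integral>\<^sup>+x. ennreal (?B x * U (x - y)) \<partial>lborel) \<le> ennreal ((8 * v + N) * R ^ 3)" for y
  proof -
    have "(\<integral>\<^sup>+x. ennreal (?B x * U (x - y)) \<partial>lborel) \<le> (\<integral>\<^sup>+x. ennreal (?B x) + ennreal (U (x - y) powr q) \<partial>lborel)"
    proof (intro nn_integral_mono)
      fix x
      have "?B x * U (x - y) \<le> ?B x + U (x - y) powr q"
        using le_one_plus_powr[of "U (x - y)" q] q by (auto simp: U_def indicator_def)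
      then show "ennreal (?B x * U (x - y)) \<le> ennreal (?B x) + ennreal (U (x - y) powr q)"
        by (simp add: ennreal_plus[symmetric] ennreal_leI del: ennreal_plus)
    qed
    also have "\<dots> = (\<integral>\<^sup>+x. ennreal (?B x) \<partial>lborel) + (\<integral>\<^sup>+x. ennreal (U (x - y) powr q) \<partial>lborel)"
      by (rule nn_integral_add) measurable
    also have "(\<integral>\<^sup>+x. ennreal (U (x - y) powr q) \<partial>lborel) = (\<integral>\<^sup>+x. ennreal (U x powr q) \<partial>distr lborel borel ((+) (- y)))"
      by (subst nn_integral_distr) auto
    also have "\<dots> = (\<integral>\<^sup>+x. ennreal (U x powr q) \<partial>lborel)" by (simp add: lborel_distr_plus)
    finally have "(\<integral>\<^sup>+x. ennreal (?B x * U (x - y)) \<partial>lborel) \<le> ennreal (8 * v * R ^ 3) + ennreal (N * R ^ 3)"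
      using U volB by (metis (no_types, lifting) add_left_mono order_trans)
    then show ?thesis using v0 N R by (simp add: ennreal_plus[symmetric] algebra_simps del: ennreal_plus)
  qed
  \<comment> \<open>Fubini puts the integral over \<open>x\<close> inside, where the bound for
    shifted fields is independent of both \<open>r\<close> and \<open>z\<close>.\<close>
  have V: "(\<integral>\<^sup>+x. ennreal (?B x * (R powr b * \<bar>F r x\<bar>)) \<partial>lborel) \<le> ennreal (M * (v * (8 * v + N)) * R ^ 3)" if r: "0 < r" for r
  proof -
    have "(\<integral>\<^sup>+x. ennreal (?B x * (R powr b * \<bar>F r x\<bar>)) \<partial>lborel)
        \<le> (\<integral>\<^sup>+x. ennreal M * (\<integral>\<^sup>+z. ennreal (indicator (cball 0 1) z * (?B x * U (x - r *\<^sub>R z))) \<partial>lborel) \<partial>lborel)"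
    proof (intro nn_integral_mono)
      fix x
      have "ennreal (?B x * (R powr b * \<bar>F r x\<bar>)) = ennreal (?B x * R powr b) * ennreal \<bar>F r x\<bar>"
        by (simp add: ennreal_mult'[symmetric] mult.assoc)
      also have "\<dots> \<le> ennreal (?B x * R powr b) * (ennreal M * (\<integral>\<^sup>+z. ennreal (indicator (cball 0 1) z * norm (u (x - r *\<^sub>R z))) \<partial>lborel))"
        by (intro mult_left_mono F2 r) simp
      also have "\<dots> = ennreal M * (ennreal (?B x * R powr b) * (\<integral>\<^sup>+z. ennreal (indicator (cball 0 1) z * norm (u (x - r *\<^sub>R z))) \<partial>lborel))"
        by (simp add: mult_ac)
      also have "ennreal (?B x * R powr b) * (\<integral>\<^sup>+z. ennreal (indicator (cball 0 1) z * norm (u (x - r *\<^sub>R z))) \<partial>lborel)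
          = (\<integral>\<^sup>+z. ennreal (?B x * R powr b) * ennreal (indicator (cball 0 1) z * norm (u (x - r *\<^sub>R z))) \<partial>lborel)"
        by (rule nn_integral_cmult[symmetric]) measurable
      also have "\<dots> = (\<integral>\<^sup>+z. ennreal (indicator (cball 0 1) z * (?B x * U (x - r *\<^sub>R z))) \<partial>lborel)"
        by (intro nn_integral_cong) (simp add: ennreal_mult'[symmetric] U_def mult_ac)
      finally show "ennreal (?B x * (R powr b * \<bar>F r x\<bar>)) \<le> ennreal M * (\<integral>\<^sup>+z. ennreal (indicator (cball 0 1) z * (?B x * U (x - r *\<^sub>R z))) \<partial>lborel)" .
    qed
    also have "\<dots> = ennreal M * (\<integral>\<^sup>+x. (\<integral>\<^sup>+z. ennreal (indicator (cball 0 1) z * (?B x * U (x - r *\<^sub>R z))) \<partial>lborel) \<partial>lborel)"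
      by (rule nn_integral_cmult) measurable
    also have "(\<integral>\<^sup>+x. (\<integral>\<^sup>+z. ennreal (indicator (cball 0 1) z * (?B x * U (x - r *\<^sub>R z))) \<partial>lborel) \<partial>lborel)
        = (\<integral>\<^sup>+z. (\<integral>\<^sup>+x. ennreal (indicator (cball 0 1) z * (?B x * U (x - r *\<^sub>R z))) \<partial>lborel) \<partial>lborel)"
      by (rule lborel_pair.Fubini') measurable
    also have "\<dots> = (\<integral>\<^sup>+z. ennreal (indicator (cball 0 1) z) * (\<integral>\<^sup>+x. ennreal (?B x * U (x - r *\<^sub>R z)) \<partial>lborel) \<partial>lborel)"
      by (intro nn_integral_cong, subst nn_integral_cmult[symmetric]) (auto simp: ennreal_mult'[symmetric])
    also have "\<dots> \<le> (\<integral>\<^sup>+z. ennreal (indicator (cball (0 :: real ^ 3) 1) z) * ennreal ((8 * v + N) * R ^ 3) \<partial>lborel)"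
      by (intro nn_integral_mono mult_left_mono shiftU) simp
    also have "\<dots> = ennreal v * ennreal ((8 * v + N) * R ^ 3)"
      by (subst nn_integral_multc) (auto simp: vol1)
    finally have "(\<integral>\<^sup>+x. ennreal (?B x * (R powr b * \<bar>F r x\<bar>)) \<partial>lborel) \<le> ennreal M * (ennreal v * ennreal ((8 * v + N) * R ^ 3))"
      by (simp add: mult_left_mono)
    then show ?thesis using M v0 N R by (simp add: ennreal_mult'[symmetric] mult_ac)
  qed
  \<comment> \<open>Young's inequality is applied to \<open>R powr b * \<bar>F r x\<bar>\<close>,
    whose integral is O(R^3) like the other terms; undoing the scaling gains
    \<open>R powr - (a * b)\<close>.\<close>
  have step3: "(\<integral>\<^sup>+x. ennreal (?B x * ((g x)\<^sup>2 * \<bar>F r x\<bar> powr a)) \<partial>lborel) \<le> ennreal (R powr - (a * b) * K2 * R ^ 3)" if "0 \<le> r" for r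
  proof (cases "0 < r")
    case False
    with that have "r = 0" by simp
    then show ?thesis by (simp add: F(2))
  next
    case True
    have "(\<integral>\<^sup>+x. ennreal (?B x * ((g x)\<^sup>2 * \<bar>F r x\<bar> powr a)) \<partial>lborel)
        \<le> (\<integral>\<^sup>+x. ennreal (R powr - (a * b)) * (ennreal (?B x) + ennreal (?B x * g x powr q) + ennreal (?B x * (R powr b * \<bar>F r x\<bar>))) \<partial>lborel)"
    proof (intro nn_integral_mono)
      fix x
      have "(g x)\<^sup>2 * (R powr b * \<bar>F r x\<bar>) powr a \<le> 1 + g x powr q + R powr b * \<bar>F r x\<bar>"
        using g(2) a q by (intro square_mult_powr_le) auto
      then have "R powr - (a * b) * ((g x)\<^sup>2 * (R powr b * \<bar>F r x\<bar>) powr a) \<le> R powr - (a * b) * (1 + g x powr q + R powr b * \<bar>F r x\<bar>)"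
        by (rule mult_left_mono) simp
      moreover have "R powr - (a * b) * ((g x)\<^sup>2 * (R powr b * \<bar>F r x\<bar>) powr a) = (R powr - (a * b) * R powr (b * a)) * ((g x)\<^sup>2 * \<bar>F r x\<bar> powr a)"
        by (simp add: powr_mult powr_powr)
      moreover have "R powr - (a * b) * R powr (b * a) = 1"
        using R by (simp add: powr_add[symmetric] mult.commute)
      ultimately have "(g x)\<^sup>2 * \<bar>F r x\<bar> powr a \<le> R powr - (a * b) * (1 + g x powr q + R powr b * \<bar>F r x\<bar>)" by simp
      then have "?B x * ((g x)\<^sup>2 * \<bar>F r x\<bar> powr a) \<le> R powr - (a * b) * (?B x + ?B x * g x powr q + ?B x * (R powr b * \<bar>F r x\<bar>))"
        by (auto simp: indicator_def)
      then have "ennreal (?B x * ((g x)\<^sup>2 * \<bar>F r x\<bar> powr a)) \<le> ennreal (R powr - (a * b) * (?B x + ?B x * g x powr q + ?B x * (R powr b * \<bar>F r x\<bar>)))"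
        by (rule ennreal_leI)
      then show "ennreal (?B x * ((g x)\<^sup>2 * \<bar>F r x\<bar> powr a))
          \<le> ennreal (R powr - (a * b)) * (ennreal (?B x) + ennreal (?B x * g x powr q) + ennreal (?B x * (R powr b * \<bar>F r x\<bar>)))"
        by (simp add: ennreal_mult' ennreal_plus)
    qed
    also have "\<dots> = ennreal (R powr - (a * b)) * ((\<integral>\<^sup>+x. ennreal (?B x) \<partial>lborel) + (\<integral>\<^sup>+x. ennreal (?B x * g x powr q) \<partial>lborel)
        + (\<integral>\<^sup>+x. ennreal (?B x * (R powr b * \<bar>F r x\<bar>)) \<partial>lborel))"
      by (subst nn_integral_cmult, measurable, (subst nn_integral_add, measurable)+)
    also have "\<dots> \<le> ennreal (R powr - (a * b)) * (ennreal (8 * v * R ^ 3) + ennreal (L * R ^ 3) + ennreal (M * (v * (8 * v + N)) * R ^ 3))"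
      unfolding volB by (intro mult_left_mono add_mono L V True order_refl) simp
    also have "\<dots> = ennreal (R powr - (a * b) * (8 * v * R ^ 3 + L * R ^ 3 + M * (v * (8 * v + N)) * R ^ 3))"
      using v0 L M N R by (simp add: ennreal_mult' ennreal_plus)
    also have "R powr - (a * b) * (8 * v * R ^ 3 + L * R ^ 3 + M * (v * (8 * v + N)) * R ^ 3) = R powr - (a * b) * K2 * R ^ 3"
      by (simp add: K2_def algebra_simps)
    finally show ?thesis .
  qed
  have "(\<integral>\<^sup>+x. ennreal (?B x * ((g x)\<^sup>2 * (e x)\<^sup>2)) \<partial>lborel)
      \<le> (\<integral>\<^sup>+x. ennreal (R powr s / s * K0\<^sup>2) * (\<integral>\<^sup>+r. ennreal (?I r * r powr (s - 1) * (?B x * ((g x)\<^sup>2 * \<bar>F r x\<bar> powr a))) \<partial>lborel) \<partial>lborel)"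
  proof (intro nn_integral_mono)
    fix x
    have "ennreal (?B x * ((g x)\<^sup>2 * (e x)\<^sup>2)) = ennreal (?B x * (g x)\<^sup>2) * ennreal ((e x)\<^sup>2)"
      by (simp add: ennreal_mult'[symmetric] mult.assoc)
    also have "\<dots> \<le> ennreal (?B x * (g x)\<^sup>2) * (ennreal (R powr s / s * K0\<^sup>2) * (\<integral>\<^sup>+r. ennreal (?I r * (r powr (s - 1) * \<bar>F r x\<bar> powr a)) \<partial>lborel))"
      by (intro mult_left_mono step1) simp
    also have "\<dots> = ennreal (R powr s / s * K0\<^sup>2) * (ennreal (?B x * (g x)\<^sup>2) * (\<integral>\<^sup>+r. ennreal (?I r * (r powr (s - 1) * \<bar>F r x\<bar> powr a)) \<partial>lborel))"
      by (simp add: mult_ac)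
    also have "ennreal (?B x * (g x)\<^sup>2) * (\<integral>\<^sup>+r. ennreal (?I r * (r powr (s - 1) * \<bar>F r x\<bar> powr a)) \<partial>lborel)
        = (\<integral>\<^sup>+r. ennreal (?B x * (g x)\<^sup>2) * ennreal (?I r * (r powr (s - 1) * \<bar>F r x\<bar> powr a)) \<partial>lborel)"
      by (rule nn_integral_cmult[symmetric]) measurable
    also have "\<dots> = (\<integral>\<^sup>+r. ennreal (?I r * r powr (s - 1) * (?B x * ((g x)\<^sup>2 * \<bar>F r x\<bar> powr a))) \<partial>lborel)"
      by (intro nn_integral_cong) (simp add: ennreal_mult'[symmetric] mult_ac)
    finally show "ennreal (?B x * ((g x)\<^sup>2 * (e x)\<^sup>2))
      \<le> ennreal (R powr s / s * K0\<^sup>2) * (\<integral>\<^sup>+r. ennreal (?I r * r powr (s - 1) * (?B x * ((g x)\<^sup>2 * \<bar>F r x\<bar> powr a))) \<partial>lborel)" .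
  qed
  also have "\<dots> = ennreal (R powr s / s * K0\<^sup>2) * (\<integral>\<^sup>+x. (\<integral>\<^sup>+r. ennreal (?I r * r powr (s - 1) * (?B x * ((g x)\<^sup>2 * \<bar>F r x\<bar> powr a))) \<partial>lborel) \<partial>lborel)"
    by (rule nn_integral_cmult) measurable
  also have "(\<integral>\<^sup>+x. (\<integral>\<^sup>+r. ennreal (?I r * r powr (s - 1) * (?B x * ((g x)\<^sup>2 * \<bar>F r x\<bar> powr a))) \<partial>lborel) \<partial>lborel)
      = (\<integral>\<^sup>+r. (\<integral>\<^sup>+x. ennreal (?I r * r powr (s - 1) * (?B x * ((g x)\<^sup>2 * \<bar>F r x\<bar> powr a))) \<partial>lborel) \<partial>lborel)"
    by (rule lborel_pair.Fubini') measurable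
  also have "\<dots> = (\<integral>\<^sup>+r. ennreal (?I r * r powr (s - 1)) * (\<integral>\<^sup>+x. ennreal (?B x * ((g x)\<^sup>2 * \<bar>F r x\<bar> powr a)) \<partial>lborel) \<partial>lborel)"
    by (intro nn_integral_cong, subst nn_integral_cmult[symmetric]) (auto simp: ennreal_mult'[symmetric])
  also have "\<dots> \<le> (\<integral>\<^sup>+r. ennreal (?I r * r powr (s - 1)) * ennreal (R powr - (a * b) * K2 * R ^ 3) \<partial>lborel)"
  proof (intro nn_integral_mono)
    fix r
    show "ennreal (?I r * r powr (s - 1)) * (\<integral>\<^sup>+x. ennreal (?B x * ((g x)\<^sup>2 * \<bar>F r x\<bar> powr a)) \<partial>lborel)
        \<le> ennreal (?I r * r powr (s - 1)) * ennreal (R powr - (a * b) * K2 * R ^ 3)"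
      using step3[of r] by (cases "0 \<le> r") (auto intro!: mult_left_mono)
  qed
  also have "\<dots> = ennreal (R powr s / s) * ennreal (R powr - (a * b) * K2 * R ^ 3)"
    by (subst nn_integral_multc) (auto simp: I1)
  finally have "(\<integral>\<^sup>+x. ennreal (?B x * ((g x)\<^sup>2 * (e x)\<^sup>2)) \<partial>lborel)
      \<le> ennreal (R powr s / s * K0\<^sup>2) * (ennreal (R powr s / s) * ennreal (R powr - (a * b) * K2 * R ^ 3))"
    by (simp add: mult_left_mono)
  also have "\<dots> = ennreal (K0\<^sup>2 / s\<^sup>2 * K2 * (R powr s * R powr s * R powr - (a * b) * R powr 3))"
  proof -
    have nn: "0 \<le> R powr s / s * K0\<^sup>2" "0 \<le> R powr s / s" using s by auto
    have "R powr s / s * K0\<^sup>2 * (R powr s / s * (R powr - (a * b) * K2 * R ^ 3))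
        = K0\<^sup>2 / s\<^sup>2 * K2 * (R powr s * R powr s * R powr - (a * b) * R powr 3)"
      using R by (simp add: power2_eq_square powr_numeral)
    then show ?thesis by (simp only: ennreal_mult'[symmetric] nn)
  qed
  also have "\<dots> \<le> ennreal ((C + 1)\<^sup>2 * 4 / a\<^sup>2 * K2 * R powr (3 + a / 2))"
  proof (rule ennreal_leI)
    have "R powr s * R powr s * R powr - (a * b) * R powr 3 = R powr (a - a * b + 3)"
      by (simp add: powr_add[symmetric] s(2))
    also have "\<dots> \<le> R powr (3 + a / 2)"
    proof (rule powr_mono)
      \<comment> \<open>The upper bound on \<open>q\<close> enters here: the total exponent 3 + a -
        ab is at most 3 + a/2.\<close>
      have "1 / 2 \<le> b" using q by (simp add: b_def field_simps)
      then have "a * (1 / 2) \<le> a * b" using a by (intro mult_left_mono) auto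
      then show "a - a * b + 3 \<le> 3 + a / 2" by simp
    qed (use R in auto)
    finally have "R powr s * R powr s * R powr - (a * b) * R powr 3 \<le> R powr (3 + a / 2)" .
    then have "K0\<^sup>2 / s\<^sup>2 * K2 * (R powr s * R powr s * R powr - (a * b) * R powr 3) \<le> K0\<^sup>2 / s\<^sup>2 * K2 * R powr (3 + a / 2)"
      using K2 by (intro mult_left_mono) auto
    moreover have "K0\<^sup>2 / s\<^sup>2 = (C + 1)\<^sup>2 * 4 / a\<^sup>2" by (simp add: K0_def s_def power_divide)
    ultimately show "K0\<^sup>2 / s\<^sup>2 * K2 * (R powr s * R powr s * R powr - (a * b) * R powr 3) \<le> (C + 1)\<^sup>2 * 4 / a\<^sup>2 * K2 * R powr (3 + a / 2)" by simp
  qed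
  finally show ?thesis by (simp add: K2_def)
qed

section \<open>Skew-symmetric potentials at a given scale\<close>

definition ball_int :: "real \<Rightarrow> ('a::euclidean_space \<Rightarrow> real) \<Rightarrow> real" where
  "ball_int \<rho> f = (LINT x:cball 0 \<rho>|lborel. f x)"

lemma ball_int_integrable:
  fixes f :: "'a::euclidean_space \<Rightarrow> real"
  assumes "continuous_on UNIV f"
  shows "set_integrable lborel (cball 0 \<rho>) f"
  unfolding set_integrable_def by (intro borel_integrable_compact continuous_on_subset[OF assms]) auto

lemma
  fixes f g :: "'a::euclidean_space \<Rightarrow> real"
  assumes "continuous_on UNIV f" "continuous_on UNIV g"
  shows ball_int_add: "ball_int \<rho> (\<lambda>x. f x + g x) = ball_int \<rho> f + ball_int \<rho> g"
    and ball_int_mono: "(\<And>x. norm x \<le> \<rho> \<Longrightarrow> f x \<le> g x) \<Longrightarrow> ball_int \<rho> f \<le> ball_int \<rho> g"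
  unfolding ball_int_def
  by (rule set_integral_add ball_int_integrable assms)+
     (rule set_integral_mono[OF ball_int_integrable[OF assms(1)] ball_int_integrable[OF assms(2)]]; simp)

lemma ball_int_cmult: "ball_int \<rho> (\<lambda>x. c * f x) = c * ball_int \<rho> f"
  by (simp add: ball_int_def)

lemma ball_int_sum:
  fixes f :: "'i \<Rightarrow> 'a::euclidean_space \<Rightarrow> real"
  assumes "finite I" "\<And>i. i \<in> I \<Longrightarrow> continuous_on UNIV (f i)"
  shows "ball_int \<rho> (\<lambda>x. \<Sum>i\<in>I. f i x) = (\<Sum>i\<in>I. ball_int \<rho> (f i))"
  using assms
proof (induction I rule: finite_induct)
  case empty
  then show ?case by (simp add: ball_int_def)
next
  case (insert i I)
  then have "ball_int \<rho> (\<lambda>x. f i x + (\<Sum>i\<in>I. f i x)) = ball_int \<rho> (f i) + ball_int \<rho> (\<lambda>x. \<Sum>i\<in>I. f i x)"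
    by (intro ball_int_add continuous_on_sum) auto
  with insert show ?case by simp
qed

lemma ball_int_subset:
  fixes f :: "'a::euclidean_space \<Rightarrow> real"
  assumes "continuous_on UNIV f" "\<And>x. 0 \<le> f x" "\<rho> \<le> \<rho>'"
  shows "ball_int \<rho> f \<le> ball_int \<rho>' f"
  unfolding ball_int_def set_lebesgue_integral_def
proof (rule integral_mono)
  show "integrable lborel (\<lambda>x. indicat_real (cball 0 \<rho>) x *\<^sub>R f x)" "integrable lborel (\<lambda>x. indicat_real (cball 0 \<rho>') x *\<^sub>R f x)"
    using ball_int_integrable[OF assms(1)] by (auto simp: set_integrable_def)
  show "indicat_real (cball 0 \<rho>) x *\<^sub>R f x \<le> indicat_real (cball 0 \<rho>') x *\<^sub>R f x" for x
    using assms(2)[of x] assms(3) by (auto simp: indicator_def)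
qed

lemma ball_int_le_integral:
  fixes f :: "'a::euclidean_space \<Rightarrow> real"
  assumes "continuous_on UNIV f" "\<And>x. 0 \<le> f x" "\<And>x. \<rho>' < norm x \<Longrightarrow> f x = 0"
  shows "ball_int \<rho> f \<le> (\<integral>x. f x \<partial>lborel)"
  unfolding ball_int_def set_lebesgue_integral_def
proof (rule integral_mono)
  show "integrable lborel (\<lambda>x. indicat_real (cball 0 \<rho>) x *\<^sub>R f x)"
    using ball_int_integrable[OF assms(1)] by (auto simp: set_integrable_def)
  show "integrable lborel f" by (rule integrable_continuous_support[OF assms(1,3)])
  show "indicat_real (cball 0 \<rho>) x *\<^sub>R f x \<le> f x" for x
    using assms(2)[of x] by (auto simp: indicator_def)
qed

lemma ball_int_le_nn_integral:
  fixes f :: "'a::euclidean_space \<Rightarrow> real"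
  assumes "continuous_on UNIV f" "\<And>x. 0 \<le> f x" "0 \<le> c"
    and le: "(\<integral>\<^sup>+x. ennreal (indicator (cball 0 \<rho>) x * f x) \<partial>lborel) \<le> ennreal c"
  shows "ball_int \<rho> f \<le> c"
proof -
  have "ball_int \<rho> f = enn2real (\<integral>\<^sup>+x. ennreal (indicator (cball 0 \<rho>) x * f x) \<partial>lborel)"
    unfolding ball_int_def set_lebesgue_integral_def
    using ball_int_integrable[OF assms(1), of \<rho>] assms(2)
    by (subst integral_eq_nn_integral) (auto simp: set_integrable_def)
  also have "\<dots> \<le> c" using le assms(3) by (rule enn2real_leI[rotated])
  finally show ?thesis .
qed

lemma ball_int_const:
  "0 \<le> \<rho> \<Longrightarrow> ball_int \<rho> (\<lambda>x :: real ^ 3. c) = c * (\<rho> ^ 3 * measure lborel (cball (0 :: real ^ 3) 1))"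
proof -
  assume "0 \<le> \<rho>"
  then have "measure lborel (cball (0 :: real ^ 3) \<rho>) = \<rho> ^ 3 * measure lborel (cball (0 :: real ^ 3) 1)"
    using emeasure_cball_scale[of \<rho> 0] by (simp add: measure_def)
  then show ?thesis
    using emeasure_compact_finite[OF compact_cball, of "0 :: real ^ 3" \<rho>]
    by (simp add: ball_int_def set_lebesgue_integral_def mult.commute)
qed

lemma ball_int_square_le:
  fixes g :: "real ^ 3 \<Rightarrow> real"
  assumes g: "continuous_on UNIV g" "\<And>x. 0 \<le> g x" and L: "0 \<le> L"
      "(\<integral>\<^sup>+x. ennreal (indicator (cball 0 (2 * R)) x * g x powr q) \<partial>lborel) \<le> ennreal (L * R ^ 3)"
    and q: "2 < q" and R: "0 \<le> R"
  shows "ball_int (2 * R) (\<lambda>x. (g x)\<^sup>2) \<le> (8 * measure lborel (cball (0 :: real ^ 3) 1) + L) * R ^ 3"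
proof -
  have c: "continuous_on UNIV (\<lambda>x. g x powr q)"
    using q g by (intro continuous_on_powr' continuous_intros) auto
  have "ball_int (2 * R) (\<lambda>x. (g x)\<^sup>2) \<le> ball_int (2 * R) (\<lambda>x. 1 + g x powr q)"
  proof (rule ball_int_mono)
    fix x
    show "(g x)\<^sup>2 \<le> 1 + g x powr q"
    proof (cases "g x \<le> 1")
      case True
      then have "(g x)\<^sup>2 \<le> 1" using g(2) by (simp add: power_le_one)
      then show ?thesis using powr_ge_zero[of "g x" q] by linarith
    next
      case False
      then have "(g x)\<^sup>2 = g x powr 2" by simp
      also have "\<dots> \<le> g x powr q" using False q by (intro powr_mono) auto
      finally show ?thesis by simp
    qed
  qed (intro continuous_intros g c)+
  also have "\<dots> = ball_int (2 * R) (\<lambda>x :: real ^ 3. 1) + ball_int (2 * R) (\<lambda>x. g x powr q)"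
    by (rule ball_int_add) (intro continuous_intros c)+
  also have "ball_int (2 * R) (\<lambda>x. g x powr q) \<le> L * R ^ 3"
    by (rule ball_int_le_nn_integral[OF c _ _ L(2)]) (use L R in auto)
  finally show ?thesis using R by (simp add: ball_int_const algebra_simps power_mult_distrib)
qed

text \<open>The normalisation puts field components on the same footing as the constant weight 1:
  both satisfy the hypothesis on \<open>g\<close> in \<open>weighted_square_estimate\<close> with a
  constant independent of \<open>R\<close>.\<close>

lemma nn_integral_scaled_component:
  fixes u :: "real ^ 3 \<Rightarrow> real ^ 3"
  assumes u: "(\<integral>\<^sup>+x. ennreal (norm (u x) powr q) \<partial>lborel) \<le> ennreal N" "0 \<le> N" "continuous_on UNIV u"
    and q: "2 < q" and R: "1 \<le> R"
  shows "(\<integral>\<^sup>+x. ennreal (indicator (cball 0 (2 * R)) x * (R powr (3 / q) * \<bar>u x $ i\<bar>) powr q) \<partial>lborel) \<le> ennreal (N * R ^ 3)"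
proof -
  have [measurable]: "u \<in> borel_measurable borel" using u(3) by (rule borel_measurable_continuous_onI)
  have "(\<integral>\<^sup>+x. ennreal (indicator (cball 0 (2 * R)) x * (R powr (3 / q) * \<bar>u x $ i\<bar>) powr q) \<partial>lborel)
      \<le> (\<integral>\<^sup>+x. ennreal (R ^ 3) * ennreal (norm (u x) powr q) \<partial>lborel)"
  proof (intro nn_integral_mono)
    fix x
    have "(R powr (3 / q) * \<bar>u x $ i\<bar>) powr q = R ^ 3 * \<bar>u x $ i\<bar> powr q"
      using R q by (simp add: powr_mult powr_powr powr_numeral)
    also have "\<dots> \<le> R ^ 3 * norm (u x) powr q"
      using R q component_le_norm_cart[of "u x" i] by (intro mult_left_mono powr_mono2) auto
    finally have "indicator (cball 0 (2 * R)) x * (R powr (3 / q) * \<bar>u x $ i\<bar>) powr q \<le> R ^ 3 * norm (u x) powr q"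
      using R by (auto simp: indicator_def)
    then show "ennreal (indicator (cball 0 (2 * R)) x * (R powr (3 / q) * \<bar>u x $ i\<bar>) powr q) \<le> ennreal (R ^ 3) * ennreal (norm (u x) powr q)"
      using R by (simp add: ennreal_mult'[symmetric] ennreal_leI)
  qed
  also have "\<dots> = ennreal (R ^ 3) * (\<integral>\<^sup>+x. ennreal (norm (u x) powr q) \<partial>lborel)"
    by (rule nn_integral_cmult) measurable
  also have "\<dots> \<le> ennreal (R ^ 3) * ennreal N" by (intro mult_left_mono u(1)) simp
  finally show ?thesis using R u(2) by (simp add: ennreal_mult'[symmetric] mult.commute)
qed

text \<open>Gives the power of \<open>R\<close> predicted by Hoelder's inequality: the crude bound
  of a square by 1 plus a q-th power loses no power because it is applied to the normalised
  component.\<close>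

lemma ball_int_component_square:
  fixes u :: "real ^ 3 \<Rightarrow> real ^ 3"
  assumes u: "(\<integral>\<^sup>+x. ennreal (norm (u x) powr q) \<partial>lborel) \<le> ennreal N" "0 \<le> N" "continuous_on UNIV u"
    and q: "2 < q" and R: "1 \<le> R"
  shows "ball_int (2 * R) (\<lambda>x. (u x $ i)\<^sup>2) \<le> (8 * measure lborel (cball (0 :: real ^ 3) 1) + N) * R powr (3 - 6 / q)"
proof -
  let ?b = "3 / q"
  have "ball_int (2 * R) (\<lambda>x. (R powr ?b * \<bar>u x $ i\<bar>)\<^sup>2) \<le> (8 * measure lborel (cball (0 :: real ^ 3) 1) + N) * R ^ 3"
    using u q R nn_integral_scaled_component[OF u q R, of i]
    by (intro ball_int_square_le[where q=q] continuous_intros) auto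
  moreover have "ball_int (2 * R) (\<lambda>x. (R powr ?b * \<bar>u x $ i\<bar>)\<^sup>2) = R powr (6 / q) * ball_int (2 * R) (\<lambda>x. (u x $ i)\<^sup>2)"
  proof -
    have "(R powr ?b)\<^sup>2 = R powr (6 / q)" by (simp add: power2_eq_square powr_add[symmetric])
    then show ?thesis by (simp add: power_mult_distrib ball_int_cmult)
  qed
  ultimately have "R powr - (6 / q) * (R powr (6 / q) * ball_int (2 * R) (\<lambda>x. (u x $ i)\<^sup>2))
      \<le> R powr - (6 / q) * ((8 * measure lborel (cball (0 :: real ^ 3) 1) + N) * R ^ 3)"
    by (intro mult_left_mono) auto
  moreover have "R powr - (6 / q) * R powr (6 / q) = 1" using R by (simp add: powr_add[symmetric])
  moreover have "R powr - (6 / q) * R ^ 3 = R powr (3 - 6 / q)"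
    using R by (simp add: powr_numeral[symmetric] powr_add[symmetric] del: powr_numeral)
  moreover have "R powr - (6 / q) * ((8 * measure lborel (cball (0 :: real ^ 3) 1) + N) * R ^ 3)
      = (8 * measure lborel (cball (0 :: real ^ 3) 1) + N) * (R powr - (6 / q) * R ^ 3)"
    by (simp add: mult_ac)
  ultimately show ?thesis by (simp only: mult.assoc[symmetric] mult_1)
qed

lemma sum_square_le: "(a + b)\<^sup>2 \<le> 2 * a\<^sup>2 + 2 * b\<^sup>2" for a b :: real
  using sum_squares_bound[of a b] by (simp add: power2_eq_square algebra_simps)

section \<open>Pointwise bounds for averages, and rescaled cutoffs\<close>

text \<open>Supplies the bound through which the L^q norm enters
  \<open>weighted_square_estimate\<close>; the BMO^-1 bound comes from
  \<open>BMO_inv_avg_bound\<close>.\<close>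

lemma avg_le_nn_integral:
  fixes u :: "real ^ 3 \<Rightarrow> real ^ 3"
  assumes K: "continuous_on UNIV K" "\<And>z. 1 \<le> norm z \<Longrightarrow> K z = 0" "\<And>z. \<bar>K z\<bar> \<le> B" and u: "continuous_on UNIV u"
  shows "ennreal \<bar>avg K (\<lambda>x. u x $ i) r x\<bar> \<le> ennreal B * (\<integral>\<^sup>+z. ennreal (indicator (cball 0 1) z * norm (u (x - r *\<^sub>R z))) \<partial>lborel)"
proof -
  have ui: "continuous_on UNIV (\<lambda>x. u x $ i)" using u by (intro continuous_intros)
  have cu: "continuous_on UNIV (\<lambda>z. u (x - r *\<^sub>R z))"
    by (intro continuous_on_compose2[OF u] continuous_intros) auto
  have c: "continuous_on UNIV (\<lambda>z. K z * u (x - r *\<^sub>R z) $ i)"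
    by (intro continuous_intros K(1) cu)
  have int: "integrable lborel (\<lambda>z. K z * u (x - r *\<^sub>R z) $ i)"
    by (rule integrable_continuous_support[OF c, of 1]) (simp add: K(2))
  have [measurable]: "(\<lambda>z. norm (u (x - r *\<^sub>R z))) \<in> borel_measurable borel"
    by (intro borel_measurable_continuous_onI continuous_intros cu)
  have [measurable]: "cball (0 :: real ^ 3) 1 \<in> sets borel" by simp
  have "ennreal \<bar>avg K (\<lambda>x. u x $ i) r x\<bar> = ennreal (norm (\<integral>z. K z * u (x - r *\<^sub>R z) $ i \<partial>lborel))"
    by (simp add: avg_eq_lborel[OF K(1,2) ui])
  also have "\<dots> \<le> (\<integral>\<^sup>+z. ennreal (norm (K z * u (x - r *\<^sub>R z) $ i)) \<partial>lborel)"
    by (rule integral_norm_bound_ennreal[OF int])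
  also have "\<dots> \<le> (\<integral>\<^sup>+z. ennreal B * ennreal (indicator (cball 0 1) z * norm (u (x - r *\<^sub>R z))) \<partial>lborel)"
  proof (intro nn_integral_mono)
    fix z
    have B: "0 \<le> B" using K(3)[of 0] by linarith
    have "\<bar>K z\<bar> * \<bar>u (x - r *\<^sub>R z) $ i\<bar> \<le> B * norm (u (x - r *\<^sub>R z))"
      using B by (intro mult_mono K(3) component_le_norm_cart) auto
    then have "norm (K z * u (x - r *\<^sub>R z) $ i) \<le> B * (indicator (cball 0 1) z * norm (u (x - r *\<^sub>R z)))"
      using K(2)[of z] by (cases "norm z \<le> 1") (auto simp: abs_mult indicator_def)
    then show "ennreal (norm (K z * u (x - r *\<^sub>R z) $ i)) \<le> ennreal B * ennreal (indicator (cball 0 1) z * norm (u (x - r *\<^sub>R z)))"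
      using B by (simp only: ennreal_mult'[symmetric] ennreal_leI)
  qed
  also have "\<dots> = ennreal B * (\<integral>\<^sup>+z. ennreal (indicator (cball 0 1) z * norm (u (x - r *\<^sub>R z))) \<partial>lborel)"
    by (rule nn_integral_cmult) measurable
  finally show ?thesis .
qed

lemma bump_bounds:
  obtains A where "0 < A" "\<And>z :: real ^ 'n::finite. \<bar>bump z\<bar> \<le> A" "\<And>k (z :: real ^ 'n). \<bar>pd k bump z\<bar> \<le> A"
    "\<And>j k (z :: real ^ 'n). \<bar>pd k (pd j bump) z\<bar> \<le> A"
proof -
  have s0: "bump z = 0" if "1 < norm z" for z :: "real ^ 'n" using that bump_outside[of z] by simp
  have s1: "pd k bump z = 0" if "1 < norm z" for k and z :: "real ^ 'n" by (rule pd_zero_outside[OF s0 that])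
  have s2: "pd k (pd j bump) z = 0" if "1 < norm z" for k j and z :: "real ^ 'n" by (rule pd_zero_outside[OF s1 that])
  obtain A0 where A0: "0 \<le> A0" "\<And>z :: real ^ 'n. \<bar>bump z\<bar> \<le> A0"
    by (rule continuous_support_bounded[of "bump :: real ^ 'n \<Rightarrow> real" 1]) (simp_all add: bump_continuous s0)
  have "\<exists>B\<ge>0. \<forall>z :: real ^ 'n. \<bar>pd k bump z\<bar> \<le> B" for k
    using continuous_support_bounded[of "pd k (bump :: real ^ 'n \<Rightarrow> real)" 1] C1_continuous_pd[OF bump_C1] s1 by metis
  then obtain A1 where A1: "\<And>k. 0 \<le> A1 k" "\<And>k (z :: real ^ 'n). \<bar>pd k bump z\<bar> \<le> A1 k" by metis
  have "\<exists>B. 0 \<le> B \<and> (\<forall>z :: real ^ 'n. \<bar>pd (snd p) (pd (fst p) bump) z\<bar> \<le> B)" for p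
    using continuous_support_bounded[of "pd (snd p) (pd (fst p) (bump :: real ^ 'n \<Rightarrow> real))" 1]
      C1_continuous_pd[OF C2_C1_pd[OF bump_C2]] s2 by metis
  then have "\<exists>a. \<forall>p. 0 \<le> a p \<and> (\<forall>z :: real ^ 'n. \<bar>pd (snd p) (pd (fst p) bump) z\<bar> \<le> a p)"
    by (intro choice allI)
  then obtain a where a: "\<And>p. 0 \<le> a p" "\<And>p (z :: real ^ 'n). \<bar>pd (snd p) (pd (fst p) bump) z\<bar> \<le> a p" by blast
  define A2 where "A2 = (\<lambda>j k. a (j, k))"
  have A2: "0 \<le> A2 j k" "\<bar>pd k (pd j bump) z\<bar> \<le> A2 j k" for j k and z :: "real ^ 'n"
    using a(1)[of "(j, k)"] a(2)[of "(j, k)" z] by (simp_all add: A2_def)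
  define A where "A = 1 + A0 + (\<Sum>k\<in>UNIV. A1 k) + (\<Sum>j\<in>UNIV. \<Sum>k\<in>UNIV. A2 j k)"
  have n: "0 \<le> (\<Sum>k\<in>UNIV. A1 k)" "0 \<le> (\<Sum>j\<in>UNIV. \<Sum>k\<in>UNIV. A2 j k)"
    using A1 A2 by (auto intro!: sum_nonneg)
  have m: "A1 k \<le> (\<Sum>k\<in>UNIV. A1 k)" "A2 j k \<le> (\<Sum>j\<in>UNIV. \<Sum>k\<in>UNIV. A2 j k)" for j k
    using A1 A2 by (auto intro!: member_le_sum member_le_double_sum)
  show ?thesis
  proof (rule that[of A])
    show "0 < A" using n A0(1) by (simp add: A_def)
    show "\<bar>bump z\<bar> \<le> A" for z :: "real ^ 'n" using A0(2)[of z] n by (simp add: A_def)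
    show "\<bar>pd k bump z\<bar> \<le> A" for k and z :: "real ^ 'n" using A1(2)[of k z] m(1)[of k] n A0(1) by (simp add: A_def)
    show "\<bar>pd k (pd j bump) z\<bar> \<le> A" for j k and z :: "real ^ 'n" using A2(2)[where j=j and k=k and z=z] m(2)[of j k] n A0(1) by (simp add: A_def)
  qed
qed

definition cutoff :: "real \<Rightarrow> real ^ 'n::finite \<Rightarrow> real" where
  "cutoff \<rho> x = bump ((1 / \<rho>) *\<^sub>R x)"

lemma pd_cutoff: "pd j (cutoff \<rho>) = (\<lambda>x. (1 / \<rho>) * pd j bump ((1 / \<rho>) *\<^sub>R x))"
  using pd_affine[OF bump_C1, of j "1 / \<rho>" 0] by (simp add: cutoff_def[abs_def] fun_eq_iff)

lemma pd_pd_cutoff: "pd k (pd j (cutoff \<rho>)) x = (1 / \<rho>\<^sup>2) * pd k (pd j bump) ((1 / \<rho>) *\<^sub>R x)"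
proof -
  have c: "C1 (pd j (bump :: real ^ 'a \<Rightarrow> real))" by (rule C2_C1_pd) simp
  have d: "C1 (\<lambda>x. pd j bump ((1 / \<rho>) *\<^sub>R x + 0))"
    by (rule smooth_C1[OF smooth_affine[OF smooth_partial_deriv[OF bump_smooth]]])
  have "pd k (pd j (cutoff \<rho>)) x = (1 / \<rho>) * pd k (\<lambda>x. pd j bump ((1 / \<rho>) *\<^sub>R x + 0)) x"
    unfolding pd_cutoff using d pd_cmult[of "\<lambda>x. pd j bump ((1 / \<rho>) *\<^sub>R x + 0)" x k "1 / \<rho>"] by simp
  also have "\<dots> = (1 / \<rho>) * ((1 / \<rho>) * pd k (pd j bump) ((1 / \<rho>) *\<^sub>R x + 0))"
    by (simp only: pd_affine[OF c])
  finally show ?thesis by (simp add: power2_eq_square)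
qed

lemma cutoff_C2: "C2 (cutoff \<rho>)"
  using smooth_C2[OF smooth_affine[OF bump_smooth, of "1 / \<rho>" 0]] by (simp add: cutoff_def[abs_def])

lemma cutoff_outside: "0 < \<rho> \<Longrightarrow> \<rho> < norm x \<Longrightarrow> cutoff \<rho> x = 0"
  unfolding cutoff_def by (rule bump_outside) (simp add: field_simps)

section \<open>The potential of one field with its two quantitative bounds\<close>

text \<open>The constant does not depend on \<open>R\<close>. The weight \<open>g\<close> is left
  general because each potential has to be multiplied by the components of both fields as well as by
  1. The conditions on \<open>a\<close> make all exponents of the gradient bound at most 2 -
  a/2.\<close>

lemma field_potential:
  fixes u :: "real ^ 3 \<Rightarrow> real ^ 3"
  assumes u: "u \<in> BMO_inv" "smooth_function u"
    and div: "\<And>x. (\<Sum>j\<in>UNIV. pd j (\<lambda>x. u x $ j) x) = 0"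
    and Lq: "(\<integral>\<^sup>+x. ennreal (norm (u x) powr q) \<partial>lborel) \<le> ennreal N" "0 \<le> N"
    and q: "2 < q" "q < 6" and a: "0 < a" "a \<le> 1" "a \<le> (q - 2) / q" "a \<le> 6 / q - 1"
  obtains K where "0 \<le> K" "\<And>R. 1 \<le> R \<Longrightarrow> \<exists>d :: 3 \<Rightarrow> 3 \<Rightarrow> real ^ 3 \<Rightarrow> real.
     (\<forall>i j. C1 (d i j)) \<and> (\<forall>i j x. d i j x = - d j i x) \<and>
     (\<forall>i x. (\<Sum>j\<in>UNIV. pd j (d i j) x) = u x $ i) \<and>
     (\<forall>i j g L. continuous_on UNIV g \<longrightarrow> (\<forall>x. 0 \<le> g x) \<longrightarrow> 0 \<le> L \<longrightarrow>
        (\<integral>\<^sup>+x. ennreal (indicator (cball 0 (2 * R)) x * g x powr q) \<partial>lborel) \<le> ennreal (L * R ^ 3) \<longrightarrow>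
        ball_int (2 * R) (\<lambda>x. (g x)\<^sup>2 * (d i j x)\<^sup>2) \<le> K * (1 + L) * R powr (3 + a / 2)) \<and>
     (\<forall>i j. ball_int R (\<lambda>x. \<Sum>k\<in>UNIV. (pd k (d i j) x)\<^sup>2) \<le> K * R powr (2 - a / 2))"
proof -
  define U where "U = (\<lambda>i x. u x $ i)"
  define v where "v = measure lborel (cball (0 :: real ^ 3) 1)"
  have v0: "0 \<le> v" by (simp add: v_def)
  have Us: "smooth_function (U i)" for i unfolding U_def using u(2) by (rule smooth_component)
  have cu: "continuous_on UNIV u"
  proof -
    have "continuous_on UNIV (\<lambda>x. \<chi> i. U i x)"
      by (intro continuous_on_vec_lambda C1_continuous smooth_C1 Us)
    then show ?thesis by (simp add: U_def)
  qed
  obtain C0 where C0: "0 \<le> C0" "\<And>R. 0 < R \<Longrightarrow> \<exists>E :: 3 \<Rightarrow> 3 \<Rightarrow> real ^ 3 \<Rightarrow> real.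
     (\<forall>i j. C1 (E i j)) \<and> (\<forall>i j x. E i j x = - E j i x) \<and>
     (\<forall>i x. (\<Sum>j\<in>UNIV. pd j (E i j) x) = avg mollifier (\<lambda>x. u x $ i) R x) \<and>
     (\<forall>i j x. norm x \<le> 2 * R \<longrightarrow> \<bar>E i j x\<bar> \<le> C0 \<and> (\<forall>k. \<bar>pd k (E i j) x\<bar> \<le> C0 / R))"
    by (rule BMO_inv_mollified_potential[OF u], rule that)
  obtain Cm where Cm: "0 \<le> Cm" "\<And>r x i. 0 < r \<Longrightarrow> \<bar>avg mollifier (\<lambda>x. u x $ i) r x\<bar> \<le> Cm / r"
    by (rule BMO_inv_avg_bound[OF u mollifier_smooth mollifier_outside], assumption, rule that)
  have pb0: "pd j (bump :: real ^ 3 \<Rightarrow> real) z = 0" if "1 \<le> norm z" for j z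
    by (rule pd_unit_support[OF bump_C1 bump_outside that])
  have "\<exists>C\<ge>0. \<forall>r x i. 0 < r \<longrightarrow> \<bar>avg (pd j bump) (\<lambda>x. u x $ i) r x\<bar> \<le> C / r" for j
    by (rule BMO_inv_avg_bound[OF u smooth_partial_deriv[OF bump_smooth] pb0, of j]) blast+
  then obtain Cb where Cb: "\<And>j. 0 \<le> Cb j" "\<And>j r x i. 0 < r \<Longrightarrow> \<bar>avg (pd j bump) (\<lambda>x. u x $ i) r x\<bar> \<le> Cb j / r" by metis
  \<comment> \<open>Each \<open>F r x\<close> is a difference of averages with two kernels, each
    bounded by the sum over \<open>r\<close>.\<close>
  define CF where "CF = 2 * (\<Sum>j\<in>UNIV. Cb j)"
  have CF0: "0 \<le> CF" unfolding CF_def using Cb(1) by (auto intro!: sum_nonneg)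
  have Cbs: "Cb j \<le> (\<Sum>j\<in>UNIV. Cb j)" for j using Cb(1) by (auto intro: member_le_sum)
  obtain A where A: "0 < A" "\<And>z :: real ^ 3. \<bar>bump z\<bar> \<le> A" "\<And>k (z :: real ^ 3). \<bar>pd k bump z\<bar> \<le> A"
    "\<And>j k (z :: real ^ 3). \<bar>pd k (pd j bump) z\<bar> \<le> A"
    by (rule bump_bounds[where 'n=3], rule that)
  obtain c where c: "0 < c" "\<And>z :: real ^ 3. norm z \<le> 1 / 2 \<Longrightarrow> c \<le> bump z"
    by (rule bump_lower_bound[where 'n=3], rule that)
  \<comment> \<open>The constant of \<open>weighted_square_estimate\<close> for
    \<open>C = CF\<close> and \<open>M = 2 * A\<close>; \<open>P\<close> makes its dependence on
    \<open>L\<close> explicit.\<close>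
  define W where "W = (\<lambda>L. (CF + 1)\<^sup>2 * 4 / a\<^sup>2 * (8 * v + L + 2 * A * (v * (8 * v + N))))"
  define P where "P = (CF + 1)\<^sup>2 * 4 / a\<^sup>2 * (1 + 8 * v + 2 * A * (v * (8 * v + N)))"
  have P0: "0 \<le> P" unfolding P_def using v0 A(1) Lq(2) by simp
  have WP: "W L \<le> P * (1 + L)" if "0 \<le> L" for L
  proof -
    have "8 * v + L + 2 * A * (v * (8 * v + N)) \<le> (1 + 8 * v + 2 * A * (v * (8 * v + N))) * (1 + L)"
      using that v0 A(1) Lq(2) by (simp add: algebra_simps)
    then have "(CF + 1)\<^sup>2 * 4 / a\<^sup>2 * (8 * v + L + 2 * A * (v * (8 * v + N)))
       \<le> (CF + 1)\<^sup>2 * 4 / a\<^sup>2 * ((1 + 8 * v + 2 * A * (v * (8 * v + N))) * (1 + L))"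
      by (rule mult_left_mono) simp
    then show ?thesis by (simp only: W_def P_def mult.assoc)
  qed
  \<comment> \<open>\<open>K1\<close> is for the weighted squares, \<open>K2\<close> for the
    gradients. In both, the terms with \<open>C0\<close> come from the mollified part
    \<open>E\<close> and the others from \<open>skew_pot\<close>.\<close>
  define K1 where "K1 = 2 * P + 2 * C0\<^sup>2 * (8 * v + 1)"
  define K2 where "K2 = 6 * C0\<^sup>2 * v + 2 * (200 * A\<^sup>2 / c\<^sup>2 * (4 * (8 * v + N) + 32 * Cm\<^sup>2 * v + P * (1 + 8 * v)))"
  have K12: "0 \<le> K1" "0 \<le> K2" using P0 v0 Lq(2) by (auto simp: K1_def K2_def)
  show ?thesis
  proof (rule that[of "K1 + K2"])
    show "0 \<le> K1 + K2" using K12 by simp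
    fix R :: real
    assume R: "1 \<le> R"
    then have R0: "0 < R" by simp
    obtain E :: "3 \<Rightarrow> 3 \<Rightarrow> real ^ 3 \<Rightarrow> real" where E: "\<And>i j. C1 (E i j)" "\<And>i j x. E i j x = - E j i x"
      "\<And>i x. (\<Sum>j\<in>UNIV. pd j (E i j) x) = avg mollifier (\<lambda>x. u x $ i) R x"
      "\<And>i j x. norm x \<le> 2 * R \<Longrightarrow> \<bar>E i j x\<bar> \<le> C0" "\<And>i j k x. norm x \<le> 2 * R \<Longrightarrow> \<bar>pd k (E i j) x\<bar> \<le> C0 / R"
      using C0(2)[OF R0] by blast
    interpret S: solenoidal U R
      by standard (use Us div R in \<open>auto simp: U_def\<close>)
    let ?e = S.skew_pot
    have e2: "C2 (?e i j)" for i j by (rule S.skew_pot_C2)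
    then have e1: "C1 (?e i j)" for i j by (rule C2_C1)
    have ce: "continuous_on UNIV (?e i j)" "continuous_on UNIV (pd k (?e i j))" for i j k
      using e1 by (auto intro: C1_continuous C1_continuous_pd)
    have cE: "continuous_on UNIV (E i j)" "continuous_on UNIV (pd k (E i j))" for i j k
      using E(1) by (auto intro: C1_continuous C1_continuous_pd)
    \<comment> \<open>\<open>E\<close> has the mollified field as its divergence and
      \<open>skew_pot\<close> the field minus its mollification, so the sum is an exact
      potential.\<close>
    define d where "d = (\<lambda>i j x. E i j x + ?e i j x)"
    have d1: "C1 (d i j)" for i j unfolding d_def by (intro C1_add E e1)
    have pdd: "pd k (d i j) x = pd k (E i j) x + pd k (?e i j) x" for i j k x
      unfolding d_def by (intro pd_add C1_differentiable E e1)
    have cd: "continuous_on UNIV (d i j)" "continuous_on UNIV (pd k (d i j))" for i j k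
      using d1 by (auto intro: C1_continuous C1_continuous_pd)
    have dskew: "d i j x = - d j i x" for i j x
      unfolding d_def using E(2)[of i j x] S.skew_pot_skew[of i j x] by simp
    have ddiv: "(\<Sum>j\<in>UNIV. pd j (d i j) x) = u x $ i" for i x
    proof -
      have "(\<Sum>j\<in>UNIV. pd j (d i j) x) = avg mollifier (\<lambda>x. u x $ i) R x + S.remainder i x"
        unfolding pdd by (simp only: sum.distrib E(3) S.div_skew_pot)
      then show ?thesis unfolding S.remainder_def by (simp add: U_def)
    qed
    have west: "ball_int (2 * R) (\<lambda>x. (g x)\<^sup>2 * (?e i j x)\<^sup>2) \<le> P * (1 + L) * R powr (3 + a / 2)"
      if g: "continuous_on UNIV g" "\<And>x. 0 \<le> g x" and L: "0 \<le> L"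
      "(\<integral>\<^sup>+x. ennreal (indicator (cball 0 (2 * R)) x * g x powr q) \<partial>lborel) \<le> ennreal (L * R ^ 3)" for g L i j
    proof -
      \<comment> \<open>By \<open>scaled_avg_vort\<close> this is a difference of averages of
        \<open>u\<close> with kernels \<open>pd j bump\<close> and \<open>pd i bump\<close>.\<close>
      define F where "F = (\<lambda>r x. r * avg bump (S.vort i j) r x)"
      have Feq: "F r x = avg (pd j bump) (\<lambda>x. u x $ i) r x - avg (pd i bump) (\<lambda>x. u x $ j) r x" for r x
        using S.scaled_avg_vort[of r i j x] by (simp add: F_def U_def)
      have cvort: "continuous_on UNIV (S.vort i j)" by (intro C1_continuous C2_C1 S.vort_C2)
      have "(\<integral>\<^sup>+x. ennreal (indicator (cball 0 (2 * R)) x * ((g x)\<^sup>2 * (?e i j x)\<^sup>2)) \<partial>lborel) \<le> ennreal (W L * R powr (3 + a / 2))"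
        unfolding W_def
      proof (rule weighted_square_estimate[where F=F and u=u and q=q])
        show "continuous_on UNIV (\<lambda>p. F (fst p) (snd p))"
          unfolding F_def by (intro continuous_intros avg_continuous bump_continuous cvort)
        show "F 0 x = 0" for x by (simp add: F_def)
        show "?e i j x = - integral {0..R} (\<lambda>r. F r x)" for x by (simp add: S.skew_pot_eq F_def)
        show "\<bar>F r x\<bar> \<le> CF / r" if r: "0 < r" for r x
        proof -
          have "\<bar>F r x\<bar> \<le> Cb j / r + Cb i / r"
            unfolding Feq using Cb(2)[OF r, of j i x] Cb(2)[OF r, of i j x] by linarith
          also have "\<dots> \<le> CF / r"
            unfolding CF_def add_divide_distrib[symmetric] using r Cbs[of i] Cbs[of j] by (intro divide_right_mono) auto
          finally show ?thesis .
        qed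
        show "ennreal \<bar>F r x\<bar> \<le> ennreal (2 * A) * (\<integral>\<^sup>+z. ennreal (indicator (cball 0 1) z * norm (u (x - r *\<^sub>R z))) \<partial>lborel)" for r x
        proof -
          let ?J = "\<integral>\<^sup>+z. ennreal (indicator (cball 0 1) z * norm (u (x - r *\<^sub>R z))) \<partial>lborel"
          have "ennreal \<bar>F r x\<bar> \<le> ennreal (\<bar>avg (pd j bump) (\<lambda>x. u x $ i) r x\<bar> + \<bar>avg (pd i bump) (\<lambda>x. u x $ j) r x\<bar>)"
            unfolding Feq by (intro ennreal_leI) linarith
          also have "\<dots> = ennreal \<bar>avg (pd j bump) (\<lambda>x. u x $ i) r x\<bar> + ennreal \<bar>avg (pd i bump) (\<lambda>x. u x $ j) r x\<bar>"
            by (rule ennreal_plus) auto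
          also have "\<dots> \<le> ennreal A * ?J + ennreal A * ?J"
            by (intro add_mono avg_le_nn_integral C1_continuous_pd[OF bump_C1] pb0 A(3) cu)
          also have "\<dots> = ennreal (2 * A) * ?J"
          proof -
            have "ennreal (2 * A) = ennreal A + ennreal A" using A(1) by (simp add: ennreal_plus[symmetric] del: ennreal_plus)
            then show ?thesis by (simp only: distrib_right)
          qed
          finally show ?thesis .
        qed
      qed (use q a R CF0 A(1) cu Lq g L in \<open>auto simp: v_def\<close>)
      also have "\<dots> \<le> ennreal (P * (1 + L) * R powr (3 + a / 2))"
        by (intro ennreal_leI mult_right_mono WP L) simp
      finally show ?thesis
        using P0 L(1) by (intro ball_int_le_nn_integral continuous_intros g ce) auto
    qed
    have dest: "ball_int (2 * R) (\<lambda>x. (g x)\<^sup>2 * (d i j x)\<^sup>2) \<le> (K1 + K2) * (1 + L) * R powr (3 + a / 2)"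
      if g: "continuous_on UNIV g" "\<And>x. 0 \<le> g x" and L: "0 \<le> L"
      "(\<integral>\<^sup>+x. ennreal (indicator (cball 0 (2 * R)) x * g x powr q) \<partial>lborel) \<le> ennreal (L * R ^ 3)" for g L i j
    proof -
      have "ball_int (2 * R) (\<lambda>x. (g x)\<^sup>2 * (d i j x)\<^sup>2) \<le> ball_int (2 * R) (\<lambda>x. (2 * C0\<^sup>2) * (g x)\<^sup>2 + 2 * ((g x)\<^sup>2 * (?e i j x)\<^sup>2))"
      proof (rule ball_int_mono)
        fix x :: "real ^ 3"
        assume x: "norm x \<le> 2 * R"
        have "\<bar>E i j x\<bar> \<le> \<bar>C0\<bar>" using E(4)[OF x] C0(1) by simp
        then have "(E i j x)\<^sup>2 \<le> C0\<^sup>2" by (simp only: abs_le_square_iff)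
        then have "(d i j x)\<^sup>2 \<le> 2 * C0\<^sup>2 + 2 * (?e i j x)\<^sup>2"
          unfolding d_def using sum_square_le[of "E i j x" "?e i j x"] by linarith
        then have "(g x)\<^sup>2 * (d i j x)\<^sup>2 \<le> (g x)\<^sup>2 * (2 * C0\<^sup>2 + 2 * (?e i j x)\<^sup>2)"
          by (rule mult_left_mono) simp
        then show "(g x)\<^sup>2 * (d i j x)\<^sup>2 \<le> (2 * C0\<^sup>2) * (g x)\<^sup>2 + 2 * ((g x)\<^sup>2 * (?e i j x)\<^sup>2)"
          by (simp add: algebra_simps)
      qed (intro continuous_intros g cd ce)+
      also have "\<dots> = (2 * C0\<^sup>2) * ball_int (2 * R) (\<lambda>x. (g x)\<^sup>2) + 2 * ball_int (2 * R) (\<lambda>x. (g x)\<^sup>2 * (?e i j x)\<^sup>2)"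
        by (subst ball_int_add) (auto intro!: continuous_intros g ce simp: ball_int_cmult)
      also have "\<dots> \<le> (2 * C0\<^sup>2) * ((8 * v + L) * R powr (3 + a / 2)) + 2 * (P * (1 + L) * R powr (3 + a / 2))"
      proof (intro add_mono mult_left_mono west g L)
        have "ball_int (2 * R) (\<lambda>x. (g x)\<^sup>2) \<le> (8 * v + L) * R ^ 3"
          unfolding v_def by (rule ball_int_square_le[OF g L q(1)]) (use R in simp)
        also have "\<dots> \<le> (8 * v + L) * R powr (3 + a / 2)"
        proof (rule mult_left_mono)
          have "R ^ 3 = R powr 3" using R by (simp add: powr_numeral)
          also have "\<dots> \<le> R powr (3 + a / 2)" using R a by (intro powr_mono) auto
          finally show "R ^ 3 \<le> R powr (3 + a / 2)" .
        qed (use v0 L in auto)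
        finally show "ball_int (2 * R) (\<lambda>x. (g x)\<^sup>2) \<le> (8 * v + L) * R powr (3 + a / 2)" .
      qed auto
      also have "\<dots> = ((2 * C0\<^sup>2) * (8 * v + L) + 2 * (P * (1 + L))) * R powr (3 + a / 2)"
        by (simp add: algebra_simps)
      also have "\<dots> \<le> ((K1 + K2) * (1 + L)) * R powr (3 + a / 2)"
      proof (rule mult_right_mono)
        have "8 * v + L \<le> (8 * v + 1) * (1 + L)" using v0 L by (simp add: algebra_simps)
        then have "(2 * C0\<^sup>2) * (8 * v + L) \<le> (2 * C0\<^sup>2) * ((8 * v + 1) * (1 + L))" by (rule mult_left_mono) simp
        then have "(2 * C0\<^sup>2) * (8 * v + L) + 2 * (P * (1 + L)) \<le> K1 * (1 + L)"
          by (simp add: K1_def algebra_simps)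
        also have "\<dots> \<le> (K1 + K2) * (1 + L)" using K12 L by (intro mult_right_mono) auto
        finally show "(2 * C0\<^sup>2) * (8 * v + L) + 2 * (P * (1 + L)) \<le> (K1 + K2) * (1 + L)" .
      qed simp
      finally show ?thesis .
    qed
    have gest: "ball_int R (\<lambda>x. \<Sum>k\<in>UNIV. (pd k (d i j) x)\<^sup>2) \<le> (K1 + K2) * R powr (2 - a / 2)" for i j
    proof -
      have R2: "1 \<le> R powr (2 - a / 2)" using R a by (intro ge_one_powr_ge_zero) auto
      let ?rem = S.remainder
      have rem1: "C1 (?rem i)" for i by (rule S.remainder_C1)
      have crem: "continuous_on UNIV (?rem i)" for i using rem1 by (rule C1_continuous)
      have cU: "continuous_on UNIV (\<lambda>x. u x $ i)" for i using cu by (intro continuous_intros)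
      \<comment> \<open>The field contributes 3 - 6/q and its mollification, bounded by
        \<open>Cm / R\<close>, contributes 1 to the exponent; both are at most 2 - a/2.\<close>
      have brem: "ball_int (2 * R) (\<lambda>x. (?rem i x)\<^sup>2) \<le> (2 * (8 * v + N) + 16 * Cm\<^sup>2 * v) * R powr (2 - a / 2)" for i
      proof -
        have "ball_int (2 * R) (\<lambda>x. (?rem i x)\<^sup>2) \<le> ball_int (2 * R) (\<lambda>x. 2 * (u x $ i)\<^sup>2 + 2 * (Cm / R)\<^sup>2)"
        proof (rule ball_int_mono)
          fix x :: "real ^ 3"
          have "\<bar>avg mollifier (\<lambda>x. u x $ i) R x\<bar> \<le> \<bar>Cm / R\<bar>"
            by (rule order_trans[OF Cm(2)[OF R0] abs_ge_self])
          then have "(avg mollifier (\<lambda>x. u x $ i) R x)\<^sup>2 \<le> (Cm / R)\<^sup>2" by (simp only: abs_le_square_iff)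
          then show "(?rem i x)\<^sup>2 \<le> 2 * (u x $ i)\<^sup>2 + 2 * (Cm / R)\<^sup>2"
            using sum_square_le[of "u x $ i" "- avg mollifier (\<lambda>x. u x $ i) R x"]
            unfolding S.remainder_def by (simp add: U_def)
        qed (intro continuous_intros crem cU)+
        also have "\<dots> = 2 * ball_int (2 * R) (\<lambda>x. (u x $ i)\<^sup>2) + 2 * (Cm / R)\<^sup>2 * ((2 * R) ^ 3 * v)"
          using R by (subst ball_int_add) (auto intro!: continuous_intros cU simp: ball_int_cmult ball_int_const v_def)
        also have "2 * (Cm / R)\<^sup>2 * ((2 * R) ^ 3 * v) = 16 * Cm\<^sup>2 * v * R"
          using R0 by (simp add: power_divide power_mult_distrib field_simps eval_nat_numeral)
        also have "2 * ball_int (2 * R) (\<lambda>x. (u x $ i)\<^sup>2) + 16 * Cm\<^sup>2 * v * R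
            \<le> 2 * ((8 * v + N) * R powr (2 - a / 2)) + 16 * Cm\<^sup>2 * v * R powr (2 - a / 2)"
        proof (intro add_mono mult_left_mono)
          have "ball_int (2 * R) (\<lambda>x. (u x $ i)\<^sup>2) \<le> (8 * v + N) * R powr (3 - 6 / q)"
            unfolding v_def by (rule ball_int_component_square[OF Lq cu q(1) R])
          also have "\<dots> \<le> (8 * v + N) * R powr (2 - a / 2)"
            using R a v0 Lq(2) by (intro mult_left_mono powr_mono) auto
          finally show "ball_int (2 * R) (\<lambda>x. (u x $ i)\<^sup>2) \<le> (8 * v + N) * R powr (2 - a / 2)" .
          have "R = R powr 1" using R by simp
          also have "\<dots> \<le> R powr (2 - a / 2)" using R a by (intro powr_mono) auto
          finally show "R \<le> R powr (2 - a / 2)" .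
        qed (use v0 in auto)
        finally show ?thesis by (simp add: algebra_simps)
      qed
      have be: "ball_int (2 * R) (\<lambda>x. (?e i j x)\<^sup>2 / (2 * R)\<^sup>2) \<le> P * (1 + 8 * v) * R powr (2 - a / 2)"
      proof -
        \<comment> \<open>The constant weight \<open>g = 1\<close> is admissible with
          \<open>L = 8 * v\<close>. After division by R^2 the exponent 1 + a/2 is at most 2 - a/2
          because a <= 1.\<close>
        have one: "(\<integral>\<^sup>+x. ennreal (indicator (cball (0 :: real ^ 3) (2 * R)) x * 1 powr q) \<partial>lborel) \<le> ennreal (8 * v * R ^ 3)"
          using emeasure_cball_scale[of "2 * R" "0 :: real ^ 3"] R by (simp add: v_def power_mult_distrib ennreal_indicator mult_ac)
        have "ball_int (2 * R) (\<lambda>x. 1\<^sup>2 * (?e i j x)\<^sup>2) \<le> P * (1 + 8 * v) * R powr (3 + a / 2)"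
          by (rule west[OF _ _ _ one]) (use v0 in auto)
        then have "1 / (2 * R)\<^sup>2 * ball_int (2 * R) (\<lambda>x. (?e i j x)\<^sup>2) \<le> 1 / (2 * R)\<^sup>2 * (P * (1 + 8 * v) * R powr (3 + a / 2))"
          by (intro mult_left_mono) auto
        also have "\<dots> \<le> R powr - 2 * (P * (1 + 8 * v) * R powr (3 + a / 2))"
        proof (rule mult_right_mono)
          have "R powr - 2 = 1 / R\<^sup>2" using R by (simp add: powr_minus_divide powr_numeral)
          moreover have "1 / (2 * R)\<^sup>2 \<le> 1 / R\<^sup>2" using R by (intro divide_left_mono power_mono) auto
          ultimately show "1 / (2 * R)\<^sup>2 \<le> R powr - 2" by simp
          show "0 \<le> P * (1 + 8 * v) * R powr (3 + a / 2)" using P0 v0 by simp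
        qed
        also have "\<dots> = P * (1 + 8 * v) * (R powr - 2 * R powr (3 + a / 2))" by simp
        also have "\<dots> \<le> P * (1 + 8 * v) * R powr (2 - a / 2)"
          unfolding powr_add[symmetric] using R a P0 v0 by (intro mult_left_mono powr_mono) auto
        finally show ?thesis
          using ball_int_cmult[of "2 * R" "1 / (2 * R)\<^sup>2" "\<lambda>x. (?e i j x)\<^sup>2"] by simp
      qed
      have cac: "c\<^sup>2 * ball_int R (\<lambda>x. \<Sum>k\<in>UNIV. (pd k (?e i j) x)\<^sup>2)
          \<le> 200 * A\<^sup>2 * ball_int (2 * R) (\<lambda>x. (?rem i x)\<^sup>2 + (?rem j x)\<^sup>2 + (?e i j x)\<^sup>2 / (2 * R)\<^sup>2)"
      proof -
        \<comment> \<open>The scale 2R makes the ball of radius \<open>R\<close> the half ball of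
          the cutoff, where it is at least \<open>c\<close>.\<close>
        let ?w = "cutoff (2 * R) :: real ^ 3 \<Rightarrow> real"
        have w1: "C1 ?w" by (intro C2_C1 cutoff_C2)
        have cw: "continuous_on UNIV ?w" using w1 by (rule C1_continuous)
        have "c\<^sup>2 * ball_int R (\<lambda>x. \<Sum>k\<in>UNIV. (pd k (?e i j) x)\<^sup>2) = ball_int R (\<lambda>x. c\<^sup>2 * (\<Sum>k\<in>UNIV. (pd k (?e i j) x)\<^sup>2))"
          by (simp add: ball_int_cmult)
        also have "\<dots> \<le> ball_int R (\<lambda>x. (?w x)\<^sup>2 * (\<Sum>k\<in>UNIV. (pd k (?e i j) x)\<^sup>2))"
        proof (rule ball_int_mono)
          fix x :: "real ^ 3"
          assume x: "norm x \<le> R"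
          have "c \<le> ?w x" unfolding cutoff_def using x R0 by (intro c(2)) (simp add: field_simps)
          then have "c\<^sup>2 \<le> (?w x)\<^sup>2" using c(1) by (intro power_mono) auto
          then show "c\<^sup>2 * (\<Sum>k\<in>UNIV. (pd k (?e i j) x)\<^sup>2) \<le> (?w x)\<^sup>2 * (\<Sum>k\<in>UNIV. (pd k (?e i j) x)\<^sup>2)"
            by (intro mult_right_mono sum_nonneg) auto
        qed (intro continuous_intros cw ce)+
        also have "\<dots> \<le> (\<integral>x. (?w x)\<^sup>2 * (\<Sum>k\<in>UNIV. (pd k (?e i j) x)\<^sup>2) \<partial>lborel)"
          using R0 by (intro ball_int_le_integral[where \<rho>'="2 * R"] continuous_intros cw ce mult_nonneg_nonneg sum_nonneg)
            (auto simp: cutoff_outside)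
        also have "\<dots> \<le> 200 * A\<^sup>2 * ball_int (2 * R) (\<lambda>x. (?rem i x)\<^sup>2 + (?rem j x)\<^sup>2 + (?e i j x)\<^sup>2 / (2 * R)\<^sup>2)"
          unfolding ball_int_def
        proof (rule caccioppoli[OF e2 rem1 rem1 S.laplacian_skew_pot w1])
          show "cutoff (2 * R) x = 0" if "2 * R < norm x" for x :: "real ^ 3" using cutoff_outside[OF _ that] R0 by simp
          show "\<bar>?w x\<bar> \<le> A" for x by (simp add: cutoff_def A(2))
          show "\<bar>pd k ?w x\<bar> \<le> A / (2 * R)" for k x
            unfolding pd_cutoff using A(3)[of k "(1 / (2 * R)) *\<^sub>R x"] R0 by (simp only: abs_mult) (simp add: divide_right_mono)
          show "0 < 2 * R" using R0 by simp
        qed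
        finally show ?thesis .
      qed
      have "ball_int (2 * R) (\<lambda>x. (?rem i x)\<^sup>2 + (?rem j x)\<^sup>2 + (?e i j x)\<^sup>2 / (2 * R)\<^sup>2)
          = ball_int (2 * R) (\<lambda>x. (?rem i x)\<^sup>2) + ball_int (2 * R) (\<lambda>x. (?rem j x)\<^sup>2) + ball_int (2 * R) (\<lambda>x. (?e i j x)\<^sup>2 / (2 * R)\<^sup>2)"
        using R0 by (subst ball_int_add ball_int_add; (intro continuous_intros crem ce; simp)?)+ simp
      also have "\<dots> \<le> (2 * (8 * v + N) + 16 * Cm\<^sup>2 * v) * R powr (2 - a / 2) + (2 * (8 * v + N) + 16 * Cm\<^sup>2 * v) * R powr (2 - a / 2)
          + P * (1 + 8 * v) * R powr (2 - a / 2)"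
        by (intro add_mono brem be)
      also have "\<dots> = (4 * (8 * v + N) + 32 * Cm\<^sup>2 * v + P * (1 + 8 * v)) * R powr (2 - a / 2)"
        by (simp add: algebra_simps)
      finally have "200 * A\<^sup>2 * ball_int (2 * R) (\<lambda>x. (?rem i x)\<^sup>2 + (?rem j x)\<^sup>2 + (?e i j x)\<^sup>2 / (2 * R)\<^sup>2)
          \<le> 200 * A\<^sup>2 * ((4 * (8 * v + N) + 32 * Cm\<^sup>2 * v + P * (1 + 8 * v)) * R powr (2 - a / 2))"
        by (rule mult_left_mono) simp
      with cac have "ball_int R (\<lambda>x. \<Sum>k\<in>UNIV. (pd k (?e i j) x)\<^sup>2)
          \<le> 200 * A\<^sup>2 / c\<^sup>2 * (4 * (8 * v + N) + 32 * Cm\<^sup>2 * v + P * (1 + 8 * v)) * R powr (2 - a / 2)"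
        using c(1) by (simp add: field_simps)
      moreover have "ball_int R (\<lambda>x. \<Sum>k\<in>UNIV. (pd k (d i j) x)\<^sup>2)
          \<le> 6 * (C0 / R)\<^sup>2 * (R ^ 3 * v) + 2 * ball_int R (\<lambda>x. \<Sum>k\<in>UNIV. (pd k (?e i j) x)\<^sup>2)"
      proof -
        have "ball_int R (\<lambda>x. \<Sum>k\<in>UNIV. (pd k (d i j) x)\<^sup>2) \<le> ball_int R (\<lambda>x. 6 * (C0 / R)\<^sup>2 + 2 * (\<Sum>k\<in>UNIV. (pd k (?e i j) x)\<^sup>2))"
        proof (rule ball_int_mono)
          fix x :: "real ^ 3"
          assume x: "norm x \<le> R"
          have "(pd k (d i j) x)\<^sup>2 \<le> 2 * (C0 / R)\<^sup>2 + 2 * (pd k (?e i j) x)\<^sup>2" for k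
          proof -
            have "\<bar>pd k (E i j) x\<bar> \<le> \<bar>C0 / R\<bar>" using E(5)[of x k i j] x R0 C0(1) by simp
            then have "(pd k (E i j) x)\<^sup>2 \<le> (C0 / R)\<^sup>2" by (simp only: abs_le_square_iff)
            then show ?thesis unfolding pdd using sum_square_le[of "pd k (E i j) x" "pd k (?e i j) x"] by linarith
          qed
          then have "(\<Sum>k\<in>UNIV. (pd k (d i j) x)\<^sup>2) \<le> (\<Sum>k\<in>(UNIV :: 3 set). 2 * (C0 / R)\<^sup>2 + 2 * (pd k (?e i j) x)\<^sup>2)"
            by (rule sum_mono)
          then show "(\<Sum>k\<in>UNIV. (pd k (d i j) x)\<^sup>2) \<le> 6 * (C0 / R)\<^sup>2 + 2 * (\<Sum>k\<in>UNIV. (pd k (?e i j) x)\<^sup>2)"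
            by (simp add: sum.distrib sum_distrib_left)
        qed (intro continuous_intros cd ce)+
        also have "\<dots> = 6 * (C0 / R)\<^sup>2 * (R ^ 3 * v) + 2 * ball_int R (\<lambda>x. \<Sum>k\<in>UNIV. (pd k (?e i j) x)\<^sup>2)"
          using R0 by (subst ball_int_add) (auto intro!: continuous_intros ce simp: ball_int_cmult ball_int_const v_def)
        finally show ?thesis .
      qed
      moreover have "6 * (C0 / R)\<^sup>2 * (R ^ 3 * v) \<le> 6 * C0\<^sup>2 * v * R powr (2 - a / 2)"
      proof -
        have "6 * (C0 / R)\<^sup>2 * (R ^ 3 * v) = 6 * C0\<^sup>2 * v * R"
          using R0 by (simp add: power_divide field_simps eval_nat_numeral)
        also have "\<dots> \<le> 6 * C0\<^sup>2 * v * R powr (2 - a / 2)"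
        proof (rule mult_left_mono)
          have "R = R powr 1" using R by simp
          also have "\<dots> \<le> R powr (2 - a / 2)" using R a by (intro powr_mono) auto
          finally show "R \<le> R powr (2 - a / 2)" .
        qed (use v0 in auto)
        finally show ?thesis .
      qed
      ultimately have "ball_int R (\<lambda>x. \<Sum>k\<in>UNIV. (pd k (d i j) x)\<^sup>2) \<le> 6 * C0\<^sup>2 * v * R powr (2 - a / 2)
          + 2 * (200 * A\<^sup>2 / c\<^sup>2 * (4 * (8 * v + N) + 32 * Cm\<^sup>2 * v + P * (1 + 8 * v)) * R powr (2 - a / 2))"
        by linarith
      also have "\<dots> = K2 * R powr (2 - a / 2)"
        by (simp only: K2_def distrib_right mult.assoc)
      also have "\<dots> \<le> (K1 + K2) * R powr (2 - a / 2)" using K12 by (intro mult_right_mono) auto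
      finally show ?thesis .
    qed
    show "\<exists>d :: 3 \<Rightarrow> 3 \<Rightarrow> real ^ 3 \<Rightarrow> real.
     (\<forall>i j. C1 (d i j)) \<and> (\<forall>i j x. d i j x = - d j i x) \<and>
     (\<forall>i x. (\<Sum>j\<in>UNIV. pd j (d i j) x) = u x $ i) \<and>
     (\<forall>i j g L. continuous_on UNIV g \<longrightarrow> (\<forall>x. 0 \<le> g x) \<longrightarrow> 0 \<le> L \<longrightarrow>
        (\<integral>\<^sup>+x. ennreal (indicator (cball 0 (2 * R)) x * g x powr q) \<partial>lborel) \<le> ennreal (L * R ^ 3) \<longrightarrow>
        ball_int (2 * R) (\<lambda>x. (g x)\<^sup>2 * (d i j x)\<^sup>2) \<le> (K1 + K2) * (1 + L) * R powr (3 + a / 2)) \<and>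
     (\<forall>i j. ball_int R (\<lambda>x. \<Sum>k\<in>UNIV. (pd k (d i j) x)\<^sup>2) \<le> (K1 + K2) * R powr (2 - a / 2))"
    proof (intro exI[of _ d] conjI allI impI)
      show "ball_int (2 * R) (\<lambda>x. (g x)\<^sup>2 * (d i j x)\<^sup>2) \<le> (K1 + K2) * (1 + L) * R powr (3 + a / 2)"
        if "continuous_on UNIV g" "\<forall>x. 0 \<le> g x" "0 \<le> L"
          "(\<integral>\<^sup>+x. ennreal (indicator (cball 0 (2 * R)) x * g x powr q) \<partial>lborel) \<le> ennreal (L * R ^ 3)" for i j g L
        by (rule dest[OF that(1) that(2)[rule_format] that(3,4)])
    qed (rule d1 dskew ddiv gest)+
  qed
qed

section \<open>The Liouville theorem\<close>

lemma partial_deriv_component: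
  fixes f :: "real ^ 'n::finite \<Rightarrow> real ^ 'm::finite"
  assumes "f differentiable (at x)"
  shows "partial_deriv j f x $ i = pd j (\<lambda>y. f y $ i) x"
proof -
  have "((\<lambda>y. f y $ i) has_derivative (\<lambda>h. frechet_derivative f (at x) h $ i)) (at x)"
    using assms by (intro bounded_linear.has_derivative[OF bounded_linear_vec_nth]) (simp add: frechet_derivative_works[symmetric])
  from pd_eq[OF this] show ?thesis by (simp add: partial_deriv_def)
qed

lemma laplacian_component:
  fixes f :: "real ^ 'n::finite \<Rightarrow> real ^ 'm::finite"
  assumes "smooth_function f"
  shows "laplacian f x $ i = (\<Sum>k\<in>UNIV. pd k (pd k (\<lambda>y. f y $ i)) x)"
proof -
  have "partial_deriv k (partial_deriv k f) x $ i = pd k (pd k (\<lambda>y. f y $ i)) x" for k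
  proof -
    have "(\<lambda>y. partial_deriv k f y $ i) = pd k (\<lambda>y. f y $ i)"
      using partial_deriv_component[OF smooth_differentiable[OF assms]] by (rule ext)
    then show ?thesis
      using partial_deriv_component[OF smooth_differentiable[OF smooth_partial_deriv[OF assms]]] by simp
  qed
  then show ?thesis by (simp add: laplacian_def)
qed

lemma Lebesgue_space_nn_integral:
  fixes u :: "real ^ 3 \<Rightarrow> real ^ 3"
  assumes "u \<in> Lebesgue_space q" "continuous_on UNIV u"
  obtains N where "0 \<le> N" "(\<integral>\<^sup>+x. ennreal (norm (u x) powr q) \<partial>lborel) \<le> ennreal N"
proof -
  have [measurable]: "u \<in> borel_measurable borel" using assms(2) by (rule borel_measurable_continuous_onI)
  have "integrable lborel (\<lambda>x. norm (u x) powr q)"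
    using assms(1) integrable_completion[of "\<lambda>x. norm (u x) powr q" lborel]
    by (simp add: Lebesgue_space_def)
  then have "(\<integral>\<^sup>+x. ennreal (norm (u x) powr q) \<partial>lborel) = ennreal (\<integral>x. norm (u x) powr q \<partial>lborel)"
    by (intro nn_integral_eq_integral) auto
  moreover have "0 \<le> (\<integral>x. norm (u x) powr q \<partial>lborel)" by (intro integral_nonneg_AE) auto
  ultimately show ?thesis using that[of "\<integral>x. norm (u x) powr q \<partial>lborel"] by simp
qed

lemma zero_gradient_Lebesgue_space:
  fixes u :: "real ^ 3 \<Rightarrow> real ^ 3"
  assumes u: "smooth_function u" and z: "\<And>i k x. pd k (\<lambda>x. u x $ i) x = 0"
    and N: "(\<integral>\<^sup>+x. ennreal (norm (u x) powr q) \<partial>lborel) \<le> ennreal N"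
  shows "u x = 0"
proof -
  have const: "u x = u 0" for x
  proof -
    have "u x $ i = u 0 $ i" for i
    proof -
      have d: "(\<lambda>x. u x $ i) differentiable (at y)" for y
        using smooth_differentiable[OF smooth_component[OF u]] .
      obtain t where "u (0 + x) $ i - u 0 $ i = (\<Sum>j\<in>UNIV. x $ j * pd j (\<lambda>x. u x $ i) (0 + t *\<^sub>R x))"
        by (rule mean_value_line[where f="\<lambda>x. u x $ i" and x=0 and h=x, OF d], rule that)
      then show ?thesis by (simp add: z)
    qed
    then show ?thesis by (simp add: vec_eq_iff)
  qed
  have "(\<integral>\<^sup>+x. ennreal (norm (u x) powr q) \<partial>(lborel :: (real ^ 3) measure)) = (\<integral>\<^sup>+x. ennreal (norm (u 0) powr q) \<partial>(lborel :: (real ^ 3) measure))"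
    by (rule nn_integral_cong) (subst const, rule refl)
  also have "\<dots> = ennreal (norm (u 0) powr q) * \<infinity>" by (simp add: emeasure_lborel_UNIV)
  finally have "ennreal (norm (u 0) powr q) * \<infinity> \<le> ennreal N" using N by simp
  then have "norm (u 0) powr q = 0"
    by (cases "norm (u 0) powr q = 0") (auto simp: ennreal_mult_top top_unique)
  then show ?thesis using const[of x] by simp
qed

theorem theorem4:
  fixes u H :: "real ^ 3 \<Rightarrow> real ^ 3" and q :: real
  assumes "stationary_MHD_solution u H"
    and "u \<in> BMO_inv" and "H \<in> BMO_inv"
    and "2 < q" and "q < 6"
    and "u \<in> Lebesgue_space q" and "H \<in> Lebesgue_space q"
  shows "(\<forall>x. u x = 0) \<and> (\<forall>x. H x = 0)"
proof -
  have smooth: "smooth_function u" "smooth_function H"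
    using assms(1) by (auto simp: stationary_MHD_solution_def)
  obtain p :: "real ^ 3 \<Rightarrow> real" where p: "smooth_function p"
    and eqs: "\<And>x. divergence u x = 0" "\<And>x. convection u u x - laplacian u x + grad p x = convection H H x"
      "\<And>x. divergence H x = 0" "\<And>x. convection u H x - convection H u x = laplacian H x"
    using assms(1) by (auto simp: stationary_MHD_solution_def)
  define U V where "U = (\<lambda>i x. u x $ i)" and "V = (\<lambda>i x. H x $ i)"
  have UVs: "smooth_function (U i)" "smooth_function (V i)" for i
    unfolding U_def V_def by (rule smooth_component[OF smooth(1)] smooth_component[OF smooth(2)])+
  have UV2: "C2 (U i)" "C2 (V i)" for i by (rule smooth_C2[OF UVs(1)] smooth_C2[OF UVs(2)])+
  have cUV: "continuous_on UNIV (U i)" "continuous_on UNIV (V i)" "continuous_on UNIV (pd k (U i))" "continuous_on UNIV (pd k (V i))" for i k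
    by (rule C1_continuous[OF smooth_C1[OF UVs(1)]] C1_continuous[OF smooth_C1[OF UVs(2)]]
        C1_continuous_pd[OF smooth_C1[OF UVs(1)]] C1_continuous_pd[OF smooth_C1[OF UVs(2)]])+
  have cvec: "continuous_on UNIV f" if "smooth_function f" for f :: "real ^ 3 \<Rightarrow> real ^ 3"
    using smooth_differentiable[OF that] by (intro continuous_at_imp_continuous_on ballI differentiable_imp_continuous_within)
  have mom: "(\<Sum>k\<in>UNIV. pd k (pd k (U i)) x) =
      (\<Sum>j\<in>UNIV. U j x * pd j (U i) x) - (\<Sum>j\<in>UNIV. V j x * pd j (V i) x) + pd i p x" for i x
    using arg_cong[OF eqs(2)[of x], of "\<lambda>y. y $ i"]
    by (simp add: laplacian_component[OF smooth(1)] convection_def grad_def U_def V_def)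
  have ind: "(\<Sum>k\<in>UNIV. pd k (pd k (V i)) x) =
      (\<Sum>j\<in>UNIV. U j x * pd j (V i) x) - (\<Sum>j\<in>UNIV. V j x * pd j (U i) x)" for i x
    using arg_cong[OF eqs(4)[of x], of "\<lambda>y. y $ i"]
    by (simp add: laplacian_component[OF smooth(2)] convection_def U_def V_def)
  have divs: "(\<Sum>j\<in>UNIV. pd j (\<lambda>x. u x $ j) x) = 0" "(\<Sum>j\<in>UNIV. pd j (\<lambda>x. H x $ j) x) = 0" for x
    using eqs(1,3)[of x] by (simp_all add: divergence_def)
  obtain Nu where Nu: "0 \<le> Nu" "(\<integral>\<^sup>+x. ennreal (norm (u x) powr q) \<partial>lborel) \<le> ennreal Nu"
    by (rule Lebesgue_space_nn_integral[OF assms(6) cvec[OF smooth(1)]], rule that)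
  obtain Nh where Nh: "0 \<le> Nh" "(\<integral>\<^sup>+x. ennreal (norm (H x) powr q) \<partial>lborel) \<le> ennreal Nh"
    by (rule Lebesgue_space_nn_integral[OF assms(7) cvec[OF smooth(2)]], rule that)
  define N where "N = Nu + Nh"
  have N: "0 \<le> N" "(\<integral>\<^sup>+x. ennreal (norm (u x) powr q) \<partial>lborel) \<le> ennreal N"
    "(\<integral>\<^sup>+x. ennreal (norm (H x) powr q) \<partial>lborel) \<le> ennreal N"
    using Nu Nh by (auto simp: N_def intro: order_trans ennreal_leI)
  \<comment> \<open>The three constraints: (q-2)/q for Young's inequality, 6/q - 1 so that R^(3 -
    6/q + a/2) is at most R^(2 - a/2), and 1 so that R^(3 + a/2 - 4) is at most R^(-a/2).\<close>
  define a where "a = min (min 1 ((q - 2) / q)) (6 / q - 1)"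
  have q: "2 < q" "q < 6" by fact+
  have "0 < (q - 2) / q" "0 < 6 / q - 1" using q by (auto simp: field_simps)
  then have a: "0 < a" "a \<le> 1" "a \<le> (q - 2) / q" "a \<le> 6 / q - 1" by (auto simp: a_def)
  define v where "v = measure lborel (cball (0 :: real ^ 3) 1)"
  have v0: "0 \<le> v" by (simp add: v_def)
  let ?pot = "\<lambda>(f :: real ^ 3 \<Rightarrow> real ^ 3) K R (d :: 3 \<Rightarrow> 3 \<Rightarrow> real ^ 3 \<Rightarrow> real).
     (\<forall>i j. C1 (d i j)) \<and> (\<forall>i j x. d i j x = - d j i x) \<and>
     (\<forall>i x. (\<Sum>j\<in>UNIV. pd j (d i j) x) = f x $ i) \<and>
     (\<forall>i j g L. continuous_on UNIV g \<longrightarrow> (\<forall>x. 0 \<le> g x) \<longrightarrow> 0 \<le> L \<longrightarrow>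
        (\<integral>\<^sup>+x. ennreal (indicator (cball 0 (2 * R)) x * g x powr q) \<partial>lborel) \<le> ennreal (L * R ^ 3) \<longrightarrow>
        ball_int (2 * R) (\<lambda>x. (g x)\<^sup>2 * (d i j x)\<^sup>2) \<le> K * (1 + L) * R powr (3 + a / 2)) \<and>
     (\<forall>i j. ball_int R (\<lambda>x. \<Sum>k\<in>UNIV. (pd k (d i j) x)\<^sup>2) \<le> K * R powr (2 - a / 2))"
  obtain Ku where Ku: "0 \<le> Ku" "\<And>R. 1 \<le> R \<Longrightarrow> \<exists>d. ?pot u Ku R d"
    by (rule field_potential[OF assms(2) smooth(1) divs(1) N(2) N(1) q a], rule that)
  obtain Kh where Kh: "0 \<le> Kh" "\<And>R. 1 \<le> R \<Longrightarrow> \<exists>d. ?pot H Kh R d"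
    by (rule field_potential[OF assms(3) smooth(2) divs(2) N(3) N(1) q a], rule that)
  define Kt where "Kt = Ku + Kh"
  have Kt: "0 \<le> Kt" "Ku \<le> Kt" "Kh \<le> Kt" using Ku(1) Kh(1) by (auto simp: Kt_def)
  obtain A where A: "0 < A" "\<And>z :: real ^ 3. \<bar>bump z\<bar> \<le> A" "\<And>k (z :: real ^ 3). \<bar>pd k bump z\<bar> \<le> A"
    "\<And>j k (z :: real ^ 3). \<bar>pd k (pd j bump) z\<bar> \<le> A"
    by (rule bump_bounds[where 'n=3], rule that)
  obtain c where c: "0 < c" "\<And>z :: real ^ 3. norm z \<le> 1 / 2 \<Longrightarrow> c \<le> bump z"
    by (rule bump_lower_bound[where 'n=3], rule that)
  define G where "G = (\<lambda>x. \<Sum>i\<in>UNIV. \<Sum>k\<in>UNIV. (pd k (U i) x)\<^sup>2 + (pd k (V i) x)\<^sup>2)"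
  have cG: "continuous_on UNIV G" unfolding G_def by (intro continuous_intros cUV)
  have G0: "0 \<le> G x" for x unfolding G_def by (intro sum_nonneg add_nonneg_nonneg) auto
  \<comment> \<open>Sum of the constants in \<open>bS\<close>, \<open>bSD\<close>, \<open>bE\<close>
    and \<open>bD\<close>: 108 = 27 * 4 counts index triples and the four products of a field with a
    potential, 18 = 9 * 2 counts index pairs and the two potentials.\<close>
  define Q where "Q = 3 * (16 * v + 2 * N) + 108 * (Kt * (1 + N)) + 9 * Kt + 18 * (Kt * (1 + 8 * v))"
  have decay: "(\<integral>x. (cutoff R x) ^ 4 * G x \<partial>lborel) \<le> 4 * (2592 * A\<^sup>2)\<^sup>2 * (Q * R powr - (a / 2))"
    if R: "1 \<le> R" for R
  proof -
    have R0: "0 < R" using R by simp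
    obtain d where d: "?pot u Ku R d" using Ku(2)[OF R] by blast
    obtain h where h: "?pot H Kh R h" using Kh(2)[OF R] by blast
    have d1: "C1 (d i j)" "C1 (h i j)" for i j
      using conjunct1[OF d] conjunct1[OF h] by auto
    have cdh: "continuous_on UNIV (d i j)" "continuous_on UNIV (h i j)" "continuous_on UNIV (pd k (d i j))" for i j k
      by (rule C1_continuous[OF d1(1)] C1_continuous[OF d1(2)] C1_continuous_pd[OF d1(1)])+
    have dsk: "d i j x = - d j i x" "h i j x = - h j i x" for i j x
      using conjunct1[OF conjunct2[OF d]] conjunct1[OF conjunct2[OF h]] by blast+
    have ddiv: "(\<Sum>j\<in>UNIV. pd j (d i j) x) = U i x" "(\<Sum>j\<in>UNIV. pd j (h i j) x) = V i x" for i x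
      using conjunct1[OF conjunct2[OF conjunct2[OF d]]] conjunct1[OF conjunct2[OF conjunct2[OF h]]]
      by (simp_all only: U_def V_def)
    have dg: "ball_int (2 * R) (\<lambda>x. (g x)\<^sup>2 * (d i j x)\<^sup>2) \<le> Kt * (1 + L) * R powr (3 + a / 2)"
      "ball_int (2 * R) (\<lambda>x. (g x)\<^sup>2 * (h i j x)\<^sup>2) \<le> Kt * (1 + L) * R powr (3 + a / 2)"
      if "continuous_on UNIV g" "\<forall>x. 0 \<le> g x" "0 \<le> L"
        "(\<integral>\<^sup>+x. ennreal (indicator (cball 0 (2 * R)) x * g x powr q) \<partial>lborel) \<le> ennreal (L * R ^ 3)" for g L i j
    proof -
      have "ball_int (2 * R) (\<lambda>x. (g x)\<^sup>2 * (d i j x)\<^sup>2) \<le> Ku * (1 + L) * R powr (3 + a / 2)"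
        using d that by blast
      also have "\<dots> \<le> Kt * (1 + L) * R powr (3 + a / 2)" using Kt that(3) by (intro mult_right_mono) auto
      finally show "ball_int (2 * R) (\<lambda>x. (g x)\<^sup>2 * (d i j x)\<^sup>2) \<le> Kt * (1 + L) * R powr (3 + a / 2)" .
      have "ball_int (2 * R) (\<lambda>x. (g x)\<^sup>2 * (h i j x)\<^sup>2) \<le> Kh * (1 + L) * R powr (3 + a / 2)"
        using h that by blast
      also have "\<dots> \<le> Kt * (1 + L) * R powr (3 + a / 2)" using Kt that(3) by (intro mult_right_mono) auto
      finally show "ball_int (2 * R) (\<lambda>x. (g x)\<^sup>2 * (h i j x)\<^sup>2) \<le> Kt * (1 + L) * R powr (3 + a / 2)" .
    qed
    have dgrad: "ball_int R (\<lambda>x. \<Sum>k\<in>UNIV. (pd k (d i j) x)\<^sup>2) \<le> Kt * R powr (2 - a / 2)" for i j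
    proof -
      have "ball_int R (\<lambda>x. \<Sum>k\<in>UNIV. (pd k (d i j) x)\<^sup>2) \<le> Ku * R powr (2 - a / 2)" using d by blast
      also have "\<dots> \<le> Kt * R powr (2 - a / 2)" using Kt by (intro mult_right_mono) auto
      finally show ?thesis .
    qed
    \<comment> \<open>The weighted bound R^(3 + a/2), divided by R^(6/q) to undo the normalisation
      of the weight.\<close>
    define Y where "Y = R powr (3 + a / 2 - 6 / q)"
    \<comment> \<open>Both fields act as weights for both potentials, since the product of
      \<open>S\<close> and \<open>D\<close> contains all four combinations.\<close>
    have cross: "ball_int (2 * R) (\<lambda>x. (f x $ l)\<^sup>2 * (d i j x)\<^sup>2) \<le> Kt * (1 + N) * Y"
      "ball_int (2 * R) (\<lambda>x. (f x $ l)\<^sup>2 * (h i j x)\<^sup>2) \<le> Kt * (1 + N) * Y"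
      if f: "continuous_on UNIV f" "(\<integral>\<^sup>+x. ennreal (norm (f x) powr q) \<partial>lborel) \<le> ennreal N" for f :: "real ^ 3 \<Rightarrow> real ^ 3" and l i j
    proof -
      let ?g = "\<lambda>x. R powr (3 / q) * \<bar>f x $ l\<bar>"
      have g: "continuous_on UNIV ?g" "\<forall>x. 0 \<le> ?g x" using f(1) by (auto intro!: continuous_intros)
      note L = nn_integral_scaled_component[OF f(2) N(1) f(1) q(1) R, of l]
      have sq: "(R powr (3 / q))\<^sup>2 = R powr (6 / q)" by (simp add: power2_eq_square powr_add[symmetric])
      have e: "ball_int (2 * R) (\<lambda>x. (?g x)\<^sup>2 * (e x)\<^sup>2) = R powr (6 / q) * ball_int (2 * R) (\<lambda>x. (f x $ l)\<^sup>2 * (e x)\<^sup>2)" for e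
        by (simp add: power_mult_distrib sq mult.assoc ball_int_cmult)
      have fin: "X \<le> Kt * (1 + N) * Y" if "R powr (6 / q) * X \<le> Kt * (1 + N) * R powr (3 + a / 2)" for X
      proof -
        have "R powr - (6 / q) * (R powr (6 / q) * X) \<le> R powr - (6 / q) * (Kt * (1 + N) * R powr (3 + a / 2))"
          using that by (rule mult_left_mono) simp
        moreover have "R powr - (6 / q) * (R powr (6 / q) * X) = X"
          using R0 by (simp add: mult.assoc[symmetric] powr_add[symmetric])
        moreover have "R powr - (6 / q) * (Kt * (1 + N) * R powr (3 + a / 2)) = Kt * (1 + N) * (R powr - (6 / q) * R powr (3 + a / 2))"
          by (simp only: mult_ac)
        moreover have "R powr - (6 / q) * R powr (3 + a / 2) = Y"
          unfolding Y_def powr_add[symmetric] by (simp add: algebra_simps)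
        ultimately show ?thesis by simp
      qed
      show "ball_int (2 * R) (\<lambda>x. (f x $ l)\<^sup>2 * (d i j x)\<^sup>2) \<le> Kt * (1 + N) * Y"
        using dg(1)[OF g N(1) L, of i j] unfolding e by (rule fin)
      show "ball_int (2 * R) (\<lambda>x. (f x $ l)\<^sup>2 * (h i j x)\<^sup>2) \<le> Kt * (1 + N) * Y"
        using dg(2)[OF g N(1) L, of i j] unfolding e by (rule fin)
    qed
    define S D E where "S = (\<lambda>x. \<Sum>i\<in>UNIV. (U i x)\<^sup>2 + (V i x)\<^sup>2)"
      and "D = (\<lambda>x. \<Sum>i\<in>UNIV. \<Sum>j\<in>UNIV. (d i j x)\<^sup>2 + (h i j x)\<^sup>2)"
      and "E = (\<lambda>x. \<Sum>i\<in>UNIV. \<Sum>j\<in>UNIV. \<Sum>k\<in>UNIV. (pd k (d i j) x)\<^sup>2)"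
    have cS: "continuous_on UNIV S" and cD: "continuous_on UNIV D" and cE: "continuous_on UNIV E"
      unfolding S_def D_def E_def by (intro continuous_intros cUV cdh)+
    have S0: "0 \<le> S x" and D0: "0 \<le> D x" for x
      unfolding S_def D_def by (auto intro!: sum_nonneg)
    have sum3: "(\<Sum>i\<in>(UNIV :: 3 set). f i) \<le> 3 * B" if "\<And>i. f i \<le> B" for f and B :: real
      using sum_mono[of UNIV f "\<lambda>_. B"] that by simp
    have bS: "ball_int R S \<le> 3 * (16 * v + 2 * N) * R powr (2 - a / 2)"
    proof -
      have "ball_int R S \<le> ball_int (2 * R) S" using R0 by (intro ball_int_subset cS S0) auto
      also have "\<dots> = (\<Sum>i\<in>UNIV. ball_int (2 * R) (\<lambda>x. (U i x)\<^sup>2 + (V i x)\<^sup>2))"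
        unfolding S_def by (intro ball_int_sum continuous_intros cUV) auto
      also have "\<dots> \<le> 3 * ((16 * v + 2 * N) * R powr (3 - 6 / q))"
      proof (rule sum3)
        fix i
        have "ball_int (2 * R) (\<lambda>x. (U i x)\<^sup>2 + (V i x)\<^sup>2) = ball_int (2 * R) (\<lambda>x. (U i x)\<^sup>2) + ball_int (2 * R) (\<lambda>x. (V i x)\<^sup>2)"
          by (intro ball_int_add continuous_intros cUV)
        also have "\<dots> \<le> (8 * v + N) * R powr (3 - 6 / q) + (8 * v + N) * R powr (3 - 6 / q)"
          unfolding U_def V_def v_def
          by (intro add_mono ball_int_component_square N cvec smooth q R)
        finally show "ball_int (2 * R) (\<lambda>x. (U i x)\<^sup>2 + (V i x)\<^sup>2) \<le> (16 * v + 2 * N) * R powr (3 - 6 / q)"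
          by (simp add: algebra_simps)
      qed
      also have "\<dots> \<le> 3 * ((16 * v + 2 * N) * R powr (2 - a / 2))"
        using R a v0 N(1) by (intro mult_left_mono powr_mono) auto
      finally show ?thesis by (simp only: mult.assoc)
    qed
    have bSD: "ball_int R (\<lambda>x. S x * D x) \<le> 108 * (Kt * (1 + N)) * R powr (2 - a / 2)"
    proof -
      let ?t = "\<lambda>l i j x. ((U l x)\<^sup>2 * (d i j x)\<^sup>2 + (U l x)\<^sup>2 * (h i j x)\<^sup>2) + ((V l x)\<^sup>2 * (d i j x)\<^sup>2 + (V l x)\<^sup>2 * (h i j x)\<^sup>2)"
      have ct: "continuous_on UNIV (?t l i j)" for l i j by (intro continuous_intros cUV cdh)
      have SD: "(\<lambda>x. S x * D x) = (\<lambda>x. \<Sum>l\<in>UNIV. \<Sum>i\<in>UNIV. \<Sum>j\<in>UNIV. ?t l i j x)"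
        unfolding S_def D_def by (simp only: sum_distrib_left sum_distrib_right distrib_left distrib_right fun_eq_iff) (simp add: sum_3)
      have "ball_int R (\<lambda>x. S x * D x) \<le> ball_int (2 * R) (\<lambda>x. S x * D x)"
        using R0 by (intro ball_int_subset continuous_intros cS cD mult_nonneg_nonneg S0 D0) auto
      also have "ball_int (2 * R) (\<lambda>x. S x * D x) = (\<Sum>l\<in>UNIV. \<Sum>i\<in>UNIV. \<Sum>j\<in>UNIV. ball_int (2 * R) (?t l i j))"
        unfolding SD by (subst ball_int_sum, simp, intro continuous_on_sum ct, intro sum.cong refl)+
      also have "\<dots> \<le> 3 * (3 * (3 * (4 * (Kt * (1 + N) * Y))))"
      proof (intro sum3)
        fix l i j
        have "ball_int (2 * R) (?t l i j) = (ball_int (2 * R) (\<lambda>x. (U l x)\<^sup>2 * (d i j x)\<^sup>2) + ball_int (2 * R) (\<lambda>x. (U l x)\<^sup>2 * (h i j x)\<^sup>2))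
            + (ball_int (2 * R) (\<lambda>x. (V l x)\<^sup>2 * (d i j x)\<^sup>2) + ball_int (2 * R) (\<lambda>x. (V l x)\<^sup>2 * (h i j x)\<^sup>2))"
        proof -
          note t = continuous_on_mult continuous_on_power cUV cdh
          have c4: "continuous_on UNIV (\<lambda>x. (U l x)\<^sup>2 * (d i j x)\<^sup>2)" "continuous_on UNIV (\<lambda>x. (U l x)\<^sup>2 * (h i j x)\<^sup>2)"
            "continuous_on UNIV (\<lambda>x. (V l x)\<^sup>2 * (d i j x)\<^sup>2)" "continuous_on UNIV (\<lambda>x. (V l x)\<^sup>2 * (h i j x)\<^sup>2)"
            by (intro t)+
          show ?thesis
            by (simp only: ball_int_add[OF continuous_on_add[OF c4(1,2)] continuous_on_add[OF c4(3,4)]] ball_int_add[OF c4(1,2)] ball_int_add[OF c4(3,4)])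
        qed
        also have "\<dots> \<le> (Kt * (1 + N) * Y + Kt * (1 + N) * Y) + (Kt * (1 + N) * Y + Kt * (1 + N) * Y)"
          unfolding U_def V_def by (intro add_mono cross cvec smooth N)
        also have "\<dots> = 4 * (Kt * (1 + N) * Y)" by simp
        finally show "ball_int (2 * R) (?t l i j) \<le> 4 * (Kt * (1 + N) * Y)" .
      qed
      also have "\<dots> = 108 * (Kt * (1 + N)) * Y" by simp
      also have "\<dots> \<le> 108 * (Kt * (1 + N)) * R powr (2 - a / 2)"
        unfolding Y_def using R a Kt N(1) by (intro mult_left_mono powr_mono) auto
      finally show ?thesis .
    qed
    have bE: "ball_int R E \<le> 9 * Kt * R powr (2 - a / 2)"
    proof -
      have "ball_int R E = (\<Sum>i\<in>UNIV. \<Sum>j\<in>UNIV. ball_int R (\<lambda>x. \<Sum>k\<in>UNIV. (pd k (d i j) x)\<^sup>2))"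
        unfolding E_def
        by (subst ball_int_sum, simp, intro continuous_intros cdh, intro sum.cong refl)+
      also have "\<dots> \<le> 3 * (3 * (Kt * R powr (2 - a / 2)))" by (intro sum3 dgrad)
      finally show ?thesis by simp
    qed
    have bD: "ball_int R D \<le> 18 * (Kt * (1 + 8 * v)) * R powr (3 + a / 2)"
    proof -
      \<comment> \<open>For the unweighted squares the weight is the constant 1, with
        \<open>L = 8 * v\<close>.\<close>
      have one: "(\<integral>\<^sup>+x. ennreal (indicator (cball (0 :: real ^ 3) (2 * R)) x * 1 powr q) \<partial>lborel) \<le> ennreal (8 * v * R ^ 3)"
        using emeasure_cball_scale[of "2 * R" "0 :: real ^ 3"] R by (simp add: v_def power_mult_distrib ennreal_indicator mult_ac)
      have b1: "ball_int (2 * R) (\<lambda>x. (d i j x)\<^sup>2) \<le> Kt * (1 + 8 * v) * R powr (3 + a / 2)"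
        "ball_int (2 * R) (\<lambda>x. (h i j x)\<^sup>2) \<le> Kt * (1 + 8 * v) * R powr (3 + a / 2)" for i j
        using dg(1)[OF _ _ _ one, of i j] dg(2)[OF _ _ _ one, of i j] v0 by simp_all
      have "ball_int R D \<le> ball_int (2 * R) D" using R0 by (intro ball_int_subset cD D0) auto
      also have "\<dots> = (\<Sum>i\<in>UNIV. \<Sum>j\<in>UNIV. ball_int (2 * R) (\<lambda>x. (d i j x)\<^sup>2 + (h i j x)\<^sup>2))"
        unfolding D_def
        by (subst ball_int_sum, simp, intro continuous_intros cdh, intro sum.cong refl)+
      also have "\<dots> \<le> 3 * (3 * (2 * (Kt * (1 + 8 * v) * R powr (3 + a / 2))))"
      proof (intro sum3)
        fix i j
        have "ball_int (2 * R) (\<lambda>x. (d i j x)\<^sup>2 + (h i j x)\<^sup>2) = ball_int (2 * R) (\<lambda>x. (d i j x)\<^sup>2) + ball_int (2 * R) (\<lambda>x. (h i j x)\<^sup>2)"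
          by (intro ball_int_add continuous_intros cdh)
        with b1[of i j] show "ball_int (2 * R) (\<lambda>x. (d i j x)\<^sup>2 + (h i j x)\<^sup>2) \<le> 2 * (Kt * (1 + 8 * v) * R powr (3 + a / 2))" by simp
      qed
      finally show ?thesis by simp
    qed
    define Z where "Z = ball_int R (\<lambda>x. (S x + S x * D x + E x) / R\<^sup>2 + D x / R ^ 4)"
    have "Z = 1 / R\<^sup>2 * (ball_int R S + ball_int R (\<lambda>x. S x * D x) + ball_int R E) + 1 / R ^ 4 * ball_int R D"
    proof -
      have "Z = ball_int R (\<lambda>x. 1 / R\<^sup>2 * (S x + S x * D x + E x) + 1 / R ^ 4 * D x)"
        by (simp add: Z_def)
      also have "\<dots> = ball_int R (\<lambda>x. 1 / R\<^sup>2 * (S x + S x * D x + E x)) + ball_int R (\<lambda>x. 1 / R ^ 4 * D x)"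
        by (intro ball_int_add continuous_on_mult continuous_on_add continuous_on_const cS cD cE)
      also have "\<dots> = 1 / R\<^sup>2 * ball_int R (\<lambda>x. S x + S x * D x + E x) + 1 / R ^ 4 * ball_int R D"
        by (simp only: ball_int_cmult)
      also have "ball_int R (\<lambda>x. S x + S x * D x + E x) = ball_int R (\<lambda>x. S x + S x * D x) + ball_int R E"
        by (intro ball_int_add continuous_on_mult continuous_on_add cS cD cE)
      also have "ball_int R (\<lambda>x. S x + S x * D x) = ball_int R S + ball_int R (\<lambda>x. S x * D x)"
        by (intro ball_int_add continuous_on_mult cS cD)
      finally show ?thesis .
    qed
    also have "\<dots> \<le> 1 / R\<^sup>2 * (3 * (16 * v + 2 * N) * R powr (2 - a / 2) + 108 * (Kt * (1 + N)) * R powr (2 - a / 2) + 9 * Kt * R powr (2 - a / 2))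
        + 1 / R ^ 4 * (18 * (Kt * (1 + 8 * v)) * R powr (3 + a / 2))"
      by (intro add_mono mult_left_mono bS bSD bE bD) auto
    also have "\<dots> = (3 * (16 * v + 2 * N) + 108 * (Kt * (1 + N)) + 9 * Kt) * (R powr (2 - a / 2) / R\<^sup>2)
        + 18 * (Kt * (1 + 8 * v)) * (R powr (3 + a / 2) / R ^ 4)"
      by (simp add: algebra_simps add_divide_distrib)
    also have "\<dots> \<le> (3 * (16 * v + 2 * N) + 108 * (Kt * (1 + N)) + 9 * Kt) * R powr - (a / 2)
        + 18 * (Kt * (1 + 8 * v)) * R powr - (a / 2)"
    proof (intro add_mono mult_left_mono)
      have "R powr (2 - a / 2) / R\<^sup>2 = R powr (2 - a / 2 - 2)"
        using R0 by (simp only: powr_diff[of R "2 - a / 2" 2] powr_numeral)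
      then show "R powr (2 - a / 2) / R\<^sup>2 \<le> R powr - (a / 2)" by simp
      have "R powr (3 + a / 2) / R ^ 4 = R powr (3 + a / 2 - 4)"
        using R0 by (simp only: powr_diff[of R "3 + a / 2" 4] powr_numeral)
      also have "\<dots> \<le> R powr - (a / 2)" using R a by (intro powr_mono) auto
      finally show "R powr (3 + a / 2) / R ^ 4 \<le> R powr - (a / 2)" .
    qed (use v0 N(1) Kt in auto)
    also have "\<dots> = Q * R powr - (a / 2)" by (simp add: Q_def algebra_simps)
    finally have Z: "Z \<le> Q * R powr - (a / 2)" .
    have "(\<integral>x. (cutoff R x) ^ 4 * G x \<partial>lborel) \<le> 4 * (2592 * A\<^sup>2)\<^sup>2 * Z"
      unfolding Z_def ball_int_def
    proof (rule energy_estimate[OF UV2 smooth_C2[OF p] d1 dsk ddiv mom ind])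
      show "C2 (cutoff R :: real ^ 3 \<Rightarrow> real)" by (rule cutoff_C2)
      show "cutoff R x = 0" if "R < norm x" for x :: "real ^ 3" using R0 that by (rule cutoff_outside)
      show "\<bar>cutoff R x\<bar> \<le> A" for x :: "real ^ 3" by (simp add: cutoff_def A(2))
      show "\<bar>pd k (cutoff R) x\<bar> \<le> A / R" for k and x :: "real ^ 3"
        unfolding pd_cutoff using A(3)[of k "(1 / R) *\<^sub>R x"] R0 by (simp only: abs_mult) (simp add: divide_right_mono)
      show "\<bar>pd k (pd j (cutoff R)) x\<bar> \<le> A / R\<^sup>2" for j k and x :: "real ^ 3"
        unfolding pd_pd_cutoff using A(4)[of k j "(1 / R) *\<^sub>R x"] R0 by (simp only: abs_mult) (simp add: divide_right_mono)
    qed (use R0 in \<open>simp_all add: G_def S_def D_def E_def\<close>)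
    also have "\<dots> \<le> 4 * (2592 * A\<^sup>2)\<^sup>2 * (Q * R powr - (a / 2))"
      by (rule mult_left_mono[OF Z]) simp
    finally show ?thesis .
  qed
  \<comment> \<open>If \<open>G\<close> were positive somewhere, the localised energies would stay
    above a fixed positive number for all large \<open>R\<close>, contradicting
    \<open>decay\<close>.\<close>
  have Gz: "G x0 = 0" for x0
  proof (rule ccontr)
    assume "G x0 \<noteq> 0"
    then have pos: "0 < G x0" using G0[of x0] by simp
    have "isCont G x0" using cG by (simp add: continuous_on_eq_continuous_at)
    then obtain \<epsilon> where \<epsilon>: "0 < \<epsilon>" "\<And>y. dist y x0 < \<epsilon> \<Longrightarrow> dist (G y) (G x0) < G x0 / 2"
      using pos unfolding continuous_at_eps_delta by (meson half_gt_zero)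
    let ?B = "cball x0 (\<epsilon> / 2)"
    have GB: "G x0 / 2 \<le> G y" if "y \<in> ?B" for y
    proof -
      have "dist y x0 < \<epsilon>" using that \<epsilon>(1) by (simp add: dist_commute)
      then have "\<bar>G y - G x0\<bar> < G x0 / 2" using \<epsilon>(2) by (simp add: dist_real_def)
      then show ?thesis by linarith
    qed
    \<comment> \<open>The cutoff enters with power 4 and is at least \<open>c\<close> near
      \<open>x0\<close> for large \<open>R\<close>, while \<open>G\<close> keeps half of its value
      on the small ball.\<close>
    define \<delta> where "\<delta> = c ^ 4 * (G x0 / 2) * measure lborel ?B"
    have "0 < measure lborel ?B" using \<epsilon>(1) by (intro content_cball_pos) simp
    then have \<delta>: "0 < \<delta>" using c(1) pos by (simp add: \<delta>_def)
    \<comment> \<open>This size of \<open>R\<close> puts the small ball into the ball of radius R/2,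
      where the lower bound on the cutoff holds.\<close>
    have lower: "\<delta> \<le> (\<integral>x. (cutoff R x) ^ 4 * G x \<partial>lborel)" if R: "2 * (norm x0 + \<epsilon>) \<le> R" for R
    proof -
      have "0 < 2 * (norm x0 + \<epsilon>)" using add_nonneg_pos[OF norm_ge_zero[of x0] \<epsilon>(1)] by simp
      then have R0: "0 < R" using R by (rule less_le_trans)
      have "\<delta> = (\<integral>x. indicator ?B x *\<^sub>R (c ^ 4 * (G x0 / 2)) \<partial>lborel)"
        using emeasure_compact_finite[OF compact_cball, of x0 "\<epsilon> / 2"] by (simp add: \<delta>_def mult.commute)
      also have "\<dots> \<le> (\<integral>x. (cutoff R x) ^ 4 * G x \<partial>lborel)"
      proof (rule integral_mono)
        show "integrable lborel (\<lambda>x. indicator ?B x *\<^sub>R (c ^ 4 * (G x0 / 2)))"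
          by (intro borel_integrable_compact continuous_intros) auto
        show "integrable lborel (\<lambda>x. (cutoff R x) ^ 4 * G x)"
          by (rule integrable_continuous_support[of _ R])
             (intro continuous_intros cG C1_continuous C2_C1 cutoff_C2, simp add: cutoff_outside[OF R0])
        fix x
        show "indicator ?B x *\<^sub>R (c ^ 4 * (G x0 / 2)) \<le> (cutoff R x) ^ 4 * G x"
        proof (cases "x \<in> ?B")
          case False
          then show ?thesis using G0[of x] by simp
        next
          case True
          have "norm x \<le> norm x0 + dist x0 x" using norm_triangle_ineq2[of x x0] by (simp add: dist_norm norm_minus_commute)
          then have "norm x \<le> R / 2" using True R \<epsilon>(1) by simp
          then have "norm ((1 / R) *\<^sub>R x) \<le> 1 / 2" using R0 by (simp add: field_simps)
          then have "c ^ 4 \<le> (cutoff R x) ^ 4" unfolding cutoff_def using c by (intro power_mono) auto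
          then have "c ^ 4 * (G x0 / 2) \<le> (cutoff R x) ^ 4 * G x"
            using GB[OF True] pos by (intro mult_mono) auto
          then show ?thesis using True by simp
        qed
      qed
      finally show ?thesis .
    qed
    have "((\<lambda>R. 4 * (2592 * A\<^sup>2)\<^sup>2 * (Q * R powr - (a / 2))) \<longlongrightarrow> 4 * (2592 * A\<^sup>2)\<^sup>2 * (Q * 0)) at_top"
      using a by (intro tendsto_intros tendsto_neg_powr filterlim_ident) auto
    then have "\<forall>\<^sub>F R in at_top. 4 * (2592 * A\<^sup>2)\<^sup>2 * (Q * R powr - (a / 2)) < \<delta>"
      using \<delta> by (intro order_tendstoD) auto
    moreover have "\<forall>\<^sub>F R in at_top. max 1 (2 * (norm x0 + \<epsilon>)) \<le> R" by (rule eventually_ge_at_top)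
    ultimately have "\<forall>\<^sub>F R :: real in at_top. False"
    proof eventually_elim
      case (elim R)
      then show False using decay[of R] lower[of R] by simp
    qed
    then show False by simp
  qed
  have z: "pd k (U i) x = 0 \<and> pd k (V i) x = 0" for i k x
  proof -
    have "(pd k (U i) x)\<^sup>2 + (pd k (V i) x)\<^sup>2 \<le> G x"
      unfolding G_def by (rule member_le_double_sum[of "\<lambda>i k. (pd k (U i) x)\<^sup>2 + (pd k (V i) x)\<^sup>2"]) auto
    then show ?thesis using Gz[of x] by (simp add: sum_power2_le_zero_iff)
  qed
  have "u x = 0" for x
    by (rule zero_gradient_Lebesgue_space[OF smooth(1) _ N(2)]) (use z in \<open>simp add: U_def\<close>)
  moreover have "H x = 0" for x
    by (rule zero_gradient_Lebesgue_space[OF smooth(2) _ N(3)]) (use z in \<open>simp add: V_def\<close>)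
  ultimately show ?thesis by blast
qed

end
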